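(* Suppose $m_+(x)/m(x)\to0$ as $x\to\infty$. Then, as $Q\wedge R\to\infty$, $$P\big[\sigma^x_{\mathbb Z\setminus(-Q,R)}<\sigma^x_0\big]\ \sim\ a^\dagger(x)\big(1-H^0_{B(Q,R)}(0)\big)\ \sim\ a^\dagger(x)\,\frac{a(Q+R)}{a(Q)a(R)}$$ uniformly for integers $-Q<x<R$ subject to the condition $$|a(Q)-a(x+Q)|+|a(-R)-a(x-R)|=o(a^\dagger(x)).$$
   Context: Let $X,X_1,X_2,\dots$ be i.i.d. integer-valued random variables, $S_n=X_1+\dots+X_n$, $S_0=0$, and $S^x_n=x+S_n$ for $x\in\mathbb Z$. Standing assumptions: the random walk is irreducible on $\mathbb Z$, $EX=0$, $EX^2=\infty$, and $P[X\ge2]>0$. The potential function is $a(x)=\sum_{n=0}^\infty\big(P[S_n=0]-P[S_n=-x]\big)$ (the series converges), and $a^\dagger(x)=\delta_{x,0}+a(x)$ with $\delta_{x,0}$ the Kronecker delta. For real $x\ge0$: $\mu_-(x)=P[X<-x]$, $\mu_+(x)=P[X>x]$; $\eta_\pm(x)=\int_x^\infty\mu_\pm(y)\,dy$; $m_\pm(x)=\int_0^x\eta_\pm(s)\,ds$, $m=m_++m_-$. $\sigma^x_B=\inf\{n\ge1:S^x_n\in B\}$, $\sigma^x_0=\sigma^x_{\{0\}}$. $Q,R$ denote positive integers, $Q\wedge R=\min(Q,R)$; $\mathbb Z\setminus(-Q,R)$ is the set of integers in $(-\infty,-Q]\cup[R,\infty)$; $B(Q,R)=\{-Q,0,R\}$;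 $H^x_B(y)=P[S^x_{\sigma^x_B}=y]$, $y\in B$, is the hitting distribution of $B$. "$f\sim g$ uniformly subject to the condition" means: for every $\varepsilon>0$ there are $\delta>0$ and $N$ such that $|f/g-1|<\varepsilon$ whenever $Q\wedge R\ge N$, $-Q<x<R$, $a^\dagger(x)\neq0$ and $|a(Q)-a(x+Q)|+|a(-R)-a(x-R)|\le\delta\,a^\dagger(x)$. *)

theory Defs
  imports "HOL-Probability.Probability"
begin

text \<open>
  A sequence \<open>X :: nat \<Rightarrow> 'a \<Rightarrow> int\<close> carries the whole family of the walk: \<open>X 0\<close> is the generic
  variable \<open>X\<close> and \<open>X 1, X 2, \<dots>\<close> are the increments, so \<open>X 0\<close> does not enter the partial sums.
\<close>

definition iid :: "'a measure \<Rightarrow> (nat \<Rightarrow> 'a \<Rightarrow> int) \<Rightarrow> bool" where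
  "iid M X \<longleftrightarrow>
     prob_space.indep_vars M (\<lambda>_. count_space UNIV) X UNIV \<and>
     (\<forall>n. distr M (count_space UNIV) (X n) = distr M (count_space UNIV) (X 0))"

definition walk :: "(nat \<Rightarrow> 'a \<Rightarrow> int) \<Rightarrow> int \<Rightarrow> nat \<Rightarrow> 'a \<Rightarrow> int" where
  "walk X x n \<omega> = x + (\<Sum>k=1..n. X k \<omega>)"

definition irreducible_walk :: "'a measure \<Rightarrow> (nat \<Rightarrow> 'a \<Rightarrow> int) \<Rightarrow> bool" where
  "irreducible_walk M X \<longleftrightarrow>
     (\<forall>x y. \<exists>n. measure M {\<omega> \<in> space M. walk X x n \<omega> = y} > 0)"

definition potential :: "'a measure \<Rightarrow> (nat \<Rightarrow> 'a \<Rightarrow> int) \<Rightarrow> int \<Rightarrow> real" where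
  "potential M X x =
     (\<Sum>n. measure M {\<omega> \<in> space M. walk X 0 n \<omega> = 0}
         - measure M {\<omega> \<in> space M. walk X 0 n \<omega> = - x})"

definition potential_dagger :: "'a measure \<Rightarrow> (nat \<Rightarrow> 'a \<Rightarrow> int) \<Rightarrow> int \<Rightarrow> real" where
  "potential_dagger M X x = (if x = 0 then 1 else 0) + potential M X x"

definition mu_minus :: "'a measure \<Rightarrow> (nat \<Rightarrow> 'a \<Rightarrow> int) \<Rightarrow> real \<Rightarrow> real" where
  "mu_minus M X x = measure M {\<omega> \<in> space M. real_of_int (X 0 \<omega>) < - x}"

definition mu_plus :: "'a measure \<Rightarrow> (nat \<Rightarrow> 'a \<Rightarrow> int) \<Rightarrow> real \<Rightarrow> real" where
  "mu_plus M X x = measure M {\<omega> \<in> space M. real_of_int (X 0 \<omega>) > x}"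

definition eta_minus :: "'a measure \<Rightarrow> (nat \<Rightarrow> 'a \<Rightarrow> int) \<Rightarrow> real \<Rightarrow> real" where
  "eta_minus M X x = (LINT y:{x..}|lborel. mu_minus M X y)"

definition eta_plus :: "'a measure \<Rightarrow> (nat \<Rightarrow> 'a \<Rightarrow> int) \<Rightarrow> real \<Rightarrow> real" where
  "eta_plus M X x = (LINT y:{x..}|lborel. mu_plus M X y)"

definition m_minus :: "'a measure \<Rightarrow> (nat \<Rightarrow> 'a \<Rightarrow> int) \<Rightarrow> real \<Rightarrow> real" where
  "m_minus M X x = (LINT s:{0..x}|lborel. eta_minus M X s)"

definition m_plus :: "'a measure \<Rightarrow> (nat \<Rightarrow> 'a \<Rightarrow> int) \<Rightarrow> real \<Rightarrow> real" where
  "m_plus M X x = (LINT s:{0..x}|lborel. eta_plus M X s)"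

definition m_total :: "'a measure \<Rightarrow> (nat \<Rightarrow> 'a \<Rightarrow> int) \<Rightarrow> real \<Rightarrow> real" where
  "m_total M X x = m_plus M X x + m_minus M X x"

text \<open>The infimum is taken in \<open>enat\<close>, so a set that is never hit has hitting time \<open>\<infinity>\<close>.\<close>

definition hitting_time :: "(nat \<Rightarrow> 'a \<Rightarrow> int) \<Rightarrow> int \<Rightarrow> int set \<Rightarrow> 'a \<Rightarrow> enat" where
  "hitting_time X x B \<omega> = Inf {enat n | n. 1 \<le> n \<and> walk X x n \<omega> \<in> B}"

text \<open>Paths that never hit \<open>B\<close> contribute no mass to the hitting distribution.\<close>

definition hitting_distribution ::
    "'a measure \<Rightarrow> (nat \<Rightarrow> 'a \<Rightarrow> int) \<Rightarrow> int \<Rightarrow> int set \<Rightarrow> int \<Rightarrow> real" where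
  "hitting_distribution M X x B y =
     measure M {\<omega> \<in> space M. \<exists>n. hitting_time X x B \<omega> = enat n \<and> walk X x n \<omega> = y}"

text \<open>
  \<open>f Q R x \<sim> g Q R x\<close> as \<open>min Q R \<rightarrow> \<infinity>\<close>, uniformly for \<open>-Q < x < R\<close> subject to
  \<open>\<bar>a(Q) - a(x+Q)\<bar> + \<bar>a(-R) - a(x-R)\<bar> = o(a\<^sup>\<dagger>(x))\<close>. As \<open>u / 0 = 0\<close>, the bound for
  \<open>\<epsilon> \<le> 1\<close> also forces \<open>g Q R x \<noteq> 0\<close> in the range considered.
\<close>

definition asymp_equiv_subject ::
    "'a measure \<Rightarrow> (nat \<Rightarrow> 'a \<Rightarrow> int) \<Rightarrow>
     (int \<Rightarrow> int \<Rightarrow> int \<Rightarrow> real) \<Rightarrow> (int \<Rightarrow> int \<Rightarrow> int \<Rightarrow> real) \<Rightarrow> bool" where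
  "asymp_equiv_subject M X f g \<longleftrightarrow>
     (\<forall>\<epsilon>>0. \<exists>\<delta>>0. \<exists>N. \<forall>Q R x.
        0 < Q \<longrightarrow> 0 < R \<longrightarrow> min Q R \<ge> N \<longrightarrow> - Q < x \<longrightarrow> x < R \<longrightarrow>
        potential_dagger M X x \<noteq> 0 \<longrightarrow>
        \<bar>potential M X Q - potential M X (x + Q)\<bar>
          + \<bar>potential M X (- R) - potential M X (x - R)\<bar> \<le> \<delta> * potential_dagger M X x \<longrightarrow>
        \<bar>f Q R x / g Q R x - 1\<bar> < \<epsilon>)"

end

theory Submission
  imports Defs
begin

text \<open>
  Write \<open>b(x) = a(x) + a(-x)\<close>, \<open>e(n) = E(\<bar>X\<bar> - n)\<^sup>+\<close> and \<open>M(n) = e(0) + \<dots> + e(n - 1)\<close>,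
  which replaces \<open>m\<close>. Fourier inversion gives \<open>b(n) \<le> C n / M(n)\<close>, and testing the Green kernel
  against a tent function gives \<open>n / M(n) \<le> 8 b(n)\<close>. For a finite set \<open>B \<ni> 0\<close> the hitting
  distribution is determined by linear identities in \<open>a\<close>; for \<open>B = {0, R}\<close> they give
  \<open>b(R) P\<^sup>x[\<sigma>\<^sub>R < \<sigma>\<^sub>0] = a\<^sup>\<dagger>(x) + a(-R) - a(x - R)\<close>. The core is that
  \<open>P[\<sigma>\<^sub>R < \<sigma>\<^sub>0]\<close>, started at \<open>-w\<close>, tends to \<open>0\<close> uniformly in \<open>w \<ge> 0\<close>: summing over the
  jump across \<open>0\<close> bounds it by a double sum against the positive tail, which is
  negligible as \<open>m\<^sub>+ / m \<rightarrow> 0\<close> as long as \<open>M(w) \<le> L M(R)\<close>; averaging over a window of such \<open>w\<close>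
  gives \<open>a(-R) = o(b(R))\<close>, and the strong Markov property covers the larger \<open>w\<close>. The identities
  for \<open>{-Q, 0, R}\<close> then yield both asymptotics for \<open>1 - H\<^sub>B(0)\<close>. Exits below \<open>-Q\<close>
  rarely return to \<open>0\<close> before hitting \<open>-Q\<close>; exits above \<open>R\<close> are controlled by
  superharmonicity of \<open>a\<close> off \<open>0\<close>.
\<close>

section \<open>Hitting probabilities\<close>

text \<open>The two bounds for \<open>b\<close> agree only up to constants, and no regular variation
  is available, so no ratio of potentials can be read off from them. Smallness has to come from
  \<open>m_+ / m\<close>, and this enters only through the jump across 0 and only while
  \<open>M(w) / M(R)\<close> stays bounded. A free constant \<open>L\<close> resolves this: after
  averaging over the longest window \<open>[0, W)\<close> with \<open>M \<le> L M(R)\<close>, about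
  \<open>R\<close> boundary terms remain against \<open>W\<close> averaged ones, at a relative cost
  of order \<open>R f(W) / (W f(R)) = M(R) / M(W) \<le> 2 / L\<close>, where
  \<open>f(n) = n / M(n)\<close>.

  The walk is recurrent and its Green function infinite. Identities are therefore proved for a walk
  killed with probability \<open>1 - r\<close> per step, where the potential is a difference of two
  finite Green functions, and carried to \<open>r = 1\<close> by Abel's theorem. Recurrence itself
  is a consequence of \<open>f(n) \<rightarrow> \<infinity>\<close>.

  On the Fourier side \<open>t / |1 - \<phi>|\<close> need not be integrable at 0, since
  \<open>M\<close> may grow slowly. The partial sums of the potential are dominated only after the
  imaginary part of the geometric sum is estimated in terms of \<open>Im \<phi>\<close>.\<close>

text \<open>\<open>taboo P D x n y\<close> is the probability of being at \<open>y\<close> at time \<open>n + 1\<close>, having avoided \<open>D\<close> at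
  the times \<open>1, \<dots>, n\<close>.\<close>

primrec taboo :: "int pmf \<Rightarrow> int set \<Rightarrow> int \<Rightarrow> nat \<Rightarrow> int \<Rightarrow> ennreal" where
  "taboo P D x 0 y = ennreal (pmf P (y - x))"
| "taboo P D x (Suc n) y =
    (\<integral>\<^sup>+z. taboo P D x n z * indicator (-D) z * ennreal (pmf P (y - z)) \<partial>count_space UNIV)"

lemma nn_integral_pmf_diff: "(\<integral>\<^sup>+y. ennreal (pmf P (y - z)) \<partial>count_space UNIV) = 1" for z :: int
proof -
  have "(\<integral>\<^sup>+y. ennreal (pmf P (y - z)) \<partial>count_space UNIV) = (\<integral>\<^sup>+y. ennreal (pmf P y) \<partial>count_space UNIV)"
    by (rule nn_integral_bij_count_space) (auto simp: bij_betw_def inj_on_def intro!: image_eqI[of _ _ "_ + z"])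
  also have "\<dots> = 1"
    using nn_integral_measure_pmf[of P "\<lambda>_. 1"] by simp
  finally show ?thesis .
qed

lemma nn_integral_count_space_swap:
  fixes f :: "'a::countable \<Rightarrow> 'b::countable \<Rightarrow> ennreal"
  shows "(\<integral>\<^sup>+x. \<integral>\<^sup>+y. f x y \<partial>count_space UNIV \<partial>count_space UNIV) =
         (\<integral>\<^sup>+y. \<integral>\<^sup>+x. f x y \<partial>count_space UNIV \<partial>count_space UNIV)"
  by (subst nn_integral_count_space_nn_integral) auto

text \<open>Markov property at the first visit to \<open>D'\<close>: if it falls on time
  \<open>k + 1\<close>, at a point outside \<open>D\<close>, then \<open>n - k\<close> steps remain,
  which \<open>taboo\<close> indexes as \<open>n - Suc k\<close>.\<close>

lemma taboo_decomp:
  assumes "D \<subseteq> D'"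
  shows "taboo P D x n y = taboo P D' x n y + (\<Sum>k<n. \<integral>\<^sup>+z. taboo P D' x k z * indicator (D' - D) z *
           taboo P D z (n - Suc k) y \<partial>count_space UNIV)"
proof (induction n arbitrary: y)
  case 0
  then show ?case by simp
next
  case (Suc n)
  define S where "S k z = taboo P D' x k z * indicator (D' - D) z" for k z
  \<comment> \<open>Three cases for the position before the last step: \<open>D'\<close> not yet
    visited, visited for the first time just now, visited earlier.\<close>
  have "taboo P D x (Suc n) y =
     (\<integral>\<^sup>+z. taboo P D' x n z * indicator (-D') z * ennreal (pmf P (y - z)) \<partial>count_space UNIV)
     + (\<integral>\<^sup>+z. S n z * ennreal (pmf P (y - z)) \<partial>count_space UNIV)
     + (\<integral>\<^sup>+z. (\<Sum>k<n. \<integral>\<^sup>+z'. S k z' * taboo P D z' (n - Suc k) z \<partial>count_space UNIV)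
          * indicator (-D) z * ennreal (pmf P (y - z)) \<partial>count_space UNIV)"
    (is "_ = nn_integral _ ?f + nn_integral _ ?g + nn_integral _ ?h")
  proof -
    have "taboo P D x (Suc n) y = (\<integral>\<^sup>+z. ?f z + ?g z + ?h z \<partial>count_space UNIV)"
      unfolding taboo.simps Suc.IH S_def
      by (intro nn_integral_cong) (use assms in \<open>auto simp: indicator_def distrib_left distrib_right\<close>)
    then show ?thesis by (simp add: nn_integral_add)
  qed
  also have "(\<integral>\<^sup>+z. (\<Sum>k<n. \<integral>\<^sup>+z'. S k z' * taboo P D z' (n - Suc k) z \<partial>count_space UNIV)
          * indicator (-D) z * ennreal (pmf P (y - z)) \<partial>count_space UNIV)
       = (\<Sum>k<n. \<integral>\<^sup>+z. \<integral>\<^sup>+z'. S k z' * (taboo P D z' (n - Suc k) z 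
          * indicator (-D) z * ennreal (pmf P (y - z))) \<partial>count_space UNIV \<partial>count_space UNIV)"
  proof -
    have "(\<Sum>k<n. \<integral>\<^sup>+z'. S k z' * taboo P D z' (n - Suc k) z \<partial>count_space UNIV)
          * indicator (-D) z * ennreal (pmf P (y - z)) =
        (\<Sum>k<n. \<integral>\<^sup>+z'. S k z' * (taboo P D z' (n - Suc k) z 
          * indicator (-D) z * ennreal (pmf P (y - z))) \<partial>count_space UNIV)" for z
      unfolding sum_distrib_right mult.assoc[symmetric]
      by (intro sum.cong refl, subst nn_integral_multc[symmetric], simp)
         (subst nn_integral_multc[symmetric], auto)
    then show ?thesis by (simp add: nn_integral_sum)
  qed
  also have "\<dots> = (\<Sum>k<n. \<integral>\<^sup>+z'. S k z' * taboo P D z' (n - k) y \<partial>count_space UNIV)"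
  proof (rule sum.cong[OF refl])
    fix k assume "k \<in> {..<n}"
    then have k: "n - k = Suc (n - Suc k)" by auto
    show "(\<integral>\<^sup>+z. \<integral>\<^sup>+z'. S k z' * (taboo P D z' (n - Suc k) z 
          * indicator (-D) z * ennreal (pmf P (y - z))) \<partial>count_space UNIV \<partial>count_space UNIV)
       = (\<integral>\<^sup>+z'. S k z' * taboo P D z' (n - k) y \<partial>count_space UNIV)"
      unfolding k taboo.simps by (subst nn_integral_count_space_swap) (simp add: nn_integral_cmult)
  qed
  finally show ?case
    by (simp add: S_def[symmetric] Suc_diff_Suc add.assoc add.commute[of "sum _ {..<n}"])
qed

text \<open>For \<open>y \<in> D\<close> and \<open>r = 1\<close> this is the hitting distribution
  of \<open>D\<close>; for \<open>y\<close> outside \<open>D\<close> it is the Green function of the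
  walk killed on \<open>D\<close>, without time 0. The weight \<open>r ^ Suc n\<close> stands for
  geometric killing. Values in \<open>ennreal\<close> make every rearrangement of sums
  unconditional.\<close>

definition hits :: "int pmf \<Rightarrow> real \<Rightarrow> int set \<Rightarrow> int \<Rightarrow> int \<Rightarrow> ennreal" where
  "hits P r D x y = (\<Sum>n. ennreal (r ^ Suc n) * taboo P D x n y)"

text \<open>Legs of \<open>k + 1\<close> and \<open>j + 1\<close> steps make a path of
  \<open>n + 1\<close> steps with \<open>n = k + 1 + j\<close>, hence the shifted index.\<close>

lemma suminf_convolution_ennreal:
  fixes c :: "nat \<Rightarrow> nat \<Rightarrow> ennreal"
  shows "(\<Sum>n. \<Sum>k<n. c k (n - Suc k)) = (\<Sum>k. \<Sum>j. c k j)"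
proof -
  have "(\<Sum>n. \<Sum>k<n. c k (n - Suc k)) = (\<Sum>n. \<Sum>k. if k < n then c k (n - Suc k) else 0)"
    by (intro suminf_cong, subst suminf_finite[where N = "{..<_}"]) auto
  also have "\<dots> = (\<Sum>k. \<Sum>n. if k < n then c k (n - Suc k) else 0)"
    unfolding nn_integral_count_space_nat[symmetric] by (rule nn_integral_count_space_swap)
  also have "\<dots> = (\<Sum>k. \<Sum>j. c k j)"
  proof (rule suminf_cong)
    fix k
    have "(\<Sum>n. if k < n then c k (n - Suc k) else 0) = (\<Sum>n. if k < n + Suc k then c k (n + Suc k - Suc k) else 0)
        + (\<Sum>n<Suc k. if k < n then c k (n - Suc k) else 0)"
      by (rule suminf_offset) auto
    then show "(\<Sum>n. if k < n then c k (n - Suc k) else 0) = (\<Sum>j. c k j)" by auto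
  qed
  finally show ?thesis .
qed

text \<open>The weights multiply along the two legs of a path. Later uses of the strong Markov
  property all go through this identity; with \<open>D = {}\<close> it relates hitting probabilities
  to the Green function.\<close>

lemma hits_decomp:
  assumes "D \<subseteq> D'" "0 \<le> r"
  shows "hits P r D x y = hits P r D' x y +
     (\<integral>\<^sup>+z. hits P r D' x z * indicator (D' - D) z * hits P r D z y \<partial>count_space UNIV)"
proof -
  define c where "c k j = (\<integral>\<^sup>+z. (ennreal (r ^ Suc k) * taboo P D' x k z) * indicator (D' - D) z *
     (ennreal (r ^ Suc j) * taboo P D z j y) \<partial>count_space UNIV)" for k j
  have "hits P r D x y = (\<Sum>n. ennreal (r ^ Suc n) * taboo P D' x n y + (\<Sum>k<n. c k (n - Suc k)))"
    unfolding hits_def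
  proof (rule suminf_cong)
    fix n
    have "ennreal (r ^ Suc n) * (\<integral>\<^sup>+z. taboo P D' x k z * indicator (D' - D) z *
           taboo P D z (n - Suc k) y \<partial>count_space UNIV) = c k (n - Suc k)" if "k < n" for k
    proof -
      have "ennreal (r ^ Suc n) = ennreal (r ^ Suc k) * ennreal (r ^ Suc (n - Suc k))"
        using that assms(2) by (simp flip: ennreal_mult power_add power_Suc)
      then show ?thesis unfolding c_def
        by (simp add: nn_integral_cmult[symmetric] ac_simps del: power_Suc)
    qed
    then show "ennreal (r ^ Suc n) * taboo P D x n y =
        ennreal (r ^ Suc n) * taboo P D' x n y + (\<Sum>k<n. c k (n - Suc k))"
      by (subst taboo_decomp[OF assms(1)]) (simp add: distrib_left sum_distrib_left del: power_Suc)
  qed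
  also have "\<dots> = hits P r D' x y + (\<Sum>n. \<Sum>k<n. c k (n - Suc k))"
    unfolding hits_def by (intro suminf_add[symmetric]) auto
  also have "(\<Sum>n. \<Sum>k<n. c k (n - Suc k)) = (\<Sum>k. \<Sum>j. c k j)"
    by (rule suminf_convolution_ennreal)
  also have "\<dots> = (\<integral>\<^sup>+z. hits P r D' x z * indicator (D' - D) z * hits P r D z y \<partial>count_space UNIV)"
    unfolding c_def hits_def
    by (simp add: nn_integral_suminf[symmetric] ennreal_suminf_cmult ennreal_suminf_multc del: power_Suc)
  finally show ?thesis .
qed

lemma indicator_add_compl: "a * indicator (-D) z + a * indicator D z = (a :: ennreal)"
  by (auto simp: indicator_def)

text \<open>Conservation of mass: paths absorbed in \<open>D\<close> at the times
  \<open>1, ..., n\<close>, plus all others. The first integral still contains the paths that enter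
  \<open>D\<close> at time \<open>n + 1\<close>.\<close>

lemma taboo_mass:
  "(\<integral>\<^sup>+y. taboo P D x n y \<partial>count_space UNIV) + (\<Sum>k<n. \<integral>\<^sup>+y. taboo P D x k y * indicator D y \<partial>count_space UNIV) = 1"
proof (induction n)
  case 0
  then show ?case by (simp add: nn_integral_pmf_diff)
next
  case (Suc n)
  have "(\<integral>\<^sup>+y. taboo P D x (Suc n) y \<partial>count_space UNIV)
     = (\<integral>\<^sup>+z. taboo P D x n z * indicator (-D) z \<partial>count_space UNIV)"
    unfolding taboo.simps by (subst nn_integral_count_space_swap)
       (simp add: nn_integral_cmult nn_integral_pmf_diff)
  then have "(\<integral>\<^sup>+y. taboo P D x (Suc n) y \<partial>count_space UNIV) 
    + (\<integral>\<^sup>+y. taboo P D x n y * indicator D y \<partial>count_space UNIV) 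
    = (\<integral>\<^sup>+y. taboo P D x n y \<partial>count_space UNIV)"
    by (simp add: nn_integral_add[symmetric] indicator_add_compl)
  then show ?case using Suc by (simp add: add.assoc[symmetric] add.commute)
qed

lemma hits_1: "hits P 1 D x y = (\<Sum>n. taboo P D x n y)"
  by (simp add: hits_def)

lemma hits_mass_le: "(\<integral>\<^sup>+y. hits P 1 D x y * indicator D y \<partial>count_space UNIV) \<le> 1"
proof -
  have "(\<integral>\<^sup>+y. hits P 1 D x y * indicator D y \<partial>count_space UNIV)
     = (\<Sum>n. \<integral>\<^sup>+y. taboo P D x n y * indicator D y \<partial>count_space UNIV)"
    unfolding hits_1 by (subst nn_integral_suminf[symmetric]) (auto simp: ennreal_suminf_multc)
  also have "\<dots> \<le> 1"
  proof (rule suminf_le_const)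
    show "(\<Sum>k<n. \<integral>\<^sup>+y. taboo P D x k y * indicator D y \<partial>count_space UNIV) \<le> 1" for n
      unfolding taboo_mass[of P D x n, symmetric] by simp
  qed simp
  finally show ?thesis .
qed

lemma hits_le_1:
  assumes "y \<in> D" shows "hits P 1 D x y \<le> 1"
proof -
  have "hits P 1 D x y * indicator D y \<le> (\<integral>\<^sup>+y. hits P 1 D x y * indicator D y \<partial>count_space UNIV)"
    by (rule nn_integral_ge_point) auto
  then show ?thesis using assms hits_mass_le[of P D x] order_trans by fastforce
qed

lemma hits_antimono: "D \<subseteq> D' \<Longrightarrow> 0 \<le> r \<Longrightarrow> hits P r D' x y \<le> hits P r D x y"
  by (subst (2) hits_decomp) auto

text \<open>Decomposition at the last step, dual to \<open>hits_decomp\<close>: the walk arrives at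
  \<open>y\<close> either from its start \<open>x\<close>, which may lie in \<open>D\<close>, or
  from a point outside \<open>D\<close> visited before.\<close>

lemma hits_Suc:
  "hits P 1 D x y = (\<integral>\<^sup>+z. (indicator {x} z + hits P 1 D x z * indicator (-D) z) * ennreal (pmf P (y - z)) \<partial>count_space UNIV)"
proof -
  have "hits P 1 D x y = (\<Sum>n. taboo P D x (n + 1) y) + (\<Sum>n<1. taboo P D x n y)"
    unfolding hits_1 by (rule suminf_offset) auto
  also have "(\<Sum>n. taboo P D x (n + 1) y) = (\<integral>\<^sup>+z. hits P 1 D x z * indicator (-D) z * ennreal (pmf P (y - z)) \<partial>count_space UNIV)"
    by (simp add: hits_1 nn_integral_suminf[symmetric] ennreal_suminf_multc)
  also have "(\<Sum>n<1. taboo P D x n y) = (\<integral>\<^sup>+z. ennreal (pmf P (y - x)) * indicator {x} z \<partial>count_space UNIV)"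
    by (subst nn_integral_cmult_indicator) auto
  also have "(\<integral>\<^sup>+z. hits P 1 D x z * indicator (-D) z * ennreal (pmf P (y - z)) \<partial>count_space UNIV) + \<dots>
     = (\<integral>\<^sup>+z. hits P 1 D x z * indicator (-D) z * ennreal (pmf P (y - z)) + ennreal (pmf P (y - x)) * indicator {x} z \<partial>count_space UNIV)"
    by (subst nn_integral_add) auto
  also have "\<dots> = (\<integral>\<^sup>+z. (indicator {x} z + hits P 1 D x z * indicator (-D) z) * ennreal (pmf P (y - z)) \<partial>count_space UNIV)"
    by (intro nn_integral_cong) (auto simp: indicator_def distrib_right)
  finally show ?thesis .
qed

section \<open>From taboo probabilities to events of the walk\<close>

lemma measurable_count_space_sum:
  fixes f :: "'i \<Rightarrow> 'a \<Rightarrow> int"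
  assumes "finite I" "\<And>i. i \<in> I \<Longrightarrow> f i \<in> measurable N (count_space UNIV)"
  shows "(\<lambda>\<omega>. c + (\<Sum>i\<in>I. f i \<omega>)) \<in> measurable N (count_space UNIV)"
  using assms
proof (induction I rule: finite_induct)
  case (insert i I)
  have "(\<lambda>\<omega>. (\<lambda>u \<omega>. u + f i \<omega>) (c + (\<Sum>i\<in>I. f i \<omega>)) \<omega>) \<in> measurable N (count_space UNIV)"
  proof (rule measurable_compose_countable[where f = "\<lambda>u \<omega>. u + f i \<omega>"])
    show "(\<lambda>\<omega>. u + f i \<omega>) \<in> measurable N (count_space UNIV)" for u
      using insert(4)[of i] by (rule measurable_compose) auto
  qed (use insert in auto)
  then show ?case using insert by (simp add: ac_simps)
qed simp

lemma iid_measurable: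
  assumes "prob_space M" "iid M X" shows "X n \<in> measurable M (count_space UNIV)"
  using assms(2) unfolding iid_def prob_space.indep_vars_def2[OF assms(1)] by auto

lemma walk_measurable:
  assumes "prob_space M" "iid M X" shows "walk X x n \<in> measurable M (count_space UNIV)"
  unfolding walk_def[abs_def] using iid_measurable[OF assms] by (intro measurable_count_space_sum) auto

lemma iid_law:
  assumes "prob_space M" "iid M X" "measure_pmf P = distr M (count_space UNIV) (X 0)"
  shows "emeasure M {\<omega> \<in> space M. X n \<omega> = k} = ennreal (pmf P k)"
proof -
  have "ennreal (pmf P k) = emeasure (distr M (count_space UNIV) (X n)) {k}"
    using assms(2) emeasure_pmf_single[of P k] unfolding iid_def assms(3) by metis
  also have "\<dots> = emeasure M {\<omega> \<in> space M. X n \<omega> = k}" using iid_measurable[OF assms(1,2)]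
    by (subst emeasure_distr) (auto simp: vimage_def Int_def conj_commute)
  finally show ?thesis by simp
qed

lemma walk_Suc: "walk X x (Suc n) \<omega> = walk X x n \<omega> + X (Suc n) \<omega>"
  by (simp add: walk_def)

lemma ball_atLeastAtMost_Suc: "(\<forall>k\<in>{1..Suc n}. Q k) \<longleftrightarrow> (\<forall>k\<in>{1..n}. Q k) \<and> Q (Suc n)"
  by (auto simp: atLeastAtMostSuc_conv)

text \<open>The next increment is independent of the path so far, so the probabilities of these
  events obey the recursion of \<open>taboo\<close>. Only the law of the increments enters, and it
  is the law of \<open>X 0\<close>.\<close>

lemma emeasure_taboo:
  assumes "prob_space M" "iid M X" "measure_pmf P = distr M (count_space UNIV) (X 0)"
  shows "emeasure M {\<omega> \<in> space M. (\<forall>k\<in>{1..n}. walk X x k \<omega> \<notin> D) \<and> walk X x (Suc n) \<omega> = y} =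
    taboo P D x n y"
proof (induction n arbitrary: y)
  case 0
  have "{\<omega> \<in> space M. (\<forall>k\<in>{1..0}. walk X x k \<omega> \<notin> D) \<and> walk X x (Suc 0) \<omega> = y}
     = {\<omega> \<in> space M. X 1 \<omega> = y - x}" by (auto simp: walk_def)
  then show ?case using iid_law[OF assms] by simp
next
  case (Suc n)
  interpret prob_space M by fact
  note [measurable] = walk_measurable[OF assms(1,2)] iid_measurable[OF assms(1,2)]
  define E where "E z = {\<omega> \<in> space M. (\<forall>k\<in>{1..n}. walk X x k \<omega> \<notin> D) \<and> walk X x (Suc n) \<omega> = z}" for z
  define F where "F z = {\<omega> \<in> space M. X (Suc (Suc n)) \<omega> = y - z}" for z
  \<comment> \<open>Index sets of the two independent blocks: the increments up to time
    \<open>n + 1\<close>, and the next one.\<close>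
  define I where "I = {1..Suc n}"
  define J where "J = {Suc (Suc n)}"
  let ?PI = "PiM I (\<lambda>_. count_space UNIV :: int measure)" and ?PJ = "PiM J (\<lambda>_. count_space UNIV :: int measure)"
  have EF[measurable]: "E z \<in> sets M" "F z \<in> sets M" for z
    unfolding E_def F_def by measurable
  have "indep_var ?PI (\<lambda>\<omega>. restrict (\<lambda>i. X i \<omega>) I) ?PJ (\<lambda>\<omega>. restrict (\<lambda>i. X i \<omega>) J)"
    using assms(2) unfolding iid_def by (intro indep_var_restrict[where I=UNIV]) (auto simp: I_def J_def)
  note indep = indep_varD[OF this]
  have wm: "(\<lambda>f. x + (\<Sum>j=1..k. f j)) \<in> measurable ?PI (count_space UNIV)" if "k \<le> Suc n" for k
    using that by (intro measurable_count_space_sum measurable_component_singleton) (auto simp: I_def)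
  have prod: "emeasure M (E z \<inter> F z) = emeasure M (E z) * emeasure M (F z)" for z
  proof -
    define A where "A = {f \<in> space ?PI. (\<forall>k\<in>{1..n}. x + (\<Sum>j=1..k. f j) \<notin> D) \<and> x + (\<Sum>j=1..Suc n. f j) = z}"
    define B where "B = {f \<in> space ?PJ. f (Suc (Suc n)) = y - z}"
    have "A \<in> sets ?PI" unfolding A_def
    proof (intro sets.sets_Collect_conj sets.sets_Collect_finite_All)
      fix k assume "k \<in> {1..n}"
      then show "{f \<in> space ?PI. x + (\<Sum>j=1..k. f j) \<notin> D} \<in> sets ?PI"
        by (intro measurable_sets_Collect[OF wm]) auto
    next
      show "{f \<in> space ?PI. x + (\<Sum>j=1..Suc n. f j) = z} \<in> sets ?PI"
        by (intro measurable_sets_Collect[OF wm]) auto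
    qed auto
    moreover have "B \<in> sets ?PJ" unfolding B_def
      by (intro measurable_sets_Collect[OF measurable_component_singleton]) (auto simp: J_def)
    moreover have "(\<lambda>\<omega>. restrict (\<lambda>i. X i \<omega>) I) -` A \<inter> space M = E z"
    proof -
      have "(\<Sum>j=1..k. restrict (\<lambda>i. X i \<omega>) I j) = (\<Sum>j=1..k. X j \<omega>)" if "k \<le> Suc n" for k \<omega>
        using that by (intro sum.cong) (auto simp: I_def)
      moreover have "restrict (\<lambda>i. X i \<omega>) I \<in> space ?PI" for \<omega> by (simp add: space_PiM)
      ultimately show ?thesis unfolding A_def E_def walk_def
        by (intro set_eqI) (simp add: conj_commute del: restrict_apply sum.cl_ivl_Suc)
    qed
    moreover have "(\<lambda>\<omega>. restrict (\<lambda>i. X i \<omega>) J) -` B \<inter> space M = F z"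
      by (auto simp: B_def F_def J_def space_PiM)
    moreover have "(\<lambda>\<omega>. (restrict (\<lambda>i. X i \<omega>) I, restrict (\<lambda>i. X i \<omega>) J)) -` (A \<times> B) \<inter> space M = E z \<inter> F z"
      using calculation by auto
    ultimately have "prob (E z \<inter> F z) = prob (E z) * prob (F z)"
      using indep[of A B] by simp
    then show ?thesis by (simp add: emeasure_eq_measure ennreal_mult)
  qed
  have "{\<omega> \<in> space M. (\<forall>k\<in>{1..Suc n}. walk X x k \<omega> \<notin> D) \<and> walk X x (Suc (Suc n)) \<omega> = y}
     = (\<Union>z\<in>-D. E z \<inter> F z)"
    unfolding E_def F_def walk_Suc[of X x "Suc n"] ball_atLeastAtMost_Suc
    by (intro set_eqI) (simp add: algebra_simps, blast)
  then have "emeasure M {\<omega> \<in> space M. (\<forall>k\<in>{1..Suc n}. walk X x k \<omega> \<notin> D) \<and> walk X x (Suc (Suc n)) \<omega> = y}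
     = (\<integral>\<^sup>+z. emeasure M (E z \<inter> F z) \<partial>count_space (-D))"
    by (subst emeasure_UN_countable[symmetric]) (auto simp: disjoint_family_on_def E_def)
  also have "\<dots> = (\<integral>\<^sup>+z. emeasure M (E z \<inter> F z) * indicator (-D) z \<partial>count_space UNIV)"
    by (simp add: nn_integral_count_space_indicator)
  also have "\<dots> = taboo P D x (Suc n) y"
    unfolding taboo.simps prod Suc.IH[symmetric] 
    by (simp add: E_def F_def iid_law[OF assms] ac_simps)
  finally show ?case .
qed

lemma emeasure_hits:
  assumes "prob_space M" "iid M X" "measure_pmf P = distr M (count_space UNIV) (X 0)" "B \<subseteq> D"
  shows "emeasure M {\<omega> \<in> space M. \<exists>n. (\<forall>k\<in>{1..n}. walk X x k \<omega> \<notin> D) \<and> walk X x (Suc n) \<omega> \<in> B} =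
    (\<integral>\<^sup>+y. hits P 1 D x y * indicator B y \<partial>count_space UNIV)"
proof -
  note [measurable] = walk_measurable[OF assms(1,2)]
  define E where "E n y = {\<omega> \<in> space M. (\<forall>k\<in>{1..n}. walk X x k \<omega> \<notin> D) \<and> walk X x (Suc n) \<omega> = y}" for n y
  have [measurable]: "E n y \<in> sets M" for n y unfolding E_def by measurable
  have "{\<omega> \<in> space M. \<exists>n. (\<forall>k\<in>{1..n}. walk X x k \<omega> \<notin> D) \<and> walk X x (Suc n) \<omega> \<in> B}
     = (\<Union>(n, y)\<in>UNIV \<times> B. E n y)"
    by (auto simp: E_def)
  also have "emeasure M \<dots> = (\<integral>\<^sup>+p. emeasure M (case p of (n, y) \<Rightarrow> E n y) \<partial>count_space (UNIV \<times> B))"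
  proof (rule emeasure_UN_countable)
    \<comment> \<open>First visits are unique: a visit to \<open>B \<subseteq> D\<close> at time
      \<open>n + 1 \<le> m\<close> contradicts avoiding \<open>D\<close> up to time
      \<open>m\<close>.\<close>
    have ne: "\<not> n < m" if "\<omega> \<in> E n y" "\<omega> \<in> E m z" "y \<in> B" for n m y z \<omega>
    proof
      assume "n < m"
      then have "Suc n \<in> {1..m}" by auto
      then show False using that assms(4) unfolding E_def by blast
    qed
    have "n = m \<and> y = z" if "\<omega> \<in> E n y" "\<omega> \<in> E m z" "y \<in> B" "z \<in> B" for n m y z \<omega>
    proof -
      have "n = m" using ne[OF that(1,2,3)] ne[OF that(2,1,4)] by simp
      then show ?thesis using that unfolding E_def by auto
    qed
    then show "disjoint_family_on (\<lambda>p. case p of (n, y) \<Rightarrow> E n y) (UNIV \<times> B)"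
      unfolding disjoint_family_on_def by (clarsimp, blast)
  qed (auto split: prod.split)
  also have "\<dots> = (\<integral>\<^sup>+n. \<integral>\<^sup>+y. emeasure M (E n y) * indicator B y \<partial>count_space UNIV \<partial>count_space UNIV)"
  proof -
    have "(\<integral>\<^sup>+p. emeasure M (case p of (n, y) \<Rightarrow> E n y) \<partial>count_space (UNIV \<times> B))
      = (\<integral>\<^sup>+p. (case p of (n, y) \<Rightarrow> emeasure M (E n y) * indicator B y) \<partial>count_space UNIV)"
      by (subst nn_integral_count_space_indicator) (auto split: prod.split simp: indicator_def intro!: nn_integral_cong)
    then show ?thesis by (simp add: nn_integral_fst_count_space[symmetric])
  qed
  also have "\<dots> = (\<integral>\<^sup>+y. \<integral>\<^sup>+n. taboo P D x n y * indicator B y \<partial>count_space UNIV \<partial>count_space UNIV)"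
    unfolding E_def emeasure_taboo[OF assms(1-3)] by (rule nn_integral_count_space_swap)
  also have "\<dots> = (\<integral>\<^sup>+y. hits P 1 D x y * indicator B y \<partial>count_space UNIV)"
    by (simp add: hits_1 nn_integral_count_space_nat)
  finally show ?thesis .
qed

section \<open>Hitting times as first visits\<close>

lemma hitting_time_eq_enat:
  "hitting_time X x B \<omega> = enat n \<longleftrightarrow> 1 \<le> n \<and> walk X x n \<omega> \<in> B \<and> (\<forall>k\<in>{1..<n}. walk X x k \<omega> \<notin> B)"
proof -
  let ?S = "{enat n | n. 1 \<le> n \<and> walk X x n \<omega> \<in> B}"
  show ?thesis
  proof
    assume h: "hitting_time X x B \<omega> = enat n"
    then have "?S \<noteq> {}" unfolding hitting_time_def Inf_enat_def by (metis enat.distinct(1))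
    then have "Inf ?S \<in> ?S" unfolding Inf_enat_def by (auto intro: LeastI)
    moreover have "enat n \<le> enat k" if "1 \<le> k" "walk X x k \<omega> \<in> B" for k
      unfolding h[symmetric] hitting_time_def using that by (intro Inf_lower) auto
    ultimately show "1 \<le> n \<and> walk X x n \<omega> \<in> B \<and> (\<forall>k\<in>{1..<n}. walk X x k \<omega> \<notin> B)"
      using h by (fastforce simp: hitting_time_def)
  next
    assume n: "1 \<le> n \<and> walk X x n \<omega> \<in> B \<and> (\<forall>k\<in>{1..<n}. walk X x k \<omega> \<notin> B)"
    show "hitting_time X x B \<omega> = enat n" unfolding hitting_time_def
    proof (rule antisym)
      show "Inf ?S \<le> enat n" using n by (intro Inf_lower) auto
      show "enat n \<le> Inf ?S" using n by (intro Inf_greatest) (auto simp: not_less[symmetric])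
    qed
  qed
qed

text \<open>The first visit to \<open>insert 0 B\<close> has to fall into \<open>B\<close>. Paths
  that never return to \<open>0\<close> are included; for them the right-hand time is
  infinite.\<close>

lemma hitting_time_less_iff:
  assumes "0 \<notin> B"
  shows "hitting_time X x B \<omega> < hitting_time X x {0} \<omega> \<longleftrightarrow>
    (\<exists>n. (\<forall>k\<in>{1..n}. walk X x k \<omega> \<notin> insert 0 B) \<and> walk X x (Suc n) \<omega> \<in> B)"
proof
  assume l: "hitting_time X x B \<omega> < hitting_time X x {0} \<omega>"
  then obtain m where m: "hitting_time X x B \<omega> = enat m" by (cases "hitting_time X x B \<omega>") auto
  have "enat m < enat k" if "1 \<le> k" "walk X x k \<omega> = 0" for k
  proof -
    have "hitting_time X x {0} \<omega> \<le> enat k" unfolding hitting_time_def using that by (intro Inf_lower) auto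
    then show ?thesis using l m by (metis order_less_le_trans)
  qed
  then show "\<exists>n. (\<forall>k\<in>{1..n}. walk X x k \<omega> \<notin> insert 0 B) \<and> walk X x (Suc n) \<omega> \<in> B"
    using m[unfolded hitting_time_eq_enat] by (intro exI[of _ "m - 1"]) fastforce
next
  assume "\<exists>n. (\<forall>k\<in>{1..n}. walk X x k \<omega> \<notin> insert 0 B) \<and> walk X x (Suc n) \<omega> \<in> B"
  then obtain n where n: "\<forall>k\<in>{1..n}. walk X x k \<omega> \<notin> insert 0 B" "walk X x (Suc n) \<omega> \<in> B" by auto
  then have 1: "hitting_time X x B \<omega> = enat (Suc n)" by (auto simp: hitting_time_eq_enat)
  have 2: "enat (Suc n) < enat k" if "1 \<le> k" "walk X x k \<omega> = 0" for k
  proof -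
    have "k \<noteq> Suc n" using that n(2) assms by auto
    moreover have "\<not> k \<le> n" using n(1) that by auto
    ultimately show ?thesis by simp
  qed
  show "hitting_time X x B \<omega> < hitting_time X x {0} \<omega>"
  proof (cases "hitting_time X x {0} \<omega>")
    case (enat m)
    then have "enat (Suc n) < enat m" using 2[of m] by (auto simp: hitting_time_eq_enat)
    then show ?thesis unfolding 1 enat .
  qed (simp add: 1)
qed

lemma hitting_distribution_eq:
  assumes "prob_space M" "iid M X" "measure_pmf P = distr M (count_space UNIV) (X 0)" "y \<in> B"
  shows "ennreal (hitting_distribution M X x B y) = hits P 1 B x y"
proof -
  interpret prob_space M by fact
  have "{\<omega> \<in> space M. \<exists>n. hitting_time X x B \<omega> = enat n \<and> walk X x n \<omega> = y}
    = {\<omega> \<in> space M. \<exists>n. (\<forall>k\<in>{1..n}. walk X x k \<omega> \<notin> B) \<and> walk X x (Suc n) \<omega> \<in> {y}}" (is "?L = ?R")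
  proof (intro Collect_cong conj_cong refl)
    fix \<omega>
    show "(\<exists>n. hitting_time X x B \<omega> = enat n \<and> walk X x n \<omega> = y) \<longleftrightarrow>
      (\<exists>n. (\<forall>k\<in>{1..n}. walk X x k \<omega> \<notin> B) \<and> walk X x (Suc n) \<omega> \<in> {y})" (is "?l \<longleftrightarrow> ?r")
    proof
      assume ?l
      then obtain n where "hitting_time X x B \<omega> = enat n" "walk X x n \<omega> = y" by auto
      then show ?r by (intro exI[of _ "n - 1"]) (auto simp: hitting_time_eq_enat)
    next
      assume ?r
      then obtain n where "\<forall>k\<in>{1..n}. walk X x k \<omega> \<notin> B" "walk X x (Suc n) \<omega> = y" by auto
      then show ?l using assms(4) by (intro exI[of _ "Suc n"]) (auto simp: hitting_time_eq_enat)
    qed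
  qed
  then have "ennreal (hitting_distribution M X x B y) = (\<integral>\<^sup>+z. hits P 1 B x z * indicator {y} z \<partial>count_space UNIV)"
    using emeasure_hits[OF assms(1-3), of "{y}" B x] assms(4)
    by (simp add: hitting_distribution_def emeasure_eq_measure)
  then show ?thesis by simp
qed

lemma measure_hitting_time_less:
  assumes "prob_space M" "iid M X" "measure_pmf P = distr M (count_space UNIV) (X 0)" "0 \<notin> B"
  shows "ennreal (measure M {\<omega> \<in> space M. hitting_time X x B \<omega> < hitting_time X x {0} \<omega>}) =
    (\<integral>\<^sup>+y. hits P 1 (insert 0 B) x y * indicator B y \<partial>count_space UNIV)"
proof -
  interpret prob_space M by fact
  show ?thesis unfolding hitting_time_less_iff[OF assms(4)]
    using emeasure_hits[OF assms(1-3), of B "insert 0 B" x] by (auto simp: emeasure_eq_measure)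
qed

section \<open>Integrated tails\<close>

text \<open>Pointwise version of \<open>M\<close>, with \<open>M n = E (trunc n |X|)\<close>. Within
  a factor 2 it is \<open>k * min k n\<close>, the size of the Taylor remainders that occur
  below.\<close>

definition trunc :: "nat \<Rightarrow> nat \<Rightarrow> real" where
  "trunc n k = (\<Sum>j<n. real (k - j))"

lemma trunc_closed: "2 * trunc n k = real (min k n) * (2 * real k - real (min k n) + 1)"
proof (induction n)
  case (Suc n)
  have "2 * trunc (Suc n) k = 2 * trunc n k + 2 * real (k - n)" by (simp add: trunc_def)
  also have "\<dots> = real (min k (Suc n)) * (2 * real k - real (min k (Suc n)) + 1)"
  proof (cases "n < k")
    case True
    then have "min k (Suc n) = Suc n" "min k n = n" by auto
    then show ?thesis unfolding Suc using True by (simp add: of_nat_diff algebra_simps)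
  next
    case False
    then have "min k (Suc n) = k" "min k n = k" by auto
    then show ?thesis unfolding Suc using False by simp
  qed
  finally show ?case .
qed (simp add: trunc_def)

lemma trunc_ge: "real k * real (min k n) \<le> 2 * trunc n k"
proof -
  have "real (min k n) * real k \<le> real (min k n) * (2 * real k - real (min k n) + 1)"
    by (intro mult_left_mono) auto
  then show ?thesis by (simp add: trunc_closed mult.commute)
qed

lemma trunc_le: "trunc n k \<le> real k * real (min k n)"
proof (cases "min k n = 0")
  case False
  have "real (min k n) * (2 * real k - real (min k n) + 1) \<le> real (min k n) * (2 * real k)"
    using False by (intro mult_left_mono) auto
  then show ?thesis using trunc_closed[of n k] by (simp add: mult.commute mult.left_commute)
qed (use trunc_closed[of n k] in simp)

text \<open>With \<open>m = min k n\<close>, the difference on the right equals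
  \<open>m * (m + 1) / 2\<close>, a truncated square.\<close>

lemma trunc_minus_ge: "(real (min k n))\<^sup>2 \<le> 2 * (trunc n k - real n * real (k - n))"
  unfolding right_diff_distrib trunc_closed
  by (cases "k \<le> n") (auto simp: min_def of_nat_diff power2_eq_square algebra_simps)

text \<open>The truncated subtraction makes these \<open>E(\<bar>X\<bar> - n)\<^sup>+\<close> and \<open>E(X - n)\<^sup>+\<close>, that is
  \<open>\<eta>\<^sub>+(n) + \<eta>\<^sub>-(n)\<close> and \<open>\<eta>\<^sub>+(n)\<close>.\<close>

definition tail_exp :: "int pmf \<Rightarrow> nat \<Rightarrow> real" where
  "tail_exp P n = measure_pmf.expectation P (\<lambda>k. real (nat \<bar>k\<bar> - n))"

definition pos_tail_exp :: "int pmf \<Rightarrow> nat \<Rightarrow> real" where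
  "pos_tail_exp P n = measure_pmf.expectation P (\<lambda>k. real (nat k - n))"

definition dtail :: "int pmf \<Rightarrow> nat \<Rightarrow> real" where
  "dtail P n = (\<Sum>k<n. tail_exp P k)"

definition pos_dtail :: "int pmf \<Rightarrow> nat \<Rightarrow> real" where
  "pos_dtail P n = (\<Sum>k<n. pos_tail_exp P k)"

definition scale :: "int pmf \<Rightarrow> nat \<Rightarrow> real" where
  "scale P n = real n / dtail P n"

definition char_int :: "int pmf \<Rightarrow> real \<Rightarrow> complex" where
  "char_int P t = measure_pmf.expectation P (\<lambda>k. iexp (t * real_of_int k))"

text \<open>What the analysis needs of the walk, stated for the law alone: irreducibility survives
  as \<open>char_neq_1\<close>, infinite variance as \<open>dtail_at_top\<close>, and the hypothesis
  on the tails as \<open>pos_dtail_ratio\<close>.\<close>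

locale centred_law =
  fixes P :: "int pmf"
  assumes integrable_law: "integrable (measure_pmf P) real_of_int"
    and mean_zero: "measure_pmf.expectation P real_of_int = 0"
    and dtail_at_top: "filterlim (dtail P) at_top sequentially"
    and pos_dtail_ratio: "(\<lambda>n. pos_dtail P n / dtail P n) \<longlonglongrightarrow> 0"
    and char_neq_1: "\<And>t. 0 < t \<Longrightarrow> t \<le> pi \<Longrightarrow> char_int P t \<noteq> 1"
begin

abbreviation "E \<equiv> measure_pmf.expectation P"
abbreviation "te \<equiv> tail_exp P"
abbreviation "pe \<equiv> pos_tail_exp P"
abbreviation "M \<equiv> dtail P"
abbreviation "Mp \<equiv> pos_dtail P"
abbreviation "f \<equiv> scale P"

lemma integrable_bound:
  fixes g :: "int \<Rightarrow> real"
  assumes "\<And>k. \<bar>g k\<bar> \<le> C * \<bar>real_of_int k\<bar>"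
  shows "integrable (measure_pmf P) g"
proof (rule Bochner_Integration.integrable_bound)
  show "integrable (measure_pmf P) (\<lambda>k. C * real_of_int k)" using integrable_law by simp
  show "AE k in measure_pmf P. norm (g k) \<le> norm (C * real_of_int k)"
    by (intro AE_I2) (auto simp: abs_mult intro!: order_trans[OF assms] mult_right_mono)
qed simp

lemma integrable_tail: "integrable (measure_pmf P) (\<lambda>k. real (nat \<bar>k\<bar> - n))"
  by (rule integrable_bound[of _ 1]) auto

lemma integrable_pos_tail: "integrable (measure_pmf P) (\<lambda>k. real (nat k - n))"
  by (rule integrable_bound[of _ 1]) auto

lemma integrable_trunc: "integrable (measure_pmf P) (\<lambda>k. trunc n (nat \<bar>k\<bar>))"
  unfolding trunc_def using integrable_tail by simp

lemma integrable_trunc_pos: "integrable (measure_pmf P) (\<lambda>k. trunc n (nat k))"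
  unfolding trunc_def using integrable_pos_tail by simp

lemma dtail_eq: "M n = E (\<lambda>k. trunc n (nat \<bar>k\<bar>))"
  unfolding dtail_def tail_exp_def trunc_def by (simp add: integrable_tail)

lemma pos_dtail_eq: "Mp n = E (\<lambda>k. trunc n (nat k))"
  unfolding pos_dtail_def pos_tail_exp_def trunc_def by (simp add: integrable_pos_tail)

lemma tail_nonneg: "0 \<le> te n" "0 \<le> pe n"
  by (auto simp: tail_exp_def pos_tail_exp_def)

lemma tail_antimono: "m \<le> n \<Longrightarrow> te n \<le> te m" "m \<le> n \<Longrightarrow> pe n \<le> pe m"
  unfolding tail_exp_def pos_tail_exp_def
  by (auto intro!: integral_mono integrable_tail integrable_pos_tail)

lemma M_0 [simp]: "M 0 = 0" "Mp 0 = 0" by (simp_all add: dtail_def pos_dtail_def)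

lemma M_Suc: "M (Suc n) = M n + te n" "Mp (Suc n) = Mp n + pe n"
  by (simp_all add: dtail_def pos_dtail_def)

lemma M_mono: "m \<le> n \<Longrightarrow> M m \<le> M n" "m \<le> n \<Longrightarrow> Mp m \<le> Mp n"
  unfolding dtail_def pos_dtail_def by (auto intro!: sum_mono2 tail_nonneg)

lemma M_nonneg: "0 \<le> M n" "0 \<le> Mp n"
  unfolding dtail_def pos_dtail_def by (auto intro!: sum_nonneg tail_nonneg)

lemma tail_0_pos: "0 < te 0"
proof (rule ccontr)
  assume "\<not> 0 < te 0"
  then have "te n = 0" for n using tail_nonneg(1)[of n] tail_nonneg(1)[of 0] tail_antimono(1)[of 0 n] by simp
  then have "M n = 0" for n by (simp add: dtail_def)
  then show False using dtail_at_top unfolding filterlim_at_top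
    by (auto dest!: spec[of _ 1])
qed

lemma M_pos: "0 < n \<Longrightarrow> 0 < M n"
  using M_mono(1)[of 1 n] tail_0_pos M_Suc[of 0] by simp

lemma n_tail_le: "real n * te n \<le> M n" "real n * pe n \<le> Mp n"
proof -
  have "(\<Sum>k<n. te n) \<le> M n" unfolding dtail_def by (intro sum_mono tail_antimono) auto
  then show "real n * te n \<le> M n" by simp
  have "(\<Sum>k<n. pe n) \<le> Mp n" unfolding pos_dtail_def by (intro sum_mono tail_antimono) auto
  then show "real n * pe n \<le> Mp n" by simp
qed

lemma M_Suc_le: "0 < n \<Longrightarrow> M (Suc n) \<le> 2 * M n" "0 < n \<Longrightarrow> Mp (Suc n) \<le> 2 * Mp n"
proof -
  assume n: "0 < n"
  have "te n \<le> real n * te n" "pe n \<le> real n * pe n"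
    using mult_right_mono[of 1 "real n", OF _ tail_nonneg(1)[of n]] 
      mult_right_mono[of 1 "real n", OF _ tail_nonneg(2)[of n]] n by auto
  then show "M (Suc n) \<le> 2 * M n" "Mp (Suc n) \<le> 2 * Mp n"
    using n_tail_le[of n] M_Suc[of n] by linarith+
qed

text \<open>By the identity behind \<open>trunc_minus_ge\<close> this is a truncated second moment,
  so it bounds \<open>1 - Re \<phi>\<close>. It is also the numerator of the increments of
  \<open>f\<close> (\<open>scale_diff\<close>); this double role lets the Fourier bound for
  \<open>abar\<close> telescope.\<close>

definition "D n = M n - real n * te n"

lemma D_nonneg: "0 \<le> D n" using n_tail_le(1) by (simp add: D_def)

lemma scale_0 [simp]: "f 0 = 0" by (simp add: scale_def)

lemma scale_pos: "0 < n \<Longrightarrow> 0 < f n" by (simp add: scale_def M_pos)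

lemma scale_nonneg: "0 \<le> f n" by (simp add: scale_def M_nonneg)

lemma scale_diff: "0 < n \<Longrightarrow> f (Suc n) - f n = D n / (M n * M (Suc n))"
  using M_pos[of n] M_pos[of "Suc n"] unfolding scale_def D_def
  by (simp add: field_simps M_Suc)

lemma scale_mono: assumes "m \<le> n" shows "f m \<le> f n"
proof (rule lift_Suc_mono_le[OF _ assms])
  fix n show "f n \<le> f (Suc n)"
  proof (cases "n = 0")
    case False
    then have "0 \<le> f (Suc n) - f n" using D_nonneg M_nonneg by (simp add: scale_diff)
    then show ?thesis by simp
  qed (simp add: scale_nonneg)
qed

lemma scale_diff_le: "f (Suc n) - f n \<le> 1 / M (Suc n)"
proof (cases "n = 0")
  case False
  have "real n / M (Suc n) \<le> f n"
    unfolding scale_def using False M_pos[of n] M_mono(1)[of n "Suc n"] by (intro divide_left_mono) auto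
  moreover have "f (Suc n) = real n / M (Suc n) + 1 / M (Suc n)"
    by (simp add: scale_def add_divide_distrib)
  ultimately show ?thesis by linarith
qed (simp add: scale_def)

lemma scale_double: "f (2 * n) \<le> 2 * f n"
proof (cases "n = 0")
  case False
  then have "real (2 * n) / M (2 * n) \<le> real (2 * n) / M n"
    using M_pos[of n] M_mono(1)[of n "2 * n"] by (intro divide_left_mono) auto
  then show ?thesis by (simp add: scale_def)
qed simp

lemma tail_tendsto_0: "te \<longlonglongrightarrow> 0"
proof -
  have "(\<lambda>n. E (\<lambda>k. real (nat \<bar>k\<bar> - n))) \<longlonglongrightarrow> E (\<lambda>k. 0)"
  proof (rule integral_dominated_convergence[where w = "\<lambda>k. \<bar>real_of_int k\<bar>"])
    show "integrable (measure_pmf P) (\<lambda>k. \<bar>real_of_int k\<bar>)" using integrable_law by simp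
    show "AE k in measure_pmf P. (\<lambda>n. real (nat \<bar>k\<bar> - n)) \<longlonglongrightarrow> 0"
    proof (intro AE_I2 tendsto_eventually)
      fix k :: int
      show "eventually (\<lambda>n. real (nat \<bar>k\<bar> - n) = 0) sequentially"
        using eventually_ge_at_top[of "nat \<bar>k\<bar>"] by eventually_elim simp
    qed
  qed auto
  then show ?thesis by (simp add: tail_exp_def[abs_def])
qed

text \<open>Toeplitz's lemma. It is applied with constant weights to \<open>M n / n\<close>, and
  with the increments of \<open>f\<close> as weights to the crossing sum.\<close>

lemma cesaro_tendsto_0:
  fixes u :: "nat \<Rightarrow> real" and w :: "nat \<Rightarrow> real"
  assumes "u \<longlonglongrightarrow> 0" "\<And>n. 0 \<le> w n" "filterlim (\<lambda>n. \<Sum>k<n. w k) at_top sequentially"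
  shows "(\<lambda>n. (\<Sum>k<n. w k * u k) / (\<Sum>k<n. w k)) \<longlonglongrightarrow> 0"
proof (rule LIMSEQ_I)
  fix r :: real assume r: "0 < r"
  define W where "W n = (\<Sum>k<n. w k)" for n
  obtain N where N: "\<And>n. n \<ge> N \<Longrightarrow> \<bar>u n\<bar> < r / 2"
    using LIMSEQ_D[OF assms(1), of "r / 2"] r by auto
  define C where "C = (\<Sum>k<N. \<bar>w k * u k\<bar>)"
  have "eventually (\<lambda>n. W n \<ge> 2 * C / r + 1 \<and> n \<ge> N) sequentially"
    using assms(3) eventually_ge_at_top[of N] unfolding filterlim_at_top W_def by (auto intro: eventually_conj)
  then obtain N2 where N2: "\<And>n. n \<ge> N2 \<Longrightarrow> W n \<ge> 2 * C / r + 1 \<and> n \<ge> N" by (auto simp: eventually_sequentially)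
  have C0: "0 \<le> C" unfolding C_def by (intro sum_nonneg) auto
  show "\<exists>no. \<forall>n\<ge>no. norm ((\<Sum>k<n. w k * u k) / (\<Sum>k<n. w k) - 0) < r"
  proof (intro exI allI impI)
    fix n assume n: "n \<ge> N2"
    have W: "W n \<ge> 2 * C / r + 1" and nN: "n \<ge> N" using N2[OF n] by auto
    then have Wp: "W n > 0" using C0 r by (smt (verit) divide_nonneg_pos)
    have "\<bar>\<Sum>k<n. w k * u k\<bar> \<le> (\<Sum>k<n. \<bar>w k * u k\<bar>)" by (rule sum_abs)
    also have "\<dots> = C + (\<Sum>k=N..<n. \<bar>w k * u k\<bar>)"
      unfolding C_def using nN by (metis sum.atLeastLessThan_concat lessThan_atLeast0 le0)
    also have "(\<Sum>k=N..<n. \<bar>w k * u k\<bar>) \<le> (\<Sum>k=N..<n. w k * (r / 2))"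
    proof (rule sum_mono)
      fix k assume "k \<in> {N..<n}"
      then have "\<bar>u k\<bar> \<le> r / 2" using N[of k] by simp
      then show "\<bar>w k * u k\<bar> \<le> w k * (r / 2)"
        using assms(2)[of k] by (simp only: abs_mult abs_of_nonneg mult_left_mono)
    qed
    also have "\<dots> \<le> W n * (r / 2)" unfolding W_def sum_distrib_right[symmetric]
      using assms(2) r by (intro mult_right_mono sum_mono2) auto
    also have "C + W n * (r / 2) < W n * r"
    proof -
      have "2 * C / r < W n" using W by simp
      then have "2 * C < W n * r" using r by (simp add: divide_less_eq)
      then show ?thesis by simp
    qed
    finally show "norm ((\<Sum>k<n. w k * u k) / (\<Sum>k<n. w k) - 0) < r"
      using Wp unfolding W_def by (simp add: abs_divide divide_less_eq mult.commute)
  qed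
qed

lemma scale_at_top: "filterlim f at_top sequentially"
proof -
  have lim: "(\<lambda>n. M n / real n) \<longlonglongrightarrow> 0"
    using cesaro_tendsto_0[OF tail_tendsto_0, of "\<lambda>_. 1"] filterlim_real_sequentially
    by (simp add: dtail_def)
  have "filterlim (\<lambda>n. inverse (M n / real n)) at_top sequentially"
    using lim by (rule filterlim_inverse_at_top)
      (use eventually_gt_at_top[of 0] in \<open>eventually_elim, simp add: M_pos\<close>)
  then show ?thesis by (simp add: scale_def[abs_def])
qed

text \<open>As \<open>pe\<close> decreases, \<open>k * pe k \<le> Mp k\<close>. One factor
  \<open>f\<close> thus pays for one positive tail and leaves a quotient that tends to 0.\<close>

lemma scale_pos_tail_le: "f k * pe k \<le> Mp k / M k"
proof -
  have "real k * pe k / M k \<le> Mp k / M k"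
    using n_tail_le(2) M_nonneg by (intro divide_right_mono) auto
  then show ?thesis by (simp add: scale_def)
qed

end

section \<open>Bounds for the characteristic function\<close>

lemma one_minus_cos_ge:
  assumes "0 \<le> u" "u \<le> (1::real)" shows "u\<^sup>2 / 4 \<le> 1 - cos u"
proof -
  have pi3: "(1::real) \<le> pi / 3" using pi_gt3 by simp
  have cos: "1 / 2 \<le> cos v" if "0 \<le> v" "v \<le> 1" for v :: real
    using cos_monotone_0_pi_le[of v "pi/3"] that pi3 pi_gt3 by (simp add: cos_60)
  have sin: "v / 2 \<le> sin v" if "0 \<le> v" "v \<le> 1" for v :: real
  proof -
    have "sin 0 - 0 / 2 \<le> sin v - v / 2"
      by (rule DERIV_nonneg_imp_nondecreasing[OF that(1)])
         (use cos that in \<open>auto intro!: exI derivative_eq_intros\<close>)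
    then show ?thesis by simp
  qed
  have "1 - cos 0 - 0\<^sup>2 / 4 \<le> 1 - cos u - u\<^sup>2 / 4"
    by (rule DERIV_nonneg_imp_nondecreasing[OF assms(1)])
       (use sin assms in \<open>auto intro!: exI derivative_eq_intros\<close>)
  then show ?thesis by simp
qed

lemma sin_le_self: "0 \<le> u \<Longrightarrow> sin u \<le> (u::real)"
  using abs_sin_x_le_abs_x[of u] by auto

text \<open>Neither summand suffices: \<open>1 - cos u\<close> is quadratic near 0 but vanishes at
  multiples of \<open>2 * pi\<close>, while \<open>u - sin u\<close> is cubic near 0 but grows
  linearly.\<close>

lemma cos_plus_sin_ge:
  assumes "0 \<le> (u::real)" shows "u * min 1 u / 8 \<le> (1 - cos u) + (u - sin u)"
proof -
  consider "u \<le> 1" | "1 \<le> u" "u \<le> 2" | "2 \<le> u" by linarith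
  then show ?thesis
  proof cases
    case 1
    then have "u * min 1 u / 8 \<le> u\<^sup>2 / 4" using assms by (simp add: min_def power2_eq_square)
    then show ?thesis using one_minus_cos_ge[OF assms 1] sin_le_self[OF assms] by linarith
  next
    case 2
    have "cos u \<le> cos 1" using 2 pi_gt3 by (intro cos_monotone_0_pi_le) auto
    then show ?thesis using one_minus_cos_ge[of 1] sin_le_self[OF assms] 2 by simp
  next
    case 3
    then have "u * min 1 u / 8 = u / 8" by simp
    then show ?thesis using sin_le_one[of u] cos_le_one[of u] 3 by linarith
  qed
qed

lemma self_minus_sin_le:
  assumes "0 \<le> (u::real)" shows "u - sin u \<le> 2 * u * (min 1 u)\<^sup>2"
proof (cases "u \<le> 1")
  case True
  have "\<bar>sin u - (\<Sum>m<3. sin_coeff m * u ^ m)\<bar> \<le> inverse (fact 3) * \<bar>u\<bar> ^ 3"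
    by (rule Maclaurin_sin_bound)
  then have "\<bar>sin u - u\<bar> \<le> u ^ 3 / 6"
    using assms by (simp add: eval_nat_numeral sin_coeff_def)
  then have "u - sin u \<le> u ^ 3 / 6" by linarith
  also have "\<dots> \<le> 2 * u * u\<^sup>2"
    using assms by (simp add: power3_eq_cube power2_eq_square)
  finally show ?thesis using True by (simp add: min_def)
next
  case False
  moreover have "- 1 \<le> sin u" by simp
  ultimately have "u - sin u \<le> 2 * u" by linarith
  then show ?thesis using False by simp
qed

lemma one_minus_cos_le: "1 - cos u \<le> 2 * (min 1 \<bar>u\<bar>)\<^sup>2" for u :: real
proof (cases "\<bar>u\<bar> \<le> 1")
  case True
  have "1 - cos u = 2 * (sin (u / 2))\<^sup>2" using cos_double_sin[of "u / 2"] by simp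
  also have "(sin (u / 2))\<^sup>2 \<le> \<bar>u / 2\<bar>\<^sup>2"
    using abs_sin_x_le_abs_x[of "u / 2"] by (intro abs_le_square_iff[THEN iffD1]) simp
  also have "2 * \<bar>u / 2\<bar>\<^sup>2 \<le> 2 * \<bar>u\<bar>\<^sup>2" by (simp add: power2_eq_square)
  finally show ?thesis using True by simp
next
  case False
  then show ?thesis using cos_ge_minus_one[of u] by (simp add: min_def)
qed

text \<open>For \<open>t\<close> in this set \<open>1 / t\<close> agrees with \<open>n\<close> up to
  a factor 2, which ties a frequency to a truncation level. The length is
  \<open>1 / (n * (n + 1))\<close>.\<close>

definition shell :: "nat \<Rightarrow> real set" where
  "shell n = {1 / (real n + 1) <.. 1 / real n}"

lemma shellD:
  assumes "t \<in> shell n" "1 \<le> n"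
  shows "0 < t" "t \<le> 1" "t * real n \<le> 1" "1 < t * (real n + 1)" "1 \<le> 2 * t * real n"
proof -
  have n: "1 \<le> real n" using assms(2) by simp
  have *: "1 / (real n + 1) < t" "t \<le> 1 / real n" using assms(1) by (auto simp: shell_def)
  show t: "0 < t" using * n by (smt (verit) zero_less_divide_1_iff)
  show a: "t * real n \<le> 1" using * n by (simp add: field_simps)
  show b: "1 < t * (real n + 1)" using * n by (simp add: field_simps)
  show "t \<le> 1" using a t n by (smt (verit) mult_le_cancel_left1)
  have "t \<le> t * real n" using n t by simp
  then show "1 \<le> 2 * t * real n" using b by (simp add: algebra_simps)
qed

lemma shell_min:
  assumes "t \<in> shell n" "1 \<le> n"
  shows "t * real (min k n) \<le> min 1 (t * real k)" "min 1 (t * real k) \<le> 2 * t * real (min k n)"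
proof -
  note s = shellD[OF assms]
  show "t * real (min k n) \<le> min 1 (t * real k)"
  proof (cases "k \<le> n")
    case True
    have "t * real k \<le> t * real n" using True s(1) by simp
    then show ?thesis using True s(3) by simp
  next
    case False
    then have "t * real n \<le> t * real k" using s(1) by simp
    then show ?thesis using False s(3) by (simp add: min_def)
  qed
  show "min 1 (t * real k) \<le> 2 * t * real (min k n)"
  proof (cases "k \<le> n")
    case True
    have "t * real k \<le> 2 * (t * real k)" using s(1) by simp
    then show ?thesis using True by (simp add: min_le_iff_disj mult.assoc)
  next
    case False
    then show ?thesis using s(5) by (simp add: min_le_iff_disj)
  qed
qed

text \<open>Averaged over the law, the four bounds produce \<open>M n\<close>,
  \<open>cube n\<close>, \<open>Mp n\<close> and \<open>D n\<close>, in this order.\<close>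

lemma shell_pointwise:
  assumes "t \<in> shell n" "1 \<le> n"
  defines "u \<equiv> \<lambda>k. t * real k"
  shows "t\<^sup>2 * trunc n k / 8 \<le> (1 - cos (u k)) + (u k - sin (u k))"
    and "u k - sin (u k) \<le> 8 * t ^ 3 * (real k * (real (min k n))\<^sup>2)"
    and "u k - sin (u k) \<le> 8 * t\<^sup>2 * trunc n k"
    and "1 - cos (u k) \<le> 16 * t\<^sup>2 * (trunc n k - real n * real (k - n))"
proof -
  note s = shellD[OF assms(1,2)] and m = shell_min[OF assms(1,2), of k]
  have u: "0 \<le> u k" using s by (simp add: u_def)
  have "t\<^sup>2 * trunc n k \<le> t\<^sup>2 * (real k * real (min k n))"
    by (intro mult_left_mono trunc_le) auto
  also have "\<dots> = u k * (t * real (min k n))" by (simp add: u_def power2_eq_square)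
  also have "\<dots> \<le> u k * min 1 (u k)" unfolding u_def using m s by (intro mult_left_mono) auto
  finally show "t\<^sup>2 * trunc n k / 8 \<le> (1 - cos (u k)) + (u k - sin (u k))"
    using cos_plus_sin_ge[OF u] by linarith
  have sq: "(min 1 (u k))\<^sup>2 \<le> (2 * t * real (min k n))\<^sup>2"
    using m u unfolding u_def by (intro power_mono) auto
  then have "2 * u k * (min 1 (u k))\<^sup>2 \<le> 2 * u k * (2 * t * real (min k n))\<^sup>2"
    using u by (intro mult_left_mono) auto
  also have "\<dots> = 8 * t ^ 3 * (real k * (real (min k n))\<^sup>2)"
    by (simp add: u_def power_mult_distrib power2_eq_square power3_eq_cube)
  finally show "u k - sin (u k) \<le> 8 * t ^ 3 * (real k * (real (min k n))\<^sup>2)"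
    using self_minus_sin_le[OF u] by linarith
  have "(min 1 (u k))\<^sup>2 \<le> min 1 (u k)" unfolding power2_eq_square using u
    by (intro mult_left_le) auto
  also have "\<dots> \<le> 2 * t * real (min k n)" using m by (simp add: u_def)
  finally have "2 * u k * (min 1 (u k))\<^sup>2 \<le> 2 * u k * (2 * t * real (min k n))"
    using u by (intro mult_left_mono) auto
  also have "\<dots> = 4 * t\<^sup>2 * (real k * real (min k n))" by (simp add: u_def power2_eq_square)
  also have "\<dots> \<le> 4 * t\<^sup>2 * (2 * trunc n k)" by (intro mult_left_mono trunc_ge) auto
  finally show "u k - sin (u k) \<le> 8 * t\<^sup>2 * trunc n k"
    using self_minus_sin_le[OF u] by linarith
  have "1 - cos (u k) \<le> 2 * (2 * t * real (min k n))\<^sup>2"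
    using one_minus_cos_le[of "u k"] sq u by simp
  also have "\<dots> = 8 * t\<^sup>2 * (real (min k n))\<^sup>2" by (simp add: power_mult_distrib)
  also have "\<dots> \<le> 8 * t\<^sup>2 * (2 * (trunc n k - real n * real (k - n)))"
    by (intro mult_left_mono trunc_minus_ge) auto
  also have "\<dots> = 16 * t\<^sup>2 * (trunc n k - real n * real (k - n))" by simp
  finally show "1 - cos (u k) \<le> 16 * t\<^sup>2 * (trunc n k - real n * real (k - n))" .
qed

context centred_law begin

abbreviation "\<phi> \<equiv> char_int P"

lemma integrable_iexp: "integrable (measure_pmf P) (\<lambda>k. iexp (t * real_of_int k))"
  by (rule measure_pmf.integrable_const_bound[of _ 1]) auto

lemma integrable_trig: "integrable (measure_pmf P) (\<lambda>k. cos (t * real_of_int k))"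
    "integrable (measure_pmf P) (\<lambda>k. sin (t * real_of_int k))"
  by (rule measure_pmf.integrable_const_bound[of _ 1]; simp)+

lemma Re_char: "Re (\<phi> t) = E (\<lambda>k. cos (t * real_of_int k))"
  unfolding char_int_def using integral_Re[OF integrable_iexp[of t]] by (simp add: Re_exp)

lemma Im_char: "Im (\<phi> t) = E (\<lambda>k. sin (t * real_of_int k))"
  unfolding char_int_def using integral_Im[OF integrable_iexp[of t]] by (simp add: Im_exp)

lemma norm_char_le: "norm (\<phi> t) \<le> 1"
proof -
  have "norm (\<phi> t) \<le> E (\<lambda>k. norm (iexp (t * real_of_int k)))"
    unfolding char_int_def by (rule integral_norm_bound)
  then show ?thesis by simp
qed

lemma Re_char_le: "Re (\<phi> t) \<le> 1"
  using complex_Re_le_cmod[of "\<phi> t"] norm_char_le[of t] by linarith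

lemma integrable_one_minus_cos: "integrable (measure_pmf P) (\<lambda>k. 1 - cos (t * real (nat \<bar>k\<bar>)))"
proof -
  have "integrable (measure_pmf P) (\<lambda>k. cos (t * real (nat \<bar>k\<bar>)))"
    by (rule measure_pmf.integrable_const_bound[of _ 1]; simp)
  then show ?thesis by (intro Bochner_Integration.integrable_diff) auto
qed

lemma one_minus_Re_char: "1 - Re (\<phi> t) = E (\<lambda>k. 1 - cos (t * real (nat \<bar>k\<bar>)))"
proof -
  have "cos (t * \<bar>real_of_int k\<bar>) = cos (t * real_of_int k)" for k
    by (cases "k \<ge> 0") auto
  then show ?thesis using integrable_trig(1) by (simp add: Re_char)
qed

lemma integrable_self_minus_sin:
  "integrable (measure_pmf P) (\<lambda>k. t * real (nat \<bar>k\<bar>) - sin (t * real (nat \<bar>k\<bar>)))"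
  "integrable (measure_pmf P) (\<lambda>k. t * real (nat k) - sin (t * real (nat k)))"
  "integrable (measure_pmf P) (\<lambda>k. t * real_of_int k - sin (t * real_of_int k))"
proof -
  have *: "\<bar>u - sin u\<bar> \<le> 2 * \<bar>u\<bar>" for u :: real
    using abs_sin_x_le_abs_x[of u] by linarith
  show "integrable (measure_pmf P) (\<lambda>k. t * real (nat \<bar>k\<bar>) - sin (t * real (nat \<bar>k\<bar>)))"
    by (rule integrable_bound[of _ "2 * \<bar>t\<bar>"], rule order_trans[OF *]) (auto simp: abs_mult)
  show "integrable (measure_pmf P) (\<lambda>k. t * real (nat k) - sin (t * real (nat k)))"
    by (rule integrable_bound[of _ "2 * \<bar>t\<bar>"], rule order_trans[OF *]) (auto simp: abs_mult intro!: mult_left_mono)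
  show "integrable (measure_pmf P) (\<lambda>k. t * real_of_int k - sin (t * real_of_int k))"
    by (rule integrable_bound[of _ "2 * \<bar>t\<bar>"], rule order_trans[OF *]) (auto simp: abs_mult)
qed

text \<open>Subtracting the mean, which is 0, makes the integrand cubic near 0.\<close>

lemma Im_char_eq: "Im (\<phi> t) = - E (\<lambda>k. t * real_of_int k - sin (t * real_of_int k))"
  using integrable_trig(2)[of t] integrable_law mean_zero by (simp add: Im_char)

text \<open>The function \<open>u - sin u\<close> is odd, so negative jumps enter
  \<open>Im \<phi>\<close> with a plus sign. Giving all jumps a plus sign counts the positive ones
  wrongly, by twice their contribution.\<close>

lemma Im_char_ge:
  "Im (\<phi> t) = E (\<lambda>k. t * real (nat \<bar>k\<bar>) - sin (t * real (nat \<bar>k\<bar>)))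
     - 2 * E (\<lambda>k. t * real (nat k) - sin (t * real (nat k)))"
proof -
  have "t * real (nat \<bar>k\<bar>) - sin (t * real (nat \<bar>k\<bar>)) =
     2 * (t * real (nat k) - sin (t * real (nat k))) - (t * real_of_int k - sin (t * real_of_int k))" for k
    by (cases "0 \<le> k") auto
  then have "E (\<lambda>k. t * real (nat \<bar>k\<bar>) - sin (t * real (nat \<bar>k\<bar>))) =
     E (\<lambda>k. 2 * (t * real (nat k) - sin (t * real (nat k))) - (t * real_of_int k - sin (t * real_of_int k)))"
    by presburger
  also have "\<dots> = E (\<lambda>k. 2 * (t * real (nat k) - sin (t * real (nat k)))) - E (\<lambda>k. t * real_of_int k - sin (t * real_of_int k))"
    by (intro Bochner_Integration.integral_diff integrable_mult_right integrable_self_minus_sin)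
  also have "E (\<lambda>k. 2 * (t * real (nat k) - sin (t * real (nat k)))) = 2 * E (\<lambda>k. t * real (nat k) - sin (t * real (nat k)))"
    by (rule integral_mult_right_zero)
  finally show ?thesis using Im_char_eq[of t] by linarith
qed

text \<open>Up to the positive tail, \<open>Im \<phi>\<close> equals the nonnegative mean of
  \<open>t|X| - sin (t|X|)\<close>. Hence it adds to \<open>1 - Re \<phi>\<close>, and
  \<open>cos_plus_sin_ge\<close> applies to the sum of both parts.\<close>

lemma char_lower_shell:
  assumes "t \<in> shell n" "1 \<le> n"
  shows "t\<^sup>2 * (M n / 8 - 16 * Mp n) \<le> 2 * norm (1 - \<phi> t)"
proof -
  have "t\<^sup>2 / 8 * M n = E (\<lambda>k. t\<^sup>2 * trunc n (nat \<bar>k\<bar>) / 8)" by (simp add: dtail_eq)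
  also have "\<dots> \<le> E (\<lambda>k. (1 - cos (t * real (nat \<bar>k\<bar>))) + (t * real (nat \<bar>k\<bar>) - sin (t * real (nat \<bar>k\<bar>))))"
  proof (intro integral_mono)
    show "integrable (measure_pmf P) (\<lambda>k. t\<^sup>2 * trunc n (nat \<bar>k\<bar>) / 8)"
      using integrable_trunc by simp
    show "integrable (measure_pmf P) (\<lambda>k. (1 - cos (t * real (nat \<bar>k\<bar>))) + (t * real (nat \<bar>k\<bar>) - sin (t * real (nat \<bar>k\<bar>))))"
      by (intro Bochner_Integration.integrable_add integrable_self_minus_sin integrable_one_minus_cos)
    show "t\<^sup>2 * trunc n (nat \<bar>k\<bar>) / 8 \<le> (1 - cos (t * real (nat \<bar>k\<bar>))) + (t * real (nat \<bar>k\<bar>) - sin (t * real (nat \<bar>k\<bar>)))" for k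
      by (rule shell_pointwise(1)[OF assms])
  qed
  also have "\<dots> = (1 - Re (\<phi> t)) + E (\<lambda>k. t * real (nat \<bar>k\<bar>) - sin (t * real (nat \<bar>k\<bar>)))"
    unfolding one_minus_Re_char
    by (intro Bochner_Integration.integral_add integrable_self_minus_sin integrable_one_minus_cos)
  also have "\<dots> = (1 - Re (\<phi> t)) + Im (\<phi> t) + 2 * E (\<lambda>k. t * real (nat k) - sin (t * real (nat k)))"
    using Im_char_ge[of t] by linarith
  also have "E (\<lambda>k. t * real (nat k) - sin (t * real (nat k))) \<le> E (\<lambda>k. 8 * t\<^sup>2 * trunc n (nat k))"
    using integrable_trunc_pos by (intro integral_mono integrable_self_minus_sin shell_pointwise(3)[OF assms]) simp
  also have "\<dots> = 8 * t\<^sup>2 * Mp n" by (simp add: pos_dtail_eq)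
  finally have "t\<^sup>2 / 8 * M n \<le> (1 - Re (\<phi> t)) + Im (\<phi> t) + 16 * t\<^sup>2 * Mp n" by simp
  moreover have "1 - Re (\<phi> t) \<le> norm (1 - \<phi> t)" using complex_Re_le_cmod[of "1 - \<phi> t"] by simp
  moreover have "Im (\<phi> t) \<le> norm (1 - \<phi> t)" using abs_Im_le_cmod[of "1 - \<phi> t"] by simp
  ultimately show ?thesis by (simp add: right_diff_distrib)
qed

lemma Re_char_shell:
  assumes "t \<in> shell n" "1 \<le> n"
  shows "1 - Re (\<phi> t) \<le> 16 * t\<^sup>2 * D n"
proof -
  have "1 - Re (\<phi> t) \<le> E (\<lambda>k. 16 * t\<^sup>2 * (trunc n (nat \<bar>k\<bar>) - real n * real (nat \<bar>k\<bar> - n)))"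
    unfolding one_minus_Re_char
    by (intro integral_mono shell_pointwise(4)[OF assms] integrable_one_minus_cos
          integrable_mult_right Bochner_Integration.integrable_diff integrable_trunc integrable_tail)
  also have "\<dots> = 16 * t\<^sup>2 * D n"
    unfolding D_def dtail_eq tail_exp_def using integrable_trunc integrable_tail by simp
  finally show ?thesis .
qed

text \<open>A truncated third absolute moment, the natural bound for the mean of
  \<open>u - sin u\<close>.\<close>

definition "cube n = E (\<lambda>k. real (nat \<bar>k\<bar>) * (real (min (nat \<bar>k\<bar>) n))\<^sup>2)"

lemma integrable_cube: "integrable (measure_pmf P) (\<lambda>k. real (nat \<bar>k\<bar>) * (real (min (nat \<bar>k\<bar>) n))\<^sup>2)"
proof (rule integrable_bound[of _ "(real n)\<^sup>2"])
  fix k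
  have "(real (min (nat \<bar>k\<bar>) n))\<^sup>2 \<le> (real n)\<^sup>2" by (intro power_mono) auto
  then have "real (nat \<bar>k\<bar>) * (real (min (nat \<bar>k\<bar>) n))\<^sup>2 \<le> real (nat \<bar>k\<bar>) * (real n)\<^sup>2"
    by (intro mult_left_mono) auto
  then show "\<bar>real (nat \<bar>k\<bar>) * (real (min (nat \<bar>k\<bar>) n))\<^sup>2\<bar> \<le> (real n)\<^sup>2 * \<bar>real_of_int k\<bar>"
    by (simp add: abs_mult mult.commute)
qed

lemma Im_char_shell:
  assumes "t \<in> shell n" "1 \<le> n"
  shows "\<bar>Im (\<phi> t)\<bar> \<le> 8 * t ^ 3 * cube n"
proof -
  have eq: "\<bar>t * real_of_int k - sin (t * real_of_int k)\<bar> = t * real (nat \<bar>k\<bar>) - sin (t * real (nat \<bar>k\<bar>))" for k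
  proof (cases "0 \<le> k")
    case True
    then show ?thesis using sin_le_self[of "t * real_of_int k"] shellD(1)[OF assms] by simp
  next
    case False
    then have "0 \<le> - (t * real_of_int k)" using shellD(1)[OF assms] by (simp add: mult_nonneg_nonpos)
    from sin_le_self[OF this] show ?thesis using False by simp
  qed
  have "\<bar>Im (\<phi> t)\<bar> \<le> E (\<lambda>k. \<bar>t * real_of_int k - sin (t * real_of_int k)\<bar>)"
    unfolding Im_char_eq abs_minus_cancel by (rule integral_abs_bound)
  also have "\<dots> \<le> E (\<lambda>k. 8 * t ^ 3 * (real (nat \<bar>k\<bar>) * (real (min (nat \<bar>k\<bar>) n))\<^sup>2))"
    unfolding eq
    by (intro integral_mono shell_pointwise(2)[OF assms] integrable_self_minus_sin integrable_mult_right integrable_cube)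
  also have "\<dots> = 8 * t ^ 3 * cube n" unfolding cube_def by (rule integral_mult_right_zero)
  finally show ?thesis .
qed

lemma char_lipschitz: "norm (\<phi> t - \<phi> s) \<le> \<bar>t - s\<bar> * E (\<lambda>k. \<bar>real_of_int k\<bar>)"
proof -
  have 1: "norm (iexp a - iexp b) \<le> \<bar>a - b\<bar>" for a b :: real
  proof -
    have "iexp a - iexp b = iexp b * (iexp (a - b) - 1)"
      by (simp add: right_diff_distrib exp_add[symmetric] algebra_simps)
    then have "norm (iexp a - iexp b) = norm (iexp (a - b) - 1)" by (simp add: norm_mult)
    also have "\<dots> \<le> \<bar>a - b\<bar>" using iexp_approx1[of "a - b" 0] by simp
    finally show ?thesis .
  qed
  have "\<phi> t - \<phi> s = E (\<lambda>k. iexp (t * real_of_int k) - iexp (s * real_of_int k))"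
    unfolding char_int_def by (intro Bochner_Integration.integral_diff[symmetric] integrable_iexp)
  also have "norm \<dots> \<le> E (\<lambda>k. norm (iexp (t * real_of_int k) - iexp (s * real_of_int k)))"
    by (rule integral_norm_bound)
  also have "\<dots> \<le> E (\<lambda>k. \<bar>t - s\<bar> * \<bar>real_of_int k\<bar>)"
  proof (intro integral_mono)
    show "norm (iexp (t * real_of_int k) - iexp (s * real_of_int k)) \<le> \<bar>t - s\<bar> * \<bar>real_of_int k\<bar>" for k
      using 1[of "t * real_of_int k" "s * real_of_int k"] by (simp add: left_diff_distrib[symmetric] abs_mult)
    show "integrable (measure_pmf P) (\<lambda>k. norm (iexp (t * real_of_int k) - iexp (s * real_of_int k)))"
      by (intro integrable_norm Bochner_Integration.integrable_diff integrable_iexp)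
  qed (use integrable_law in simp)
  also have "\<dots> = \<bar>t - s\<bar> * E (\<lambda>k. \<bar>real_of_int k\<bar>)" by (rule integral_mult_right_zero)
  finally show ?thesis .
qed

lemma continuous_char: "continuous_on S \<phi>"
proof (rule continuous_on_subset[of UNIV])
  define L where "L = E (\<lambda>k. \<bar>real_of_int k\<bar>)"
  have "L-lipschitz_on UNIV \<phi>"
    using char_lipschitz by (intro lipschitz_onI) (auto simp: L_def dist_norm mult.commute)
  then show "continuous_on UNIV \<phi>" by (rule lipschitz_on_continuous_on)
qed simp

lemma measurable_char [measurable]: "\<phi> \<in> borel_measurable borel"
  by (rule borel_measurable_continuous_onI[OF continuous_char])

lemma char_lower_away:
  assumes "0 < a" obtains c where "0 < c" "\<And>t. a \<le> t \<Longrightarrow> t \<le> pi \<Longrightarrow> c \<le> norm (1 - \<phi> t)"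
proof (cases "a \<le> pi")
  case True
  have "\<exists>s\<in>{a..pi}. \<forall>t\<in>{a..pi}. norm (1 - \<phi> s) \<le> norm (1 - \<phi> t)"
    using True by (intro continuous_attains_inf continuous_intros continuous_char) auto
  then obtain s where s: "s \<in> {a..pi}" "\<forall>t\<in>{a..pi}. norm (1 - \<phi> s) \<le> norm (1 - \<phi> t)" by auto
  then have "0 < norm (1 - \<phi> s)" using char_neq_1[of s] assms by auto
  then show ?thesis using s(2) by (intro that) auto
qed (use that[of 1] in auto)

text \<open>Near 0 the positive tail is negligible and \<open>char_lower_shell\<close> decides. The
  finitely many other shells stay away from 0, where compactness and \<open>char_neq_1\<close> give
  a positive minimum.\<close>

lemma char_lower:
  obtains c where "0 < c" "\<And>n t. 1 \<le> n \<Longrightarrow> t \<in> shell n \<Longrightarrow> c * t\<^sup>2 * M n \<le> norm (1 - \<phi> t)"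
    "\<And>t. 1 \<le> t \<Longrightarrow> t \<le> pi \<Longrightarrow> c \<le> norm (1 - \<phi> t)"
proof -
  \<comment> \<open>With this threshold \<open>16 * Mp n \<le> M n / 16\<close>, which is half of
    the main term \<open>M n / 8\<close>.\<close>
  have "eventually (\<lambda>n. Mp n / M n < 1 / 256) sequentially"
    using pos_dtail_ratio by (rule order_tendstoD) simp
  then obtain N where N: "\<And>n. n \<ge> N \<Longrightarrow> Mp n / M n < 1 / 256" by (auto simp: eventually_sequentially)
  obtain c0 where c0: "0 < c0" "\<And>t. 1 / (real N + 1) \<le> t \<Longrightarrow> t \<le> pi \<Longrightarrow> c0 \<le> norm (1 - \<phi> t)"
    using char_lower_away[of "1 / (real N + 1)"] by auto
  \<comment> \<open>On the shells with \<open>n < N\<close> one has \<open>t \<le> 1\<close> and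
    \<open>M n \<le> M (Suc N)\<close>, so \<open>c0 / M (Suc N)\<close> reduces the claim to
    \<open>c0\<close>.\<close>
  define c where "c = min (1 / 32) (min c0 (c0 / M (Suc N)))"
  have MN: "0 < M (Suc N)" by (rule M_pos) simp
  show ?thesis
  proof (rule that[of c])
    show "0 < c" using c0 MN by (simp add: c_def)
    show "c \<le> norm (1 - \<phi> t)" if "1 \<le> t" "t \<le> pi" for t
    proof -
      have "1 / (real N + 1) \<le> 1" by simp
      then have "1 / (real N + 1) \<le> t" using that by linarith
      then show ?thesis using c0(2)[of t] that by (auto simp: c_def)
    qed
    fix n t assume n: "1 \<le> n" and t: "t \<in> shell n"
    note s = shellD[OF t n]
    show "c * t\<^sup>2 * M n \<le> norm (1 - \<phi> t)"
    proof (cases "n \<ge> N")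
      case True
      then have "Mp n \<le> M n / 256" using N[OF True] M_pos[of n] n by (simp add: field_simps)
      then have "t\<^sup>2 * (M n / 16) \<le> t\<^sup>2 * (M n / 8 - 16 * Mp n)" by (intro mult_left_mono) auto
      also have "\<dots> \<le> 2 * norm (1 - \<phi> t)" by (rule char_lower_shell[OF t n])
      finally have "1 / 32 * (t\<^sup>2 * M n) \<le> norm (1 - \<phi> t)" by simp
      moreover have "c * (t\<^sup>2 * M n) \<le> 1 / 32 * (t\<^sup>2 * M n)"
        unfolding c_def using M_nonneg(1)[of n] by (intro mult_right_mono min.cobounded1) auto
      ultimately show ?thesis by (simp add: mult.assoc)
    next
      case False
      have "1 / (real N + 1) \<le> 1 / (real n + 1)" using False by (intro divide_left_mono) auto
      then have tN: "1 / (real N + 1) \<le> t" using t by (auto simp: shell_def)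
      have "c * t\<^sup>2 * M n \<le> c0 / M (Suc N) * 1 * M (Suc N)"
        using s False M_nonneg M_mono(1)[of n "Suc N"] c0(1) MN power_le_one[of t 2]
        by (intro mult_mono) (auto simp: c_def)
      also have "\<dots> = c0" using MN by simp
      also have "\<dots> \<le> norm (1 - \<phi> t)" using tN s(2) pi_gt3 by (intro c0) auto
      finally show ?thesis .
    qed
  qed
qed

end

section \<open>Fourier representation of the potential\<close>

primrec walk_pmf :: "int pmf \<Rightarrow> nat \<Rightarrow> int pmf" where
  "walk_pmf P 0 = return_pmf 0"
| "walk_pmf P (Suc n) = bind_pmf (walk_pmf P n) (\<lambda>z. map_pmf (\<lambda>k. z + k) P)"

lemma pmf_map_add: "pmf (map_pmf (\<lambda>k. z + k) P) i = pmf P (i - z)" for z :: int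
  using pmf_map_inj'[of "\<lambda>k. z + k" P "i - z"] by (simp add: inj_def)

lemma pmf_walk_Suc:
  "ennreal (pmf (walk_pmf P (Suc n)) y) =
     (\<integral>\<^sup>+z. ennreal (pmf (walk_pmf P n) z) * ennreal (pmf P (y - z)) \<partial>count_space UNIV)"
  by (simp add: ennreal_pmf_bind pmf_map_add nn_integral_measure_pmf)

lemma nn_integral_count_space_shift:
  "(\<integral>\<^sup>+z. f (z - x) \<partial>count_space UNIV) = (\<integral>\<^sup>+z. f z \<partial>count_space UNIV)" for x :: int
  by (rule nn_integral_bij_count_space) (auto simp: bij_betw_def inj_on_def intro!: image_eqI[of _ _ "_ + x"])

lemma taboo_empty: "taboo P {} x n y = ennreal (pmf (walk_pmf P (Suc n)) (y - x))"
proof (induction n arbitrary: y)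
  case 0
  show ?case unfolding taboo.simps walk_pmf.simps bind_return_pmf pmf_map_add by simp
next
  case (Suc n)
  have "taboo P {} x (Suc n) y = (\<integral>\<^sup>+z. (\<lambda>z. ennreal (pmf (walk_pmf P (Suc n)) z) * ennreal (pmf P (y - x - z))) (z - x) \<partial>count_space UNIV)"
    unfolding taboo.simps Suc by (simp add: algebra_simps del: walk_pmf.simps)
  also have "\<dots> = ennreal (pmf (walk_pmf P (Suc (Suc n))) (y - x))"
    unfolding pmf_walk_Suc[of _ "Suc n"] by (rule nn_integral_count_space_shift)
  finally show ?case .
qed

lemma integral_bind_pmf_bounded:
  fixes f :: "'b \<Rightarrow> real"
  assumes "\<And>x. \<bar>f x\<bar> \<le> B"
  shows "measure_pmf.expectation (bind_pmf Q N) f = measure_pmf.expectation Q (\<lambda>x. measure_pmf.expectation (N x) f)"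
  unfolding measure_pmf_bind
  using measurable_measure_pmf[of N] assms
  by (intro integral_bind[where K = "count_space UNIV" and B = B and B' = 1]) 
     (auto simp: measure_pmf.finite_measure_axioms)

lemma Re_char_int: "Re (char_int Q t) = measure_pmf.expectation Q (\<lambda>k. cos (t * real_of_int k))"
proof -
  have "integrable (measure_pmf Q) (\<lambda>k. iexp (t * real_of_int k))"
    by (rule measure_pmf.integrable_const_bound[of _ 1]) auto
  from integral_Re[OF this] show ?thesis by (simp add: char_int_def Re_exp)
qed

lemma Im_char_int: "Im (char_int Q t) = measure_pmf.expectation Q (\<lambda>k. sin (t * real_of_int k))"
proof -
  have "integrable (measure_pmf Q) (\<lambda>k. iexp (t * real_of_int k))"
    by (rule measure_pmf.integrable_const_bound[of _ 1]) auto
  from integral_Im[OF this] show ?thesis by (simp add: char_int_def Im_exp)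
qed

lemma integrable_cos_sin: "integrable (measure_pmf Q) (\<lambda>k. cos (h k))" "integrable (measure_pmf Q) (\<lambda>k. sin (h k))"
  for h :: "'a \<Rightarrow> real"
  by (rule measure_pmf.integrable_const_bound[of _ 1]; simp)+

lemma expectation_cos_shift:
  "measure_pmf.expectation Q (\<lambda>k. cos (t * real_of_int (y + k))) = Re (char_int Q t * iexp (t * real_of_int y))"
  unfolding times_complex.sel Re_char_int Im_char_int
  by (simp add: Re_exp Im_exp distrib_left cos_add integrable_cos_sin mult.commute)

lemma expectation_sin_shift:
  "measure_pmf.expectation Q (\<lambda>k. sin (t * real_of_int (y + k))) = Im (char_int Q t * iexp (t * real_of_int y))"
  unfolding times_complex.sel Re_char_int Im_char_int
  by (simp add: Re_exp Im_exp distrib_left sin_add integrable_cos_sin mult.commute add.commute)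

lemma char_walk_pmf: "char_int (walk_pmf P n) t = char_int P t ^ n"
proof (induction n)
  case 0
  show ?case by (simp add: char_int_def)
next
  case (Suc n)
  let ?Q = "walk_pmf P n" and ?c = "char_int P t"
  have "Re (char_int (walk_pmf P (Suc n)) t) = measure_pmf.expectation ?Q (\<lambda>z. Re (?c * iexp (t * real_of_int z)))"
    unfolding Re_char_int[of "walk_pmf P (Suc n)"] unfolding walk_pmf.simps
    by (subst integral_bind_pmf_bounded[where B = 1])
       (simp_all only: integral_map_pmf expectation_cos_shift abs_cos_le_one)
  also have "\<dots> = Re (?c * char_int ?Q t)"
    unfolding times_complex.sel Re_char_int[of ?Q] Im_char_int[of ?Q]
    by (simp add: Re_exp Im_exp integrable_cos_sin)
  finally have 1: "Re (char_int (walk_pmf P (Suc n)) t) = Re (?c * char_int ?Q t)" .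
  have "Im (char_int (walk_pmf P (Suc n)) t) = measure_pmf.expectation ?Q (\<lambda>z. Im (?c * iexp (t * real_of_int z)))"
    unfolding Im_char_int[of "walk_pmf P (Suc n)"] unfolding walk_pmf.simps
    by (subst integral_bind_pmf_bounded[where B = 1])
       (simp_all only: integral_map_pmf expectation_sin_shift abs_sin_le_one)
  also have "\<dots> = Im (?c * char_int ?Q t)"
    unfolding times_complex.sel Re_char_int[of ?Q] Im_char_int[of ?Q]
    by (simp add: Re_exp Im_exp integrable_cos_sin)
  finally show ?case using 1 Suc by (simp add: complex_eq_iff)
qed

text \<open>The real parts to be integrated are even in \<open>t\<close>, so half of the circle
  suffices.\<close>

abbreviation half_circle :: "real measure" where
  "half_circle \<equiv> restrict_space lborel {0..pi}"

lemma finite_half_circle: "finite_measure half_circle"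
  by (rule finite_measureI) (simp add: emeasure_restrict_space)

lemma integral_cos_half_circle:
  "(\<integral>t. cos (t * real_of_int m) \<partial>half_circle) = (if m = 0 then pi else 0)"
proof (cases "m = 0")
  case True
  then show ?thesis by (simp add: measure_restrict_space)
next
  case False
  have "(\<integral>t. cos (t * real_of_int m) * indicator {0..pi} t \<partial>lborel) = sin (pi * real_of_int m) / real_of_int m - sin (0 * real_of_int m) / real_of_int m"
    using False by (intro integral_FTC_Icc_real) (auto intro!: derivative_eq_intros continuous_intros)
  moreover have "sin (pi * real_of_int m) = 0" using sin_integer_2pi[of m] by (simp add: sin_zero_iff_int2 mult.commute)
  ultimately show ?thesis using False by (simp add: integral_restrict_space mult.commute)
qed

lemma pmf_inversion:
  "pmf Q (- y) = (\<integral>t. Re (char_int Q t * iexp (t * real_of_int y)) \<partial>half_circle) / pi"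
proof -
  interpret L: finite_measure half_circle by (rule finite_half_circle)
  interpret LQ: pair_sigma_finite half_circle "measure_pmf Q" ..
  interpret Lp: finite_measure "half_circle \<Otimes>\<^sub>M measure_pmf Q"
    by (rule finite_measure_pair_measure[OF measure_pmf.finite_measure_axioms finite_half_circle])
  have "(\<lambda>p. cos (fst p * real_of_int (y + snd p))) \<in> borel_measurable (half_circle \<Otimes>\<^sub>M measure_pmf Q)"
  proof -
    have 1: "(\<lambda>p. real_of_int (y + snd p)) \<in> borel_measurable (half_circle \<Otimes>\<^sub>M measure_pmf Q)"
      by (rule measurable_compose[OF measurable_snd]) simp
    have 2: "(\<lambda>p. fst p) \<in> borel_measurable (half_circle \<Otimes>\<^sub>M measure_pmf Q)"
      by (rule measurable_compose[OF measurable_fst]) (auto intro: measurable_restrict_space1)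
    show ?thesis using 1 2 by measurable
  qed
  then have int: "integrable (half_circle \<Otimes>\<^sub>M measure_pmf Q) (\<lambda>(t, k). cos (t * real_of_int (y + k)))"
    by (intro Lp.integrable_const_bound[of _ 1]) (auto simp: split_beta)
  have "(\<integral>t. Re (char_int Q t * iexp (t * real_of_int y)) \<partial>half_circle) =
      (\<integral>t. measure_pmf.expectation Q (\<lambda>k. cos (t * real_of_int (y + k))) \<partial>half_circle)"
    by (simp only: expectation_cos_shift)
  also have "\<dots> = measure_pmf.expectation Q (\<lambda>k. \<integral>t. cos (t * real_of_int (y + k)) \<partial>half_circle)"
    by (rule LQ.Fubini_integral[OF int, symmetric])
  also have "\<dots> = measure_pmf.expectation Q (\<lambda>k. pi * indicator {- y} k)"
    unfolding integral_cos_half_circle by (intro Bochner_Integration.integral_cong) (auto simp: indicator_def)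
  also have "\<dots> = pi * pmf Q (- y)" by (simp add: measure_pmf_single)
  finally show ?thesis by simp
qed

section \<open>Geometric sums in the closed unit disc\<close>

lemma abs_Im_power_le: "cmod z \<le> 1 \<Longrightarrow> \<bar>Im (z ^ n)\<bar> \<le> real n * cmod z ^ (n - 1) * \<bar>Im z\<bar>"
proof (induction n)
  case (Suc n)
  have "\<bar>Im (z ^ Suc n)\<bar> \<le> \<bar>Im (z ^ n)\<bar> * \<bar>Re z\<bar> + \<bar>Re (z ^ n)\<bar> * \<bar>Im z\<bar>"
    by (simp add: mult.commute abs_mult[symmetric] abs_triangle_ineq add.commute)
  also have "\<dots> \<le> (real n * cmod z ^ (n - 1) * \<bar>Im z\<bar>) * cmod z + cmod z ^ n * \<bar>Im z\<bar>"
    using Suc abs_Re_le_cmod[of z] abs_Re_le_cmod[of "z ^ n"]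
    by (intro add_mono mult_mono) (auto simp: norm_power)
  also have "\<dots> = real (Suc n) * cmod z ^ n * \<bar>Im z\<bar>"
    by (cases n) (simp_all add: algebra_simps)
  finally show ?case by simp
qed simp

lemma geometric_sum_complex: "z \<noteq> 1 \<Longrightarrow> (\<Sum>n<N. z ^ n) = (1 - z ^ N) / (1 - z)" for z :: complex
  using sum_gp_strict[of z N] by simp

lemma norm_geometric_sum_le:
  assumes "cmod z \<le> 1" "z \<noteq> 1" shows "cmod (\<Sum>n<N. z ^ n) \<le> 2 / cmod (1 - z)"
proof -
  have "cmod (1 - z ^ N) \<le> 1 + cmod z ^ N" using norm_triangle_ineq4[of 1 "z ^ N"] by (simp add: norm_power)
  also have "\<dots> \<le> 2" using power_le_one[of "cmod z" N] assms by simp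
  finally show ?thesis
    unfolding geometric_sum_complex[OF assms(2)] norm_divide by (intro divide_right_mono) auto
qed

text \<open>Uniform in \<open>N\<close>, and finer than \<open>2 / |1 - z|\<close>. In the potential
  this sum is multiplied by \<open>sin (t * x)\<close>, which supplies only one factor
  \<open>t\<close>; then \<open>t * |Im \<phi>| / |1 - \<phi>|^2\<close> is integrable, whereas
  \<open>t / |1 - \<phi>|\<close> need not be.\<close>

lemma Im_geometric_sum_le:
  assumes "cmod z \<le> 1" "z \<noteq> 1"
  shows "\<bar>Im (\<Sum>n<N. z ^ n)\<bar> \<le> 4 * \<bar>Im z\<bar> / (cmod (1 - z))\<^sup>2 + 4"
proof -
  define \<rho> where "\<rho> = 1 - Re z"
  have pos: "0 < cmod (1 - z)" using assms(2) by simp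
  have \<rho>0: "0 \<le> \<rho>" using complex_Re_le_cmod[of z] assms by (simp add: \<rho>_def)
  show ?thesis
  proof (cases "1 / 2 \<le> \<rho>")
    case True
    have "1 / 2 \<le> cmod (1 - z)" using True complex_Re_le_cmod[of "1 - z"] by (simp add: \<rho>_def)
    then have "2 / cmod (1 - z) \<le> 4" using pos by (simp add: divide_le_eq)
    then have "\<bar>Im (\<Sum>n<N. z ^ n)\<bar> \<le> 4"
      using norm_geometric_sum_le[OF assms, of N] abs_Im_le_cmod[of "\<Sum>n<N. z ^ n"] by linarith
    moreover have "0 \<le> 4 * \<bar>Im z\<bar> / (cmod (1 - z))\<^sup>2" by simp
    ultimately show ?thesis by linarith
  next
    case False
    have zN: "cmod (z ^ N) \<le> 1" using assms by (simp add: norm_power power_le_one)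
    \<comment> \<open>In the numerator of the closed form this product is the only one without a
      factor \<open>Im z\<close>. If \<open>\<rho> < |Im z|\<close> it is trivially small; otherwise
      \<open>|z| \<le> 1 - \<rho> / 2\<close>, and the decay of the powers compensates
      \<open>N\<close>.\<close>
    have key: "\<bar>Im (z ^ N)\<bar> * \<rho> \<le> 2 * \<bar>Im z\<bar>"
    proof (cases "\<rho> < \<bar>Im z\<bar>")
      case True
      have "\<bar>Im (z ^ N)\<bar> * \<rho> \<le> 1 * \<rho>"
        using abs_Im_le_cmod[of "z ^ N"] zN \<rho>0 by (intro mult_right_mono) auto
      then show ?thesis using True by simp
    next
      case Im: False
      have \<rho>: "0 < \<rho>"
      proof (rule ccontr)
        assume "\<not> 0 < \<rho>"
        then have "z = 1" using \<rho>0 Im by (simp add: complex_eq_iff \<rho>_def)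
        then show False using assms by simp
      qed
      have "(cmod z)\<^sup>2 = (1 - \<rho>)\<^sup>2 + \<bar>Im z\<bar>\<^sup>2" by (simp add: cmod_power2 \<rho>_def)
      moreover have "\<bar>Im z\<bar>\<^sup>2 \<le> \<rho>\<^sup>2" using Im by (intro power_mono) auto
      moreover have "(1 - \<rho>)\<^sup>2 + \<rho>\<^sup>2 \<le> (1 - \<rho> / 2)\<^sup>2"
      proof -
        have "\<rho> * (7 * \<rho>) \<le> \<rho> * 4" using False \<rho> by (intro mult_left_mono) auto
        then show ?thesis by (simp add: power2_eq_square algebra_simps)
      qed
      ultimately have "(cmod z)\<^sup>2 \<le> (1 - \<rho> / 2)\<^sup>2" by linarith
      then have r: "cmod z \<le> 1 - \<rho> / 2" using False by (intro power2_le_imp_le[of "cmod z"]) auto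
      \<comment> \<open>The powers decrease, so \<open>N\<close> copies of the last one are
        dominated by the whole geometric sum.\<close>
      have "real N * cmod z ^ (N - 1) \<le> (\<Sum>k<N. cmod z ^ k)"
      proof -
        have "(\<Sum>k<N. cmod z ^ (N - 1)) \<le> (\<Sum>k<N. cmod z ^ k)"
        proof (rule sum_mono)
          fix k assume "k \<in> {..<N}"
          then show "cmod z ^ (N - 1) \<le> cmod z ^ k"
            using assms(1) by (intro power_decreasing) auto
        qed
        then show ?thesis by simp
      qed
      also have "\<dots> = (1 - cmod z ^ N) / (1 - cmod z)"
        using r \<rho> sum_gp_strict[of "cmod z" N] by simp
      also have "\<dots> \<le> 1 / (\<rho> / 2)" using r \<rho> by (intro frac_le) auto
      finally have "real N * cmod z ^ (N - 1) \<le> 2 / \<rho>" by simp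
      then have "\<bar>Im (z ^ N)\<bar> \<le> 2 / \<rho> * \<bar>Im z\<bar>"
        using abs_Im_power_le[OF assms(1), of N] mult_right_mono[of "real N * cmod z ^ (N - 1)" "2 / \<rho>" "\<bar>Im z\<bar>"]
        by linarith
      then show ?thesis using \<rho> by (simp add: field_simps)
    qed
    have "(\<Sum>n<N. z ^ n) = (1 - z ^ N) * cnj (1 - z) / (cmod (1 - z))\<^sup>2"
      unfolding geometric_sum_complex[OF assms(2)] by (rule complex_div_cnj)
    then have "Im (\<Sum>n<N. z ^ n) = (Re (1 - z ^ N) * Im z - Im (z ^ N) * \<rho>) / (cmod (1 - z))\<^sup>2"
      by (simp add: \<rho>_def Im_divide_of_real del: of_real_power flip: of_real_power)
    moreover have "\<bar>Re (1 - z ^ N) * Im z - Im (z ^ N) * \<rho>\<bar> \<le> 2 * \<bar>Im z\<bar> + 2 * \<bar>Im z\<bar>"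
    proof -
      have "\<bar>Re (1 - z ^ N)\<bar> \<le> 2" using abs_Re_le_cmod[of "z ^ N"] zN by simp
      then have "\<bar>Re (1 - z ^ N) * Im z\<bar> \<le> 2 * \<bar>Im z\<bar>" unfolding abs_mult by (intro mult_right_mono) auto
      moreover have "\<bar>Im (z ^ N) * \<rho>\<bar> \<le> 2 * \<bar>Im z\<bar>" using key \<rho>0 by (simp add: abs_mult)
      ultimately show ?thesis by linarith
    qed
    ultimately have "\<bar>Im (\<Sum>n<N. z ^ n)\<bar> \<le> 4 * \<bar>Im z\<bar> / (cmod (1 - z))\<^sup>2"
      by (simp add: abs_divide divide_right_mono)
    then show ?thesis by simp
  qed
qed

section \<open>Integration over shells\<close>

lemma shell_cover:
  assumes "0 < t" "t \<le> 1" obtains n where "1 \<le> n" "t \<in> shell n"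
proof -
  define n where "n = nat \<lfloor>1 / t\<rfloor>"
  have 1: "1 \<le> 1 / t" using assms by simp
  then have "1 \<le> \<lfloor>1 / t\<rfloor>" by simp
  then have n: "1 \<le> n" "real n \<le> 1 / t" "1 / t < real n + 1" unfolding n_def by linarith+
  then have "t \<in> shell n" using assms unfolding shell_def by (auto simp: field_simps)
  then show ?thesis using that n by blast
qed

text \<open>Turns an integral over frequencies into a series over truncation levels, where
  telescoping and summation by parts are available. The denominators \<open>n * (n + 1)\<close> are
  the lengths of the shells.\<close>

lemma nn_integral_half_circle_le:
  assumes [measurable]: "h \<in> borel_measurable borel"
    and shell: "\<And>n t. 1 \<le> n \<Longrightarrow> t \<in> shell n \<Longrightarrow> h t \<le> c n"
    and c: "\<And>n. 0 \<le> c n" and B: "\<And>N. (\<Sum>n=1..N. c n / (real n * (real n + 1))) \<le> B"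
    and K: "0 \<le> K" "\<And>t. 1 \<le> t \<Longrightarrow> t \<le> pi \<Longrightarrow> h t \<le> K"
  shows "(\<integral>\<^sup>+t. ennreal (h t) \<partial>half_circle) \<le> ennreal (B + K * pi)"
proof -
  have [measurable]: "shell n \<in> sets borel" for n by (simp add: shell_def)
  have "(\<integral>\<^sup>+t. ennreal (h t) \<partial>half_circle) = (\<integral>\<^sup>+t. ennreal (h t) * indicator {0..pi} t \<partial>lborel)"
    by (rule nn_integral_restrict_space) simp
  also have "\<dots> \<le> (\<integral>\<^sup>+t. (\<Sum>n. ennreal (c (Suc n)) * indicator (shell (Suc n)) t) + ennreal K * indicator {1..pi} t \<partial>lborel)"
  proof (rule nn_integral_mono_AE, use AE_lborel_singleton[of 0] in eventually_elim)
    fix t :: real assume t0: "t \<noteq> 0"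
    show "ennreal (h t) * indicator {0..pi} t \<le> (\<Sum>n. ennreal (c (Suc n)) * indicator (shell (Suc n)) t) + ennreal K * indicator {1..pi} t"
    proof -
      consider "t \<notin> {0..pi}" | "0 < t" "t \<le> 1" | "1 \<le> t" "t \<le> pi" using t0 by force
      then show ?thesis
      proof cases
        case 2
        then obtain n where n: "1 \<le> n" "t \<in> shell n" by (rule shell_cover)
        have "ennreal (h t) * indicator {0..pi} t \<le> ennreal (c n)"
          using shell[OF n] by (auto simp: indicator_def intro: ennreal_leI)
        also have "\<dots> = (\<Sum>k\<in>{n-1}. ennreal (c (Suc k)) * indicator (shell (Suc k)) t)" using n by simp
        also have "\<dots> \<le> (\<Sum>n. ennreal (c (Suc n)) * indicator (shell (Suc n)) t)"
          by (intro sum_le_suminf) auto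
        finally show ?thesis by (rule order_trans) simp
      next
        case 3
        then have "ennreal (h t) * indicator {0..pi} t \<le> ennreal K * indicator {1..pi} t"
          using K(2)[of t] by (auto simp: indicator_def intro: ennreal_leI)
        then show ?thesis by (rule order_trans) simp
      qed simp
    qed
  qed
  also have "\<dots> = (\<Sum>n. ennreal (c (Suc n)) * emeasure lborel (shell (Suc n))) + ennreal K * emeasure lborel {1..pi}"
    by (simp add: nn_integral_add nn_integral_suminf nn_integral_cmult_indicator)
  also have "\<dots> \<le> ennreal B + ennreal (K * pi)"
  proof (rule add_mono)
    have "(\<Sum>n. ennreal (c (Suc n)) * emeasure lborel (shell (Suc n))) = (\<Sum>n. ennreal (c (Suc n) / (real (Suc n) * (real (Suc n) + 1))))"
    proof (rule suminf_cong)
      fix n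
      have "emeasure lborel (shell (Suc n)) = ennreal (1 / real (Suc n) - 1 / (real (Suc n) + 1))"
        unfolding shell_def by (rule emeasure_lborel_Ioc) (intro divide_left_mono, auto)
      also have "1 / real (Suc n) - 1 / (real (Suc n) + 1) = 1 / (real (Suc n) * (real (Suc n) + 1))"
        by (simp add: field_simps)
      finally show "ennreal (c (Suc n)) * emeasure lborel (shell (Suc n)) = ennreal (c (Suc n) / (real (Suc n) * (real (Suc n) + 1)))"
        using c[of "Suc n"] by (simp add: ennreal_mult[symmetric])
    qed
    also have "\<dots> \<le> ennreal B"
    proof (rule suminf_le_const)
      fix N
      have "(\<Sum>n<N. ennreal (c (Suc n) / (real (Suc n) * (real (Suc n) + 1)))) = ennreal (\<Sum>n<N. c (Suc n) / (real (Suc n) * (real (Suc n) + 1)))"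
        using c by (intro sum_ennreal) auto
      also have "(\<Sum>n<N. c (Suc n) / (real (Suc n) * (real (Suc n) + 1))) = (\<Sum>n=1..N. c n / (real n * (real n + 1)))"
        by (rule sum.reindex_bij_witness[of _ "\<lambda>n. n - 1" Suc]) auto
      finally show "(\<Sum>n<N. ennreal (c (Suc n) / (real (Suc n) * (real (Suc n) + 1)))) \<le> ennreal B"
        using B by (simp add: ennreal_leI)
    qed simp
    finally show "(\<Sum>n. ennreal (c (Suc n)) * emeasure lborel (shell (Suc n))) \<le> ennreal B" .
    have "emeasure lborel {1..pi} = ennreal (pi - 1)" using pi_gt3 by (intro emeasure_lborel_Icc) simp
    then show "ennreal K * emeasure lborel {1..pi} \<le> ennreal (K * pi)"
      using K pi_gt3 by (auto simp: ennreal_mult[symmetric] intro!: ennreal_leI mult_left_mono)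
  qed
  also have "\<dots> = ennreal (B + K * pi)"
    using B[of 0] K(1) by (simp add: ennreal_plus)
  finally show ?thesis .
qed

context centred_law begin

text \<open>For \<open>i \<ge> 1\<close> the term is at most
  \<open>te i / (M i * M (Suc i)) = 1 / M i - 1 / M (Suc i)\<close>, which telescopes; the term at
  \<open>i = 0\<close> equals \<open>1 / M 1\<close>.\<close>

lemma sum_tail_div_le: "(\<Sum>i\<le>n. te i / (M (Suc i))\<^sup>2) \<le> 2 / M 1 - 1 / M (Suc n)"
proof (induction n)
  case 0
  have "te 0 = M 1" using M_Suc(1)[of 0] by simp
  then show ?case using M_pos[of 1] by (simp add: power2_eq_square)
next
  case (Suc n)
  have p: "0 < M (Suc n)" "0 < M (Suc (Suc n))" by (auto intro: M_pos)
  have "te (Suc n) / (M (Suc (Suc n)))\<^sup>2 \<le> te (Suc n) / (M (Suc n) * M (Suc (Suc n)))"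
    unfolding power2_eq_square using p tail_nonneg M_mono(1)[of "Suc n" "Suc (Suc n)"]
    by (intro divide_left_mono mult_right_mono) auto
  also have "\<dots> = 1 / M (Suc n) - 1 / M (Suc (Suc n))"
    using p M_Suc(1)[of "Suc n"] by (simp add: field_simps)
  finally show ?case using Suc by simp
qed

lemma sum_div2_le:
  fixes h :: "nat \<Rightarrow> real"
  assumes "\<And>i. 0 \<le> h i" shows "(\<Sum>j=1..n. h (j div 2)) \<le> 2 * (\<Sum>i\<le>n. h i)"
proof -
  have "(\<Sum>j\<le>2 * n + 1. h (j div 2)) = 2 * (\<Sum>i\<le>n. h i)" by (induction n) auto
  moreover have "(\<Sum>j=1..n. h (j div 2)) \<le> (\<Sum>j\<le>2 * n + 1. h (j div 2))"
    using assms by (intro sum_mono2) auto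
  ultimately show ?thesis by simp
qed

text \<open>Only \<open>|X| \<ge> n + 1\<close> contributes to the increment, and there
  \<open>|X|\<close> is at most twice its excess over the halved level. This expresses the increment
  through \<open>te\<close>.\<close>

lemma cube_Suc_le: "cube (Suc n) \<le> cube n + 4 * real (Suc n) * te (Suc n div 2)"
proof -
  have "real k * (real (min k (Suc n)))\<^sup>2 \<le> real k * (real (min k n))\<^sup>2 + 4 * real (Suc n) * real (k - Suc n div 2)" for k
  proof (cases "Suc n \<le> k")
    case True
    have k: "real k \<le> 2 * real (k - Suc n div 2)" using True by (simp add: of_nat_diff)
    have "real k * (real (min k (Suc n)))\<^sup>2 = real k * (real (min k n))\<^sup>2 + real k * (2 * real n + 1)"
      using True by (simp add: min_def power2_eq_square algebra_simps)
    also have "real k * (2 * real n + 1) \<le> (2 * real (k - Suc n div 2)) * (2 * real (Suc n))"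
      using k by (intro mult_mono) auto
    finally show ?thesis by (simp add: algebra_simps)
  next
    case False
    then have "min k (Suc n) = min k n" by auto
    then show ?thesis by simp
  qed
  then have "cube (Suc n) \<le> E (\<lambda>k. real (nat \<bar>k\<bar>) * (real (min (nat \<bar>k\<bar>) n))\<^sup>2 + 4 * real (Suc n) * real (nat \<bar>k\<bar> - Suc n div 2))"
    unfolding cube_def
    by (intro integral_mono integrable_cube Bochner_Integration.integrable_add integrable_mult_right integrable_tail) 
  also have "\<dots> = cube n + 4 * real (Suc n) * te (Suc n div 2)"
    unfolding cube_def tail_exp_def
    by (subst Bochner_Integration.integral_add)
       (simp_all only: integrable_cube integrable_mult_right integrable_tail integral_mult_right_zero)
  finally show ?thesis .
qed

lemma cube_nonneg: "0 \<le> cube n" unfolding cube_def by simp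

text \<open>Summation by parts: the increments of \<open>cube\<close> leave a series of the form
  \<open>te / M^2\<close>, which \<open>sum_tail_div_le\<close> bounds. The constant is
  \<open>4 * 2 * 2\<close>, from \<open>cube_Suc_le\<close>, the halved index and the telescoping
  sum.\<close>

lemma sum_cube_le: "(\<Sum>n=1..N. (cube n / (M n)\<^sup>2) / (real n * (real n + 1))) \<le> 16 / M 1"
proof -
  define h where "h i = te i / (M (Suc i))\<^sup>2" for i
  \<comment> \<open>The additional summand is the boundary term. It is carried along by
    \<open>1 / (n * (n + 1)) + 1 / (n + 1) = 1 / n\<close>.\<close>
  have "(\<Sum>n=1..N. (cube n / (M n)\<^sup>2) / (real n * (real n + 1))) + cube N / (M N)\<^sup>2 / (real N + 1)
     \<le> (\<Sum>j=1..N. 4 * h (j div 2))"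
  proof (induction N)
    case 0
    have "cube 0 = 0" by (simp add: cube_def)
    then show ?case by simp
  next
    case (Suc N)
    define a where "a = (M (Suc N))\<^sup>2"
    have a: "0 < a" using M_pos[of "Suc N"] by (simp add: a_def)
    have "cube (Suc N) / a / (real (Suc N) * (real (Suc N) + 1)) + cube (Suc N) / a / (real (Suc N) + 1)
        = cube (Suc N) / a / real (Suc N)"
      using a by (simp add: divide_simps) (simp add: algebra_simps)
    also have "\<dots> \<le> (cube N + 4 * real (Suc N) * te (Suc N div 2)) / a / real (Suc N)"
      using a cube_Suc_le[of N] by (intro divide_right_mono) auto
    also have "\<dots> = cube N / a / real (Suc N) + 4 * (te (Suc N div 2) / a)"
      by (simp add: add_divide_distrib del: of_nat_Suc)
    also have "cube N / a / real (Suc N) \<le> cube N / (M N)\<^sup>2 / (real N + 1)"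
    proof (cases "N = 0")
      case False
      have "cube N / a \<le> cube N / (M N)\<^sup>2"
        using False M_mono(1)[of N "Suc N"] M_pos[of N] a cube_nonneg unfolding a_def
        by (intro divide_left_mono power_mono) auto
      then have "cube N / a / real (Suc N) \<le> cube N / (M N)\<^sup>2 / real (Suc N)" by (rule divide_right_mono) simp
      then show ?thesis by (simp add: add.commute)
    qed (simp add: cube_def)
    also have "te (Suc N div 2) / a \<le> h (Suc N div 2)"
    proof -
      have "M (Suc (Suc N div 2)) \<le> M (Suc N)" by (intro M_mono) auto
      then show ?thesis unfolding h_def a_def using M_pos[of "Suc (Suc N div 2)"] tail_nonneg
        by (intro divide_left_mono power_mono) auto
    qed
    finally have "cube (Suc N) / a / (real (Suc N) * (real (Suc N) + 1)) + cube (Suc N) / a / (real (Suc N) + 1) \<le>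
      cube N / (M N)\<^sup>2 / (real N + 1) + 4 * h (Suc N div 2)" by simp
    then show ?case using Suc by (simp add: a_def)
  qed
  moreover have "0 \<le> cube N / (M N)\<^sup>2 / (real N + 1)" using cube_nonneg by simp
  moreover have "(\<Sum>j=1..N. 4 * h (j div 2)) \<le> 16 / M 1"
  proof -
    have "(\<Sum>j=1..N. 4 * h (j div 2)) = 4 * (\<Sum>j=1..N. h (j div 2))" by (simp add: sum_distrib_left)
    also have "(\<Sum>j=1..N. h (j div 2)) \<le> 2 * (\<Sum>i\<le>N. h i)"
      unfolding h_def using tail_nonneg by (intro sum_div2_le) auto
    also have "(\<Sum>i\<le>N. h i) \<le> 2 / M 1"
    proof -
      have "0 \<le> 1 / M (Suc N)" using M_nonneg by simp
      then show ?thesis unfolding h_def using sum_tail_div_le[of N] by linarith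
    qed
    finally show ?thesis by simp
  qed
  ultimately show ?thesis by linarith
qed

lemma measurable_restrict_half: "h \<in> borel_measurable borel \<Longrightarrow> h \<in> borel_measurable half_circle"
  by (intro measurable_restrict_space1) simp

lemma integrable_Im_char: "integrable half_circle (\<lambda>t. t * \<bar>Im (\<phi> t)\<bar> / (cmod (1 - \<phi> t))\<^sup>2)"
proof -
  obtain c where c: "0 < c" "\<And>n t. 1 \<le> n \<Longrightarrow> t \<in> shell n \<Longrightarrow> c * t\<^sup>2 * M n \<le> norm (1 - \<phi> t)"
    "\<And>t. 1 \<le> t \<Longrightarrow> t \<le> pi \<Longrightarrow> c \<le> norm (1 - \<phi> t)" by (rule char_lower) blast
  have "(\<integral>\<^sup>+t. ennreal (t * \<bar>Im (\<phi> t)\<bar> / (cmod (1 - \<phi> t))\<^sup>2) \<partial>half_circle)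
     \<le> ennreal (8 / c\<^sup>2 * (16 / M 1) + pi / c\<^sup>2 * pi)"
  proof (rule nn_integral_half_circle_le[where c = "\<lambda>n. 8 / c\<^sup>2 * (cube n / (M n)\<^sup>2)"])
    show "(\<lambda>t. t * \<bar>Im (\<phi> t)\<bar> / (cmod (1 - \<phi> t))\<^sup>2) \<in> borel_measurable borel" by measurable
    show "0 \<le> 8 / c\<^sup>2 * (cube n / (M n)\<^sup>2)" for n using cube_nonneg by simp
    have "(\<Sum>n=1..N. 8 / c\<^sup>2 * (cube n / (M n)\<^sup>2) / (real n * (real n + 1)))
        = 8 / c\<^sup>2 * (\<Sum>n=1..N. (cube n / (M n)\<^sup>2) / (real n * (real n + 1)))" for N
      unfolding sum_distrib_left by (intro sum.cong refl) (simp add: mult.assoc)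
    then show "(\<Sum>n=1..N. 8 / c\<^sup>2 * (cube n / (M n)\<^sup>2) / (real n * (real n + 1))) \<le> 8 / c\<^sup>2 * (16 / M 1)" for N
      using sum_cube_le[of N] c(1) by (simp only:) (intro mult_left_mono, auto)
    show "0 \<le> pi / c\<^sup>2" by simp
    fix t
    show "t * \<bar>Im (\<phi> t)\<bar> / (cmod (1 - \<phi> t))\<^sup>2 \<le> pi / c\<^sup>2" if "1 \<le> t" "t \<le> pi"
    proof -
      have "\<bar>Im (\<phi> t)\<bar> \<le> 1" using abs_Im_le_cmod[of "\<phi> t"] norm_char_le[of t] by linarith
      then have "t * \<bar>Im (\<phi> t)\<bar> \<le> pi * 1" using that by (intro mult_mono) auto
      then show ?thesis using that c by (intro frac_le power_mono) auto
    qed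
    fix n :: nat assume n: "1 \<le> n" and t: "t \<in> shell n"
    note s = shellD[OF t n]
    have Mn: "0 < M n" using n by (intro M_pos) auto
    have "t * \<bar>Im (\<phi> t)\<bar> / (cmod (1 - \<phi> t))\<^sup>2 \<le> t * (8 * t ^ 3 * cube n) / (c * t\<^sup>2 * M n)\<^sup>2"
      using s Mn c(1) c(2)[OF n t] Im_char_shell[OF t n] cube_nonneg[of n]
      by (intro frac_le power_mono mult_left_mono) auto
    also have "\<dots> = 8 / c\<^sup>2 * (cube n / (M n)\<^sup>2)"
      using s Mn c(1) by (simp add: power_mult_distrib power2_eq_square power3_eq_cube)
    finally show "t * \<bar>Im (\<phi> t)\<bar> / (cmod (1 - \<phi> t))\<^sup>2 \<le> 8 / c\<^sup>2 * (cube n / (M n)\<^sup>2)" .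
  qed
  then have "(\<integral>\<^sup>+t. ennreal (t * \<bar>Im (\<phi> t)\<bar> / (cmod (1 - \<phi> t))\<^sup>2) \<partial>half_circle) < \<infinity>"
    by (rule order_le_less_trans) simp
  then show ?thesis
  proof (intro integrableI_nonneg)
    show "AE t in half_circle. 0 \<le> t * \<bar>Im (\<phi> t)\<bar> / (cmod (1 - \<phi> t))\<^sup>2"
      by (rule AE_I2) (auto simp: space_restrict_space)
    show "(\<lambda>t. t * \<bar>Im (\<phi> t)\<bar> / (cmod (1 - \<phi> t))\<^sup>2) \<in> borel_measurable half_circle"
      by (rule measurable_restrict_half) measurable
  qed
qed

lemma two_support_points: obtains k1 k2 where "k1 \<in> set_pmf P" "k2 \<in> set_pmf P" "k1 \<noteq> k2"
proof -
  obtain k where k: "k \<in> set_pmf P" using set_pmf_not_empty[of P] by auto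
  have "\<exists>k2\<in>set_pmf P. k2 \<noteq> k"
  proof (rule ccontr)
    assume "\<not> ?thesis"
    then have S: "j = k" if "j \<in> set_pmf P" for j using that by blast
    have "E real_of_int = E (\<lambda>_. real_of_int k)"
      by (rule integral_cong_AE) (auto simp: AE_measure_pmf_iff dest: S)
    then have "k = 0" using mean_zero by simp
    have "\<phi> 1 = measure_pmf.expectation P (\<lambda>_. iexp (1 * real_of_int k))" unfolding char_int_def
      by (rule integral_cong_AE) (auto simp: AE_measure_pmf_iff dest: S)
    then have "\<phi> 1 = 1" using \<open>k = 0\<close> by simp
    then show False using char_neq_1[of 1] pi_gt3 by simp
  qed
  then show ?thesis using k that by blast
qed

lemma norm_char_eq_1:
  assumes "norm (\<phi> t) = 1" "k \<in> set_pmf P"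
  shows "cos (t * real_of_int k - Arg (\<phi> t)) = 1"
proof -
  define \<theta> where "\<theta> = Arg (\<phi> t)"
  have "\<phi> t = cis \<theta>" using assms rcis_cmod_Arg[of "\<phi> t"] by (simp add: \<theta>_def rcis_def)
  then have "E (\<lambda>k. cos (t * real_of_int k)) = cos \<theta>" "E (\<lambda>k. sin (t * real_of_int k)) = sin \<theta>"
    by (simp_all add: Re_char[symmetric] Im_char[symmetric])
  then have "E (\<lambda>k. 1 - cos (t * real_of_int k - \<theta>)) = 0"
    by (simp add: cos_diff integrable_cos_sin)
  then have "AE k in measure_pmf P. 1 - cos (t * real_of_int k - \<theta>) = 0"
    by (subst (asm) integral_nonneg_eq_0_iff_AE) (auto simp: integrable_cos_sin)
  then show ?thesis using assms(2) by (auto simp: AE_measure_pmf_iff \<theta>_def)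
qed

text \<open>The walk may be periodic, so \<open>|\<phi>| = 1\<close> can occur away from 0. In that
  case the phases at two points of the support differ by a multiple of \<open>2 * pi\<close>, which
  leaves countably many \<open>t\<close>.\<close>

lemma AE_norm_char_less: "AE t in half_circle. norm (\<phi> t) < 1"
proof -
  obtain k1 k2 where k: "k1 \<in> set_pmf P" "k2 \<in> set_pmf P" "k1 \<noteq> k2" by (rule two_support_points)
  have "{t. norm (\<phi> t) = 1} \<subseteq> range (\<lambda>m::int. real_of_int m * 2 * pi / real_of_int (k1 - k2))"
  proof
    fix t assume "t \<in> {t. norm (\<phi> t) = 1}"
    then have "cos (t * real_of_int k1 - Arg (\<phi> t)) = 1" "cos (t * real_of_int k2 - Arg (\<phi> t)) = 1"
      using norm_char_eq_1 k by auto
    then obtain m1 m2 :: int where "t * real_of_int k1 - Arg (\<phi> t) = real_of_int m1 * 2 * pi" 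
       "t * real_of_int k2 - Arg (\<phi> t) = real_of_int m2 * 2 * pi" unfolding cos_one_2pi_int by blast
    then have "t * real_of_int (k1 - k2) = real_of_int (m1 - m2) * 2 * pi" by (simp add: algebra_simps)
    then have "t = real_of_int (m1 - m2) * 2 * pi / real_of_int (k1 - k2)" using k(3) by (simp add: field_simps)
    then show "t \<in> range (\<lambda>m::int. real_of_int m * 2 * pi / real_of_int (k1 - k2))" by blast
  qed
  then have "countable {t. norm (\<phi> t) = 1}" by (rule countable_subset) simp
  then have "AE t in lborel. t \<notin> {t. norm (\<phi> t) = 1}"
    by (intro AE_not_in countable_imp_null_set_lborel)
  then have "AE t in lborel. t \<in> {0..pi} \<longrightarrow> norm (\<phi> t) < 1"
    by eventually_elim (use norm_char_le in \<open>auto simp: less_le\<close>)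
  then show ?thesis by (subst AE_restrict_space_iff) auto
qed

lemma char_quadratic: obtains C where "\<And>t. 0 < t \<Longrightarrow> t \<le> pi \<Longrightarrow> t\<^sup>2 / norm (1 - \<phi> t) \<le> C"
proof -
  obtain c where c: "0 < c" "\<And>n t. 1 \<le> n \<Longrightarrow> t \<in> shell n \<Longrightarrow> c * t\<^sup>2 * M n \<le> norm (1 - \<phi> t)"
    "\<And>t. 1 \<le> t \<Longrightarrow> t \<le> pi \<Longrightarrow> c \<le> norm (1 - \<phi> t)" by (rule char_lower) blast
  show ?thesis
  proof (rule that[of "max (1 / (c * M 1)) (pi\<^sup>2 / c)"])
    fix t assume t: "0 < t" "t \<le> pi"
    show "t\<^sup>2 / norm (1 - \<phi> t) \<le> max (1 / (c * M 1)) (pi\<^sup>2 / c)"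
    proof (cases "t \<le> 1")
      case True
      then obtain n where n: "1 \<le> n" "t \<in> shell n" using t shell_cover by blast
      have p: "0 < M 1" "M 1 \<le> M n" using M_pos[of 1] M_mono(1)[OF n(1)] by auto
      have "c * t\<^sup>2 * M 1 \<le> c * t\<^sup>2 * M n" using c(1) p by (intro mult_left_mono) auto
      then have "c * t\<^sup>2 * M 1 \<le> norm (1 - \<phi> t)" using c(2)[OF n] by linarith
      then have "t\<^sup>2 / norm (1 - \<phi> t) \<le> t\<^sup>2 / (c * t\<^sup>2 * M 1)"
        using t c(1) p char_neq_1[OF t] by (intro divide_left_mono mult_pos_pos) auto
      also have "\<dots> = 1 / (c * M 1)" using t by simp
      finally show ?thesis by simp
    next
      case False
      then have "t\<^sup>2 / norm (1 - \<phi> t) \<le> pi\<^sup>2 / c" using c t by (intro frac_le power_mono) auto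
      then show ?thesis by simp
    qed
  qed
qed

definition "pot x = (\<Sum>n. pmf (walk_pmf P n) 0 - pmf (walk_pmf P n) (- x))"

definition "kern x t = Re ((1 - iexp (t * real_of_int x)) / (1 - \<phi> t))"

lemma measurable_kern [measurable]: "kern x \<in> borel_measurable borel"
  unfolding kern_def[abs_def] by measurable

text \<open>Dominated convergence for the partial sums under the Fourier integral; it also proves
  that the series defining the potential converges.\<close>

lemma potential_fourier:
  "integrable half_circle (kern x)"
  "(\<lambda>n. pmf (walk_pmf P n) 0 - pmf (walk_pmf P n) (- x)) sums ((\<integral>t. kern x t \<partial>half_circle) / pi)"
proof -
  interpret L: finite_measure half_circle by (rule finite_half_circle)
  obtain C where C: "\<And>t. 0 < t \<Longrightarrow> t \<le> pi \<Longrightarrow> t\<^sup>2 / norm (1 - \<phi> t) \<le> C" by (rule char_quadratic) blast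
  let ?e = "\<lambda>t. iexp (t * real_of_int x)"
  define s where "s N t = Re ((1 - ?e t) * (\<Sum>n<N. \<phi> t ^ n))" for N t
  \<comment> \<open>The first summand serves the factor \<open>1 - cos (t * x)\<close>, which is
    quadratic in \<open>t\<close> and so only needs \<open>char_quadratic\<close>; the second one
    serves \<open>sin (t * x)\<close> through \<open>Im_geometric_sum_le\<close>.\<close>
  define w where "w t = 4 * (real_of_int x)\<^sup>2 * C +
    \<bar>real_of_int x\<bar> * (4 * (t * \<bar>Im (\<phi> t)\<bar> / (cmod (1 - \<phi> t))\<^sup>2) + 4 * pi)" for t
  have w_int: "integrable half_circle w"
    unfolding w_def by (intro Bochner_Integration.integrable_add integrable_mult_right integrable_Im_char L.integrable_const)
  have [measurable]: "s N \<in> borel_measurable borel" for N unfolding s_def by measurable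
  have bound: "AE t in half_circle. norm (s N t) \<le> w t" for N
  proof -
    have "AE t in lborel. t \<in> {0..pi} \<longrightarrow> norm (s N t) \<le> w t"
    proof (use AE_lborel_singleton[of 0] in eventually_elim, intro impI)
      fix t :: real assume "t \<noteq> 0" "t \<in> {0..pi}"
      then have t: "0 < t" "t \<le> pi" by auto
      define z where "z = \<phi> t"
      have z: "cmod z \<le> 1" "z \<noteq> 1" unfolding z_def using norm_char_le char_neq_1 t by auto
      define S where "S = (\<Sum>n<N. z ^ n)"
      have "s N t = (1 - cos (t * real_of_int x)) * Re S + sin (t * real_of_int x) * Im S"
        unfolding s_def z_def[symmetric] S_def[symmetric] by (simp add: Re_exp Im_exp)
      then have "norm (s N t) \<le> \<bar>(1 - cos (t * real_of_int x)) * Re S\<bar> + \<bar>sin (t * real_of_int x) * Im S\<bar>" by simp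
      moreover have "\<bar>(1 - cos (t * real_of_int x)) * Re S\<bar> \<le> 4 * (real_of_int x)\<^sup>2 * C"
      proof -
        have "(min 1 \<bar>t * real_of_int x\<bar>)\<^sup>2 \<le> \<bar>t * real_of_int x\<bar>\<^sup>2" by (intro power_mono) auto
        then have "1 - cos (t * real_of_int x) \<le> 2 * (t * real_of_int x)\<^sup>2"
          using one_minus_cos_le[of "t * real_of_int x"] by simp
        moreover have "\<bar>Re S\<bar> \<le> 2 / cmod (1 - z)"
          using abs_Re_le_cmod[of S] norm_geometric_sum_le[OF z, of N] unfolding S_def by linarith
        ultimately have "\<bar>(1 - cos (t * real_of_int x)) * Re S\<bar> \<le> 2 * (t * real_of_int x)\<^sup>2 * (2 / cmod (1 - z))"
          unfolding abs_mult by (intro mult_mono) auto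
        also have "\<dots> = 4 * (real_of_int x)\<^sup>2 * (t\<^sup>2 / cmod (1 - z))" by (simp add: power_mult_distrib)
        also have "\<dots> \<le> 4 * (real_of_int x)\<^sup>2 * C" unfolding z_def using C[OF t] by (intro mult_left_mono) auto
        finally show ?thesis .
      qed
      moreover have "\<bar>sin (t * real_of_int x) * Im S\<bar> \<le> \<bar>real_of_int x\<bar> * (4 * (t * \<bar>Im z\<bar> / (cmod (1 - z))\<^sup>2) + 4 * pi)"
      proof -
        have "\<bar>sin (t * real_of_int x)\<bar> \<le> t * \<bar>real_of_int x\<bar>"
          using abs_sin_x_le_abs_x[of "t * real_of_int x"] t by (simp add: abs_mult)
        then have "\<bar>sin (t * real_of_int x) * Im S\<bar> \<le> (t * \<bar>real_of_int x\<bar>) * (4 * \<bar>Im z\<bar> / (cmod (1 - z))\<^sup>2 + 4)"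
          unfolding abs_mult S_def using Im_geometric_sum_le[OF z, of N] by (intro mult_mono) auto
        also have "\<dots> = \<bar>real_of_int x\<bar> * (4 * (t * \<bar>Im z\<bar> / (cmod (1 - z))\<^sup>2) + 4 * t)"
          by (simp add: algebra_simps)
        also have "\<dots> \<le> \<bar>real_of_int x\<bar> * (4 * (t * \<bar>Im z\<bar> / (cmod (1 - z))\<^sup>2) + 4 * pi)"
          using t by (intro mult_left_mono) auto
        finally show ?thesis .
      qed
      ultimately show "norm (s N t) \<le> w t" unfolding w_def z_def by linarith
    qed
    then show ?thesis by (subst AE_restrict_space_iff) auto
  qed
  have meas: "kern x \<in> borel_measurable half_circle" "s N \<in> borel_measurable half_circle" for N
    by (rule measurable_restrict_half, simp)+
  have lim: "AE t in half_circle. (\<lambda>N. s N t) \<longlonglongrightarrow> kern x t"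
    using AE_norm_char_less
  proof eventually_elim
    fix t assume "norm (\<phi> t) < 1"
    then have "(\<lambda>n. \<phi> t ^ n) sums (1 / (1 - \<phi> t))" by (rule geometric_sums)
    then have "(\<lambda>N. Re ((1 - ?e t) * (\<Sum>n<N. \<phi> t ^ n))) \<longlonglongrightarrow> Re ((1 - ?e t) * (1 / (1 - \<phi> t)))"
      unfolding sums_def by (intro tendsto_intros)
    then show "(\<lambda>N. s N t) \<longlonglongrightarrow> kern x t" by (simp add: s_def kern_def)
  qed
  show "integrable half_circle (kern x)"
    by (rule integrable_dominated_convergence[OF meas w_int lim bound])
  have DCT: "(\<lambda>N. \<integral>t. s N t \<partial>half_circle) \<longlonglongrightarrow> (\<integral>t. kern x t \<partial>half_circle)"
    by (rule integral_dominated_convergence[OF meas w_int lim bound])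
  have "(\<Sum>n<N. pmf (walk_pmf P n) 0 - pmf (walk_pmf P n) (- x)) = (\<integral>t. s N t \<partial>half_circle) / pi" for N
  proof -
    have int: "integrable half_circle (\<lambda>t. Re (\<phi> t ^ n * iexp (t * real_of_int y)))" for n y
    proof (rule L.integrable_const_bound[of _ 1])
      show "AE t in half_circle. norm (Re (\<phi> t ^ n * iexp (t * real_of_int y))) \<le> 1"
      proof (rule AE_I2)
        fix t
        have "cmod (\<phi> t ^ n * iexp (t * real_of_int y)) \<le> 1"
          using norm_char_le[of t] by (simp add: norm_mult norm_power power_le_one)
        then show "norm (Re (\<phi> t ^ n * iexp (t * real_of_int y))) \<le> 1"
          using abs_Re_le_cmod[of "\<phi> t ^ n * iexp (t * real_of_int y)"] by simp
      qed
      have "(\<lambda>t. Re (\<phi> t ^ n * iexp (t * real_of_int y))) \<in> borel_measurable borel" by measurable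
      then show "(\<lambda>t. Re (\<phi> t ^ n * iexp (t * real_of_int y))) \<in> borel_measurable half_circle" by (rule measurable_restrict_half)
    qed
    have "s N t = (\<Sum>n<N. Re (\<phi> t ^ n * iexp (t * real_of_int 0)) - Re (\<phi> t ^ n * iexp (t * real_of_int x)))" for t
      unfolding s_def sum_distrib_left Re_sum by (intro sum.cong refl) (simp add: algebra_simps)
    then have "(\<integral>t. s N t \<partial>half_circle) = (\<integral>t. (\<Sum>n<N. Re (\<phi> t ^ n * iexp (t * real_of_int 0)) - Re (\<phi> t ^ n * iexp (t * real_of_int x))) \<partial>half_circle)"
      by presburger
    also have "\<dots> = (\<Sum>n<N. (\<integral>t. Re (\<phi> t ^ n * iexp (t * real_of_int 0)) \<partial>half_circle) - (\<integral>t. Re (\<phi> t ^ n * iexp (t * real_of_int x)) \<partial>half_circle))"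
      by (simp only: Bochner_Integration.integral_sum Bochner_Integration.integral_diff Bochner_Integration.integrable_diff int)
    finally show ?thesis
      using pmf_inversion[of "walk_pmf P _" 0] pmf_inversion[of "walk_pmf P _" x]
      by (simp add: char_walk_pmf sum_divide_distrib diff_divide_distrib)
  qed
  then show "(\<lambda>n. pmf (walk_pmf P n) 0 - pmf (walk_pmf P n) (- x)) sums ((\<integral>t. kern x t \<partial>half_circle) / pi)"
    using DCT unfolding sums_def by (auto intro: tendsto_divide)
qed

lemma pot_sums: "(\<lambda>n. pmf (walk_pmf P n) 0 - pmf (walk_pmf P n) (- x)) sums pot x"
  using summable_sums[OF sums_summable[OF potential_fourier(2)[of x]]] by (simp add: pot_def)

end

section \<open>Abel's theorem and a test function\<close>

lemma abel_limit:
  fixes u :: "nat \<Rightarrow> real"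
  assumes "u sums U"
  shows "((\<lambda>r. \<Sum>n. r ^ n * u n) \<longlongrightarrow> U) (at_left 1)"
proof -
  define s where "s n = (\<Sum>k\<le>n. u k)" for n
  have s: "s \<longlonglongrightarrow> U" using assms unfolding sums_def_le s_def .
  obtain K where K: "\<And>n. \<bar>s n - U\<bar> \<le> K" "0 \<le> K"
  proof -
    have "Bseq (\<lambda>n. s n - U)" by (rule convergent_imp_Bseq[OF convergentI[OF LIM_zero[OF s]]])
    then obtain K where "\<forall>n. norm (s n - U) \<le> K" by (auto elim: BseqE)
    then have "\<bar>s n - U\<bar> \<le> \<bar>K\<bar>" for n by (metis abs_ge_self order_trans real_norm_def)
    then show ?thesis using that[of "\<bar>K\<bar>"] by simp
  qed
  \<comment> \<open>Summation by parts: the error becomes a mean of \<open>s n - U\<close> with the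
    weights \<open>(1 - r) * r ^ n\<close>, which escape to infinity as \<open>r\<close> tends to
    1.\<close>
  have eq: "(\<Sum>n. r ^ n * u n) - U = (1 - r) * (\<Sum>n. r ^ n * (s n - U))"
    and summ: "summable (\<lambda>n. r ^ n * \<bar>s n - U\<bar>)" if r: "0 < r" "r < 1" for r :: real
  proof -
    have geo: "summable (\<lambda>n. r ^ n)" using r by (intro summable_geometric) simp
    show 1: "summable (\<lambda>n. r ^ n * \<bar>s n - U\<bar>)"
    proof (rule summable_comparison_test'[OF summable_mult2[OF geo, of K]])
      fix n :: nat
      have "r ^ n * \<bar>s n - U\<bar> \<le> r ^ n * K" using r by (intro mult_left_mono K) simp
      then show "norm (r ^ n * \<bar>s n - U\<bar>) \<le> r ^ n * K" using r by (simp add: abs_mult)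
    qed
    have 2: "summable (\<lambda>n. r ^ n * (s n - U))"
    proof (rule summable_norm_cancel)
      show "summable (\<lambda>n. norm (r ^ n * (s n - U)))" using 1 r by (simp add: abs_mult)
    qed
    have 3: "summable (\<lambda>n. r ^ n * s n)"
      using summable_add[OF 2 summable_mult2[OF geo, of U]] by (simp add: algebra_simps)
    define S where "S = (\<Sum>n. r ^ n * s n)"
    have "(\<lambda>n. r ^ Suc n * s (Suc n)) sums (S - s 0)"
      using summable_sums[OF 3] unfolding S_def by (subst sums_Suc_iff) simp
    moreover have "(\<lambda>n. r * (r ^ n * s n)) sums (r * S)"
      unfolding S_def by (rule sums_mult[OF summable_sums[OF 3]])
    ultimately have "(\<lambda>n. r ^ Suc n * s (Suc n) - r * (r ^ n * s n)) sums (S - s 0 - r * S)"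
      by (rule sums_diff)
    also have "(\<lambda>n. r ^ Suc n * s (Suc n) - r * (r ^ n * s n)) = (\<lambda>n. r ^ Suc n * u (Suc n))"
      by (simp add: s_def fun_eq_iff algebra_simps)
    finally have "(\<lambda>n. r ^ n * u n) sums ((S - s 0 - r * S) + u 0)"
      by (subst (asm) sums_Suc_iff) (simp add: add.commute)
    then have "(\<Sum>n. r ^ n * u n) = (1 - r) * S" by (simp add: sums_iff s_def algebra_simps)
    moreover have "(\<Sum>n. r ^ n * (s n - U)) = S - U * (1 / (1 - r))"
    proof -
      have "(\<lambda>n. r ^ n * s n - U * r ^ n) sums (S - U * (1 / (1 - r)))"
        unfolding S_def using r by (intro sums_diff summable_sums[OF 3] sums_mult geometric_sums) simp
      then show ?thesis by (simp add: sums_iff algebra_simps)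
    qed
    ultimately show "(\<Sum>n. r ^ n * u n) - U = (1 - r) * (\<Sum>n. r ^ n * (s n - U))"
      using r by (simp add: field_simps)
  qed
  show ?thesis
  proof (rule tendstoI)
    fix e :: real assume e: "0 < e"
    obtain N where N: "\<And>n. n \<ge> N \<Longrightarrow> \<bar>s n - U\<bar> < e / 2"
      using LIMSEQ_D[OF s, of "e / 2"] e by auto
    \<comment> \<open>Makes the contribution of the first \<open>N\<close> terms less than
      \<open>e / 2\<close> when \<open>1 - r < d\<close>; the \<open>+ 1\<close> keeps the
      denominator positive.\<close>
    define d where "d = e / (2 * (real N * K + 1))"
    have d: "0 < d" unfolding d_def using e K by (intro divide_pos_pos) (auto intro: add_nonneg_pos)
    have "eventually (\<lambda>r. max 0 (1 - d) < r) (at_left (1::real))"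
    proof -
      have "max 0 (1 - d) < 1" using d by simp
      from eventually_at_left_real[OF this] show ?thesis by eventually_elim simp
    qed
    then show "eventually (\<lambda>r. dist (\<Sum>n. r ^ n * u n) U < e) (at_left 1)"
      using eventually_at_left_real[OF zero_less_one]
    proof (eventually_elim)
      fix r :: real assume r: "max 0 (1 - d) < r" and r1: "r \<in> {0<..<1}"
      have geo: "summable (\<lambda>n. r ^ n)" using r1 by (intro summable_geometric) simp
      have "\<bar>\<Sum>n. r ^ n * (s n - U)\<bar> \<le> (\<Sum>n. r ^ n * \<bar>s n - U\<bar>)"
        using summable_rabs[of "\<lambda>n. r ^ n * (s n - U)"] summ[of r] r1 by (simp add: abs_mult)
      also have "\<dots> \<le> (\<Sum>n. (if n < N then K else 0) + e / 2 * r ^ n)"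
      proof (rule suminf_le)
        show "r ^ n * \<bar>s n - U\<bar> \<le> (if n < N then K else 0) + e / 2 * r ^ n" for n
        proof (cases "n < N")
          case True
          have "r ^ n * \<bar>s n - U\<bar> \<le> 1 * K" using r1 K by (intro mult_mono power_le_one) auto
          moreover have "0 \<le> e / 2 * r ^ n" using e r1 by simp
          ultimately show ?thesis using True by simp
        next
          case False
          then have "r ^ n * \<bar>s n - U\<bar> \<le> r ^ n * (e / 2)"
            using N[of n] r1 by (intro mult_left_mono) auto
          then show ?thesis using False by (simp add: mult.commute)
        qed
        show "summable (\<lambda>n. (if n < N then K else 0) + e / 2 * r ^ n)"
          by (intro summable_add summable_mult geo summable_finite[of "{..<N}"]) auto
      qed (use summ r1 in auto)
      also have "\<dots> = real N * K + e / 2 * (1 / (1 - r))"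
      proof -
        have "(\<lambda>n. if n < N then K else 0) sums (\<Sum>n<N. K)"
          using sums_If_finite_set[of "{..<N}" "\<lambda>_. K"] by simp
        moreover have "(\<lambda>n. e / 2 * r ^ n) sums (e / 2 * (1 / (1 - r)))"
          using r1 by (intro sums_mult geometric_sums) simp
        ultimately show ?thesis by (intro sums_unique[symmetric]) (use sums_add in fastforce)
      qed
      finally have "(1 - r) * \<bar>\<Sum>n. r ^ n * (s n - U)\<bar> \<le> (1 - r) * (real N * K + e / 2 * (1 / (1 - r)))"
        using r1 by (intro mult_left_mono) auto
      also have "\<dots> = (1 - r) * (real N * K) + e / 2" using r1 by (simp add: field_simps)
      also have "(1 - r) * (real N * K) \<le> d * (real N * K)" using r K by (intro mult_right_mono) auto
      also have "d * (real N * K) < e / 2"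
      proof -
        have "d * (real N * K) < d * (real N * K + 1)" using d by simp
        also have "\<dots> = e / 2" unfolding d_def using K by (simp add: field_simps add_nonneg_eq_0_iff)
        finally show ?thesis .
      qed
      finally show "dist (\<Sum>n. r ^ n * u n) U < e"
        unfolding dist_real_def eq[OF r1[unfolded greaterThanLessThan_iff, THEN conjunct1] r1[unfolded greaterThanLessThan_iff, THEN conjunct2]]
        using r1 by (simp add: abs_mult)
    qed
  qed
qed

text \<open>Piecewise linear, 0 at 0 and at \<open>2 * x\<close>, of height \<open>x\<close> at
  \<open>x\<close>. Paired with a point source at 0 against one at \<open>x\<close> it gives exactly
  \<open>x\<close>, up to sign.\<close>

definition tent :: "nat \<Rightarrow> int \<Rightarrow> real" where
  "tent x z = real_of_int (max 0 (int x - \<bar>z - int x\<bar>))"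

definition tent_slope :: "nat \<Rightarrow> int \<Rightarrow> real" where
  "tent_slope x z = indicator {0..<int x} z - indicator {int x..<2 * int x} z"

lemma tent_diff: "tent x (z + 1) - tent x z = tent_slope x z"
proof -
  have "max 0 (int x - \<bar>z + 1 - int x\<bar>) - max 0 (int x - \<bar>z - int x\<bar>) =
      (if 0 \<le> z \<and> z < int x then 1 else 0) - (if int x \<le> z \<and> z < 2 * int x then 1 else 0)"
    by (auto simp: max_def abs_if)
  then have "tent x (z + 1) - tent x z =
      real_of_int ((if 0 \<le> z \<and> z < int x then 1 else 0) - (if int x \<le> z \<and> z < 2 * int x then 1 else 0))"
    unfolding tent_def of_int_diff[symmetric] by simp
  then show ?thesis by (simp add: tent_slope_def indicator_def)
qed

lemma sum_abs_indicator_shift: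
  fixes a :: int
  assumes "finite S"
  shows "(\<Sum>z\<in>S. \<bar>indicator {a..<a + int x} (z + int i) - indicator {a..<a + int x} z :: real\<bar>) \<le> 2 * real (min i x)"
proof -
  let ?A = "{a - int i..<a - int i + int (min i x)}" and ?B = "{a + int x - int (min i x)..<a + int x}"
  have "(\<Sum>z\<in>S. \<bar>indicator {a..<a + int x} (z + int i) - indicator {a..<a + int x} z :: real\<bar>)
    \<le> (\<Sum>z\<in>S. indicator ?A z + indicator ?B z)"
    by (intro sum_mono) (auto simp: indicator_def)
  also have "\<dots> = real (card (S \<inter> ?A)) + real (card (S \<inter> ?B))"
    using assms by (simp add: sum.distrib indicator_def[abs_def] of_bool_def sum.If_cases Int_def)
  also have "\<dots> \<le> real (card ?A) + real (card ?B)"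
    by (intro add_mono of_nat_mono card_mono) auto
  also have "\<dots> = 2 * real (min i x)" by simp
  finally show ?thesis .
qed

lemma sum_abs_tent_slope:
  assumes "finite S"
  shows "(\<Sum>z\<in>S. \<bar>tent_slope x (z + int i) - tent_slope x z\<bar>) \<le> 4 * real (min i x)"
proof -
  have "(\<Sum>z\<in>S. \<bar>tent_slope x (z + int i) - tent_slope x z\<bar>) \<le>
    (\<Sum>z\<in>S. \<bar>indicator {0..<0 + int x} (z + int i) - indicator {0..<0 + int x} z :: real\<bar> + 
       \<bar>indicator {int x..<int x + int x} (z + int i) - indicator {int x..<int x + int x} z :: real\<bar>)"
  proof (rule sum_mono)
    have "int x + int x = 2 * int x" by simp
    then show "\<bar>tent_slope x (z + int i) - tent_slope x z\<bar> \<le>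
       \<bar>indicator {0..<0 + int x} (z + int i) - indicator {0..<0 + int x} z :: real\<bar> + 
       \<bar>indicator {int x..<int x + int x} (z + int i) - indicator {int x..<int x + int x} z :: real\<bar>" for z
      unfolding tent_slope_def add_0 by (smt (verit))
  qed
  then show ?thesis
    using sum_abs_indicator_shift[OF assms, of 0 x i] sum_abs_indicator_shift[OF assms, of "int x" x i]
    unfolding sum.distrib by linarith
qed

lemma tent_shift: "tent x (z + int m) - tent x z = (\<Sum>i<m. tent_slope x (z + int i))"
proof (induction m)
  case (Suc m)
  have "tent x (z + int (Suc m)) - tent x (z + int m) = tent_slope x (z + int m)"
    using tent_diff[of x "z + int m"] by (simp add: add.commute add.left_commute)
  then show ?case using Suc by simp
qed simp

text \<open>An l1 bound for the Taylor remainder: it is a sum of \<open>|k|\<close> differences of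
  translated slopes, each of norm at most \<open>4 * min |k| x\<close>. Its mean under the law is
  therefore of order \<open>M x\<close>.\<close>

lemma sum_abs_tent:
  assumes "finite S"
  shows "(\<Sum>z\<in>S. \<bar>tent x (z + k) - tent x z - real_of_int k * tent_slope x z\<bar>) \<le> 8 * trunc x (nat \<bar>k\<bar>)"
proof -
  have "(\<Sum>z\<in>S. \<bar>tent x (z + k) - tent x z - real_of_int k * tent_slope x z\<bar>) \<le>
      real (nat \<bar>k\<bar>) * (4 * real (min (nat \<bar>k\<bar>) x))"
  proof (cases "0 \<le> k")
    case True
    define m where "m = nat k"
    have k: "k = int m" using True by (simp add: m_def)
    have "tent x (z + k) - tent x z - real_of_int k * tent_slope x z = (\<Sum>i<m. tent_slope x (z + int i) - tent_slope x z)" for z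
      unfolding k tent_shift by (simp add: sum_subtractf)
    then have "(\<Sum>z\<in>S. \<bar>tent x (z + k) - tent x z - real_of_int k * tent_slope x z\<bar>)
       \<le> (\<Sum>z\<in>S. \<Sum>i<m. \<bar>tent_slope x (z + int i) - tent_slope x z\<bar>)"
      by (auto intro!: sum_mono sum_abs)
    also have "\<dots> = (\<Sum>i<m. \<Sum>z\<in>S. \<bar>tent_slope x (z + int i) - tent_slope x z\<bar>)" by (rule sum.swap)
    also have "\<dots> \<le> (\<Sum>i<m. 4 * real (min m x))"
      by (intro sum_mono order_trans[OF sum_abs_tent_slope[OF assms]]) auto
    finally show ?thesis by (simp add: k)
  next
    case False
    define m where "m = nat (- k)"
    have k: "k = - int m" using False by (simp add: m_def)
    have "tent x (z + k) - tent x z - real_of_int k * tent_slope x z = - (\<Sum>i<m. tent_slope x (z + k + int i) - tent_slope x z)" for z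
      using tent_shift[of x "z + k" m] by (simp add: k sum_subtractf)
    then have "(\<Sum>z\<in>S. \<bar>tent x (z + k) - tent x z - real_of_int k * tent_slope x z\<bar>)
       \<le> (\<Sum>z\<in>S. \<Sum>i<m. \<bar>tent_slope x (z + k + int i) - tent_slope x z\<bar>)"
      by (auto intro!: sum_mono sum_abs)
    also have "\<dots> = (\<Sum>i<m. \<Sum>z\<in>S. \<bar>tent_slope x (z + k + int i) - tent_slope x z\<bar>)" by (rule sum.swap)
    also have "\<dots> \<le> (\<Sum>i<m. 4 * real (min m x))"
    proof (rule sum_mono)
      fix i assume i: "i \<in> {..<m}"
      define T where "T = (\<lambda>z. z + k + int i) ` S"
      have "(\<Sum>z\<in>S. \<bar>tent_slope x (z + k + int i) - tent_slope x z\<bar>) = (\<Sum>z\<in>T. \<bar>tent_slope x z - tent_slope x (z + int (m - i))\<bar>)"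
        unfolding T_def using i by (subst sum.reindex) (auto simp: inj_on_def k of_nat_diff)
      also have "\<dots> = (\<Sum>z\<in>T. \<bar>tent_slope x (z + int (m - i)) - tent_slope x z\<bar>)" by (simp add: abs_minus_commute)
      also have "\<dots> \<le> 4 * real (min (m - i) x)"
        using assms by (intro sum_abs_tent_slope) (simp add: T_def)
      also have "\<dots> \<le> 4 * real (min m x)" by auto
      finally show "(\<Sum>z\<in>S. \<bar>tent_slope x (z + k + int i) - tent_slope x z\<bar>) \<le> 4 * real (min m x)" .
    qed
    finally show ?thesis by (simp add: k)
  qed
  also have "\<dots> \<le> 8 * trunc x (nat \<bar>k\<bar>)" using trunc_ge[of "nat \<bar>k\<bar>" x] by simp
  finally show ?thesis .
qed

context centred_law begin

abbreviation "abar x \<equiv> pot x + pot (- x)"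

lemma kern_add: "kern x t + kern (- x) t = 2 * (1 - cos (t * real_of_int x)) * ((1 - Re (\<phi> t)) / (cmod (1 - \<phi> t))\<^sup>2)"
proof -
  have "(1 - iexp (t * real_of_int x)) + (1 - iexp (t * real_of_int (- x))) = of_real (2 * (1 - cos (t * real_of_int x)))"
    by (simp add: complex_eq_iff Re_exp Im_exp)
  then have "kern x t + kern (- x) t = Re (of_real (2 * (1 - cos (t * real_of_int x))) / (1 - \<phi> t))"
    unfolding kern_def by (simp only: add_divide_distrib[symmetric] plus_complex.sel(1)[symmetric])
  then show ?thesis by (simp add: Re_divide cmod_power2)
qed

text \<open>The kernel contains \<open>1 - Re \<phi>\<close>, hence \<open>D n\<close>. Bounding it
  by \<open>|1 - \<phi>|\<close> throughout would leave the sum of \<open>1 / M n\<close> over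
  \<open>n < x\<close>, which can be of larger order than \<open>x / M x\<close>.\<close>

lemma abar_upper: obtains C where "0 < C" "\<And>x. 1 \<le> x \<Longrightarrow> abar (int x) \<le> C * f x"
proof -
  obtain c where c: "0 < c" "\<And>n t. 1 \<le> n \<Longrightarrow> t \<in> shell n \<Longrightarrow> c * t\<^sup>2 * M n \<le> norm (1 - \<phi> t)"
    "\<And>t. 1 \<le> t \<Longrightarrow> t \<le> pi \<Longrightarrow> c \<le> norm (1 - \<phi> t)" by (rule char_lower) blast
  define C1 where "C1 = 512 / c\<^sup>2"
  define C2 where "C2 = 4 / c"
  define K where "K = 8 / c\<^sup>2"
  have C12: "0 < C1" "0 < C2" "0 < K" using c by (auto simp: C1_def C2_def K_def)
  define C where "C = C1 + C2 + K * pi / f 1"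
  show ?thesis
  proof (rule that[of C])
    show "0 < C" using C12 scale_pos[of 1] by (auto simp: C_def intro!: add_pos_nonneg)
    fix x :: nat assume x: "1 \<le> x"
    define g where "g t = kern (int x) t + kern (- int x) t" for t
    \<comment> \<open>High frequencies \<open>n < x\<close>: trivial bound for the cosine and
      \<open>D n\<close> for the real part. Low frequencies: \<open>1 - cos v \<le> 2 * v^2\<close>
      and \<open>1 - Re \<phi> \<le> |1 - \<phi>|\<close>.\<close>
    define cc where "cc n = (if n < x then C1 * (D n / (M n * M (Suc n))) * (real n * (real n + 1)) else C2 * (real x)\<^sup>2 / M x)" for n
    \<comment> \<open>An antidifference of the shell bounds, built from \<open>f\<close> below
      \<open>x\<close> and from \<open>- 1 / n\<close> above; the total variation of each part is a
      multiple of \<open>f x\<close>.\<close>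
    define u where "u n = C1 * f (min n x) - C2 * real x * f x / real (max n x)" for n
    have Mx: "0 < M x" using x by (intro M_pos) auto
    have gk: "g t = 2 * (1 - cos (t * real x)) * ((1 - Re (\<phi> t)) / (cmod (1 - \<phi> t))\<^sup>2)" for t
      unfolding g_def kern_add by simp
    have nn: "0 \<le> (1 - Re (\<phi> t)) / (cmod (1 - \<phi> t))\<^sup>2" for t using Re_char_le[of t] by simp
    have cos4: "2 * (1 - cos (t * real x)) \<le> 4" for t by (smt (verit) cos_ge_minus_one)
    have "(\<integral>\<^sup>+t. ennreal (g t) \<partial>half_circle) \<le> ennreal ((C1 * f x + C2 * f x) + K * pi)"
    proof (rule nn_integral_half_circle_le[where c = cc])
      show "g \<in> borel_measurable borel" unfolding g_def by measurable
      show "0 \<le> cc n" for n unfolding cc_def using C12 D_nonneg M_nonneg by simp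
      show "0 \<le> K" using C12 by simp
      show "g t \<le> K" if t: "1 \<le> t" "t \<le> pi" for t
      proof -
        have b: "(1 - Re (\<phi> t)) / (cmod (1 - \<phi> t))\<^sup>2 \<le> 2 / c\<^sup>2"
          using c(3)[OF t] c(1) abs_Re_le_cmod[of "\<phi> t"] norm_char_le[of t] by (intro frac_le power_mono) auto
        have "g t \<le> 4 * (2 / c\<^sup>2)"
          unfolding gk by (intro mult_mono cos4 b nn) auto
        then show ?thesis by (simp add: K_def)
      qed
      show "g t \<le> cc n" if n: "1 \<le> n" and t: "t \<in> shell n" for n t
      proof -
        note s = shellD[OF t n]
        have Mn: "0 < M n" using n by (intro M_pos) auto
        have low: "c * t\<^sup>2 * M n \<le> cmod (1 - \<phi> t)" by (rule c(2)[OF n t])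
        have pos: "0 < c * t\<^sup>2 * M n" using c Mn s by simp
        show ?thesis
        proof (cases "n < x")
          case True
          have b: "(1 - Re (\<phi> t)) / (cmod (1 - \<phi> t))\<^sup>2 \<le> 16 * t\<^sup>2 * D n / (c * t\<^sup>2 * M n)\<^sup>2"
            using Re_char_shell[OF t n] low pos D_nonneg[of n] by (intro frac_le power_mono) auto
          have "g t \<le> 4 * (16 * t\<^sup>2 * D n / (c * t\<^sup>2 * M n)\<^sup>2)"
            unfolding gk by (intro mult_mono cos4 b nn) auto
          also have "\<dots> = 64 / c\<^sup>2 * (D n / (M n)\<^sup>2) * (1 / t)\<^sup>2"
            using s Mn c(1) by (simp add: power_mult_distrib power2_eq_square)
          also have "\<dots> \<le> 64 / c\<^sup>2 * (2 * D n / (M n * M (Suc n))) * (4 * (real n * (real n + 1)))"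
          proof (intro mult_mono)
            have "D n / (M n)\<^sup>2 = 2 * D n / (M n * (2 * M n))" using Mn by (simp add: power2_eq_square)
            also have "\<dots> \<le> 2 * D n / (M n * M (Suc n))"
              using Mn M_Suc_le(1)[of n] M_pos[of "Suc n"] n D_nonneg[of n]
              by (intro divide_left_mono mult_left_mono) auto
            finally show "D n / (M n)\<^sup>2 \<le> 2 * D n / (M n * M (Suc n))" .
            have "1 / t \<le> real n + 1" using s by (simp add: divide_le_eq mult.commute)
            then have "(1 / t)\<^sup>2 \<le> (real n + 1)\<^sup>2" using s by (intro power_mono) auto
            also have "\<dots> \<le> (2 * real n) * (real n + 1)" unfolding power2_eq_square
              using n by (intro mult_right_mono) auto
            also have "\<dots> \<le> 4 * (real n * (real n + 1))" by simp
            finally show "(1 / t)\<^sup>2 \<le> 4 * (real n * (real n + 1))" .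
          qed (use D_nonneg M_nonneg in auto)
          also have "\<dots> = cc n" using True by (simp add: cc_def C1_def)
          finally show ?thesis .
        next
          case False
          have a: "2 * (1 - cos (t * real x)) \<le> 4 * (t * real x)\<^sup>2"
          proof -
            have "(min 1 \<bar>t * real x\<bar>)\<^sup>2 \<le> \<bar>t * real x\<bar>\<^sup>2" by (intro power_mono) auto
            then show ?thesis using one_minus_cos_le[of "t * real x"] by simp
          qed
          have b: "(1 - Re (\<phi> t)) / (cmod (1 - \<phi> t))\<^sup>2 \<le> 1 / (c * t\<^sup>2 * M n)"
          proof -
            have "1 - Re (\<phi> t) \<le> cmod (1 - \<phi> t)" using complex_Re_le_cmod[of "1 - \<phi> t"] by simp
            then have "(1 - Re (\<phi> t)) / (cmod (1 - \<phi> t))\<^sup>2 \<le> cmod (1 - \<phi> t) / (cmod (1 - \<phi> t))\<^sup>2"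
              by (intro divide_right_mono) auto
            also have "\<dots> = 1 / cmod (1 - \<phi> t)" by (simp add: power2_eq_square)
            also have "\<dots> \<le> 1 / (c * t\<^sup>2 * M n)" using low pos
              by (intro divide_left_mono mult_pos_pos[OF less_le_trans[OF pos low] pos]) auto
            finally show ?thesis .
          qed
          have "g t \<le> 4 * (t * real x)\<^sup>2 * (1 / (c * t\<^sup>2 * M n))"
            unfolding gk by (intro mult_mono a b nn) auto
          also have "\<dots> = 4 * (real x)\<^sup>2 / c / M n" using s by (simp add: power_mult_distrib)
          also have "\<dots> \<le> 4 * (real x)\<^sup>2 / c / M x"
            using False Mx M_mono(1)[of x n] c(1) by (intro divide_left_mono) auto
          also have "\<dots> = cc n" using False by (simp add: cc_def C2_def)
          finally show ?thesis .
        qed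
      qed
      show "(\<Sum>n=1..N. cc n / (real n * (real n + 1))) \<le> C1 * f x + C2 * f x" for N
      proof -
        have "cc n / (real n * (real n + 1)) \<le> u (Suc n) - u n" if n: "1 \<le> n" for n
        proof (cases "n < x")
          case True
          have "cc n / (real n * (real n + 1)) = C1 * (D n / (M n * M (Suc n)))"
            using True n unfolding cc_def by simp
          also have "\<dots> = C1 * (f (Suc n) - f n)" using n by (simp add: scale_diff)
          also have "\<dots> = u (Suc n) - u n" using True by (simp add: u_def algebra_simps)
          finally show ?thesis by simp
        next
          case False
          have "cc n / (real n * (real n + 1)) = C2 * real x * f x * (1 / (real n * (real n + 1)))"
            using False by (simp add: cc_def scale_def power2_eq_square)
          also have "1 / (real n * (real n + 1)) = 1 / real n - 1 / real (Suc n)" using n by (simp add: field_simps)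
          also have "C2 * real x * f x * (1 / real n - 1 / real (Suc n)) = u (Suc n) - u n"
            using False by (simp add: u_def right_diff_distrib max_def)
          finally show ?thesis by simp
        qed
        then have "(\<Sum>n=1..N. cc n / (real n * (real n + 1))) \<le> (\<Sum>n=1..N. u (Suc n) - u n)"
          by (intro sum_mono) auto
        also have "\<dots> = u (Suc N) - u 1" by (rule sum_Suc_diff) simp
        finally have "(\<Sum>n=1..N. cc n / (real n * (real n + 1))) \<le> u (Suc N) - u 1" .
        moreover have "u (Suc N) \<le> C1 * f x"
        proof -
          have "C1 * f (min (Suc N) x) \<le> C1 * f x" using C12 by (intro mult_left_mono scale_mono) auto
          moreover have "0 \<le> C2 * real x * f x / real (max (Suc N) x)" using C12 scale_nonneg by simp
          ultimately show ?thesis unfolding u_def by linarith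
        qed
        moreover have "- u 1 \<le> C2 * f x"
        proof -
          have "max 1 x = x" using x by simp
          then have "C2 * real x * f x / real (max 1 x) = C2 * f x" using x by simp
          moreover have "0 \<le> C1 * f (min 1 x)" using C12 scale_nonneg by simp
          ultimately show ?thesis unfolding u_def by linarith
        qed
        ultimately show ?thesis by linarith
      qed
    qed
    moreover have g0: "0 \<le> g t" for t unfolding g_def kern_add using Re_char_le[of t] by simp
    have gi: "integrable half_circle g" unfolding g_def
      by (intro Bochner_Integration.integrable_add potential_fourier(1))
    have "ennreal (\<integral>t. g t \<partial>half_circle) = (\<integral>\<^sup>+t. ennreal (g t) \<partial>half_circle)"
      using gi g0 by (intro nn_integral_eq_integral[symmetric]) auto
    ultimately have "ennreal (\<integral>t. g t \<partial>half_circle) \<le> ennreal ((C1 * f x + C2 * f x) + K * pi)" by simp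
    then have le: "(\<integral>t. g t \<partial>half_circle) \<le> (C1 * f x + C2 * f x) + K * pi"
      using C12 scale_nonneg[of x] by (subst (asm) ennreal_le_iff) auto
    have "pot (int x) = (\<integral>t. kern (int x) t \<partial>half_circle) / pi" "pot (- int x) = (\<integral>t. kern (- int x) t \<partial>half_circle) / pi"
      using sums_unique2[OF pot_sums potential_fourier(2)] by auto
    then have "abar (int x) = (\<integral>t. g t \<partial>half_circle) / pi"
      unfolding g_def by (simp add: potential_fourier(1) add_divide_distrib)
    also have "\<dots> \<le> (C1 * f x + C2 * f x + K * pi) / 1"
      using le pi_gt3 C12 scale_nonneg[of x] by (intro frac_le) auto
    also have "\<dots> \<le> C * f x"
    proof -
      have "f 1 \<le> f x" using x by (rule scale_mono)
      then have "K * pi \<le> K * pi / f 1 * f x" using scale_pos[of 1] C12 by (simp add: field_simps)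
      then show ?thesis by (simp add: C_def algebra_simps)
    qed
    finally show "abar (int x) \<le> C * f x" .
  qed
qed

end

lemma hits_mono_r: "0 \<le> r \<Longrightarrow> r \<le> s \<Longrightarrow> hits P r D x y \<le> hits P s D x y"
  unfolding hits_def
  by (intro suminf_le mult_right_mono ennreal_leI power_mono) auto

lemma taboo_le_1: "taboo P D x n y \<le> 1"
proof -
  have "taboo P D x n y \<le> (\<integral>\<^sup>+y. taboo P D x n y \<partial>count_space UNIV)"
    by (rule nn_integral_ge_point) simp
  also have "\<dots> \<le> 1" unfolding taboo_mass[of P D x n, symmetric] by simp
  finally show ?thesis .
qed

lemma nn_integral_count_space_finite_indicator:
  assumes "finite B"
  shows "(\<integral>\<^sup>+z. g z * indicator B z * h z \<partial>count_space UNIV) = (\<Sum>z\<in>B. g z * h z :: ennreal)"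
  using assms by (subst nn_integral_count_space'[of B]) (auto simp: indicator_def intro!: sum.cong)

lemma pmf_walk_Suc': "pmf (walk_pmf P (Suc n)) y = measure_pmf.expectation P (\<lambda>k. pmf (walk_pmf P n) (y - k))"
proof -
  have "ennreal (pmf (walk_pmf P (Suc n)) y) = (\<integral>\<^sup>+z. ennreal (pmf (walk_pmf P n) z) * ennreal (pmf P (y - z)) \<partial>count_space UNIV)"
    by (rule pmf_walk_Suc)
  also have "\<dots> = (\<integral>\<^sup>+k. ennreal (pmf (walk_pmf P n) (y - k)) * ennreal (pmf P (y - (y - k))) \<partial>count_space UNIV)"
    by (rule nn_integral_bij_count_space[symmetric]) (auto simp: bij_betw_def inj_on_def intro!: image_eqI[of _ _ "y - _"])
  also have "\<dots> = (\<integral>\<^sup>+k. ennreal (pmf (walk_pmf P n) (y - k)) \<partial>measure_pmf P)"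
    by (simp add: nn_integral_measure_pmf mult.commute)
  also have "\<dots> = ennreal (measure_pmf.expectation P (\<lambda>k. pmf (walk_pmf P n) (y - k)))"
    by (intro nn_integral_eq_integral measure_pmf.integrable_const_bound[of _ 1]) (auto simp: pmf_le_1)
  finally show ?thesis by (simp add: integral_nonneg_AE)
qed

context centred_law begin

section \<open>Green function and potential\<close>

abbreviation "p n y \<equiv> pmf (walk_pmf P n) y"

text \<open>At \<open>r = 1\<close> the value at 0 would be infinite (\<open>green_at_top\<close>);
  the differences \<open>pot_r\<close> nevertheless have finite limits, namely the
  potential.\<close>

definition "green r y = (\<Sum>n. r ^ n * p n y)"

definition "pot_r r x = green r 0 - green r (- x)"

lemma summable_green: "0 \<le> r \<Longrightarrow> r < 1 \<Longrightarrow> summable (\<lambda>n. r ^ n * p n y)"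
proof (rule summable_comparison_test'[of "\<lambda>n. r ^ n" 0])
  assume r: "0 \<le> r" "r < 1"
  then show "summable (\<lambda>n. r ^ n)" by (intro summable_geometric) simp
  show "norm (r ^ n * p n y) \<le> r ^ n" for n
    using r mult_left_mono[OF pmf_le_1[of "walk_pmf P n" y], of "r ^ n"] by (simp add: abs_mult)
qed

lemma green_nonneg: "0 \<le> r \<Longrightarrow> r < 1 \<Longrightarrow> 0 \<le> green r y"
  unfolding green_def by (intro suminf_nonneg summable_green) auto

lemma green_le: "0 \<le> r \<Longrightarrow> r < 1 \<Longrightarrow> green r y \<le> 1 / (1 - r)"
proof -
  assume r: "0 \<le> r" "r < 1"
  have "green r y \<le> (\<Sum>n. r ^ n)" unfolding green_def
    using r by (intro suminf_le summable_green summable_geometric) (auto simp: mult_left_le pmf_le_1)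
  then show ?thesis using r by (simp add: suminf_geometric)
qed

lemma green_0_ge: "0 \<le> r \<Longrightarrow> r < 1 \<Longrightarrow> 1 \<le> green r 0"
proof -
  assume r: "0 \<le> r" "r < 1"
  have "(\<Sum>n<1. r ^ n * p n 0) \<le> green r 0"
    unfolding green_def using r by (intro sum_le_suminf summable_green) auto
  then show ?thesis by simp
qed

lemma pot_r_0 [simp]: "pot_r r 0 = 0" by (simp add: pot_r_def)

lemma pot_0 [simp]: "pot 0 = 0" by (simp add: pot_def)

lemma eventually_at_left_1: "eventually (\<lambda>r. 0 < r \<and> r < (1::real)) (at_left 1)"
  using eventually_at_left_real[OF zero_less_one] by eventually_elim simp

lemma pot_r_tendsto: "((\<lambda>r. pot_r r x) \<longlongrightarrow> pot x) (at_left 1)"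
proof (rule Lim_transform_eventually[OF abel_limit[OF pot_sums]])
  show "eventually (\<lambda>r. (\<Sum>n. r ^ n * (p n 0 - p n (- x))) = pot_r r x) (at_left 1)"
    using eventually_at_left_1
    by eventually_elim (simp add: pot_r_def green_def suminf_diff[symmetric] summable_green right_diff_distrib)
qed

lemma green_split:
  assumes "0 \<le> r" "r < 1"
  shows "(\<lambda>n. r ^ Suc n * p (Suc n) y) sums (green r y - (if y = 0 then 1 else 0))"
proof -
  have "(\<lambda>n. r ^ n * p n y) sums green r y"
    unfolding green_def by (rule summable_sums[OF summable_green[OF assms]])
  then have "(\<lambda>n. r ^ Suc n * p (Suc n) y) sums (green r y - r ^ 0 * p 0 y)"
    by (subst sums_Suc_iff) simp
  then show ?thesis by (auto simp: indicator_def simp del: power_Suc walk_pmf.simps(2))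
qed

lemma green_minus_nonneg:
  assumes "0 \<le> r" "r < 1" shows "0 \<le> green r y - (if y = 0 then 1 else 0)"
  using green_nonneg[OF assms] green_0_ge[OF assms] by auto

lemma hits_empty:
  assumes "0 \<le> r" "r < 1"
  shows "hits P r {} x y = ennreal (green r (y - x) - (if y = x then 1 else 0))"
proof -
  have "hits P r {} x y = (\<Sum>n. ennreal (r ^ Suc n * p (Suc n) (y - x)))"
    unfolding hits_def taboo_empty using assms by (intro suminf_cong) (simp add: ennreal_mult' del: power_Suc)
  also have "\<dots> = ennreal (\<Sum>n. r ^ Suc n * p (Suc n) (y - x))"
    using assms green_split[OF assms, of "y - x"] by (intro suminf_ennreal2) (auto simp: sums_iff simp del: power_Suc walk_pmf.simps)
  also have "(\<Sum>n. r ^ Suc n * p (Suc n) (y - x)) = green r (y - x) - (if y = x then 1 else 0)"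
    using green_split[OF assms, of "y - x"] by (simp add: sums_iff del: power_Suc walk_pmf.simps)
  finally show ?thesis .
qed

lemma hits_finite: "0 \<le> r \<Longrightarrow> r < 1 \<Longrightarrow> hits P r B x y < top"
  using hits_antimono[of "{}" B r P x y] hits_empty[of r x y] by (simp add: le_less_trans)

abbreviation "hit r B x y \<equiv> enn2real (hits P r B x y)"

lemma ennreal_hit: "0 \<le> r \<Longrightarrow> r < 1 \<Longrightarrow> ennreal (hit r B x y) = hits P r B x y"
  using hits_finite[of r B x y] by simp

lemma hit_decomp:
  assumes r: "0 \<le> r" "r < 1" and B: "finite B"
  shows "green r (y - x) - (if y = x then 1 else 0) =
    hit r B x y + (\<Sum>b\<in>B. hit r B x b * (green r (y - b) - (if y = b then 1 else 0)))"
proof -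
  have gm: "0 \<le> green r (y - b) - (if y = b then 1 else 0)" for b
    using green_minus_nonneg[OF r, of "y - b"] by simp
  have Snn: "0 \<le> (\<Sum>b\<in>B. hit r B x b * (green r (y - b) - (if y = b then 1 else 0)))"
    by (intro sum_nonneg mult_nonneg_nonneg gm enn2real_nonneg)
  have "hits P r {} x y = hits P r B x y + (\<Sum>b\<in>B. hits P r B x b * hits P r {} b y)"
    using hits_decomp[of "{}" B r P x y] r B by (simp add: nn_integral_count_space_finite_indicator)
  also have "(\<Sum>b\<in>B. hits P r B x b * hits P r {} b y) = (\<Sum>b\<in>B. ennreal (hit r B x b * (green r (y - b) - (if y = b then 1 else 0))))"
    by (intro sum.cong refl) (simp only: hits_empty[OF r] ennreal_mult'[OF enn2real_nonneg] ennreal_hit[OF r])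
  also have "\<dots> = ennreal (\<Sum>b\<in>B. hit r B x b * (green r (y - b) - (if y = b then 1 else 0)))"
    by (intro sum_ennreal mult_nonneg_nonneg gm enn2real_nonneg)
  also have "hits P r B x y + \<dots> = ennreal (hit r B x y + (\<Sum>b\<in>B. hit r B x b * (green r (y - b) - (if y = b then 1 else 0))))"
    unfolding ennreal_plus[OF enn2real_nonneg Snn] ennreal_hit[OF r] ..
  finally have "ennreal (green r (y - x) - (if y = x then 1 else 0)) = ennreal (hit r B x y + (\<Sum>b\<in>B. hit r B x b * (green r (y - b) - (if y = b then 1 else 0))))"
    unfolding hits_empty[OF r] .
  moreover have "0 \<le> green r (y - x) - (if y = x then 1 else 0)" by (rule gm)
  moreover have "0 \<le> hit r B x y + (\<Sum>b\<in>B. hit r B x b * (green r (y - b) - (if y = b then 1 else 0)))"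
    using Snn by simp
  ultimately show ?thesis by (simp only: ennreal_inj)
qed

text \<open>For \<open>y \<in> B\<close> the term \<open>hit r B x y\<close> of
  \<open>hit_decomp\<close> is exactly the missing visit at time 0, so it is absorbed into the Green
  functions on the right.\<close>

lemma hit_green:
  assumes r: "0 \<le> r" "r < 1" and B: "finite B" "y \<in> B"
  shows "green r (y - x) - (if y = x then 1 else 0) = (\<Sum>b\<in>B. hit r B x b * green r (y - b))"
proof -
  have "(\<Sum>b\<in>B. hit r B x b * (green r (y - b) - (if y = b then 1 else 0)))
     = (\<Sum>b\<in>B. hit r B x b * green r (y - b)) - (\<Sum>b\<in>B. if y = b then hit r B x b else 0)"
    unfolding sum_subtractf[symmetric] by (intro sum.cong) (auto simp: algebra_simps)
  also have "(\<Sum>b\<in>B. if y = b then hit r B x b else 0) = hit r B x y" using B by (simp add: sum.delta)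
  finally show ?thesis using hit_decomp[OF r B(1), of y x] by simp
qed

lemma hit_0_eq:
  assumes r: "0 \<le> r" "r < 1"
  shows "hit r {0} x 0 * green r 0 = green r (- x) - (if x = 0 then 1 else 0)"
  using hit_green[OF r, of "{0}" 0 x] by auto

lemma hit_le_1: assumes "0 \<le> r" "r < 1" "y \<in> B" shows "hit r B x y \<le> 1"
proof -
  have "hits P r B x y \<le> 1" using hits_mono_r[of r 1 P B x y] hits_le_1[OF assms(3)] assms by (auto intro: order_trans)
  then show ?thesis using enn2real_mono[of "hits P r B x y" 1] by simp
qed

lemma pot_r_nonneg: assumes r: "0 \<le> r" "r < 1" shows "0 \<le> pot_r r x"
proof (cases "x = 0")
  case False
  have "hit r {0} x 0 * green r 0 \<le> 1 * green r 0"
    using hit_le_1[OF r, of 0 "{0}" x] green_nonneg[OF r] by (intro mult_right_mono) auto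
  then show ?thesis using hit_0_eq[OF r, of x] False by (simp add: pot_r_def)
qed simp

text \<open>Green function of the walk killed at 0, time 0 included. Only the last term involves
  \<open>green\<close> itself; it is nonnegative when \<open>pot_r\<close> is, and vanishes as
  \<open>r\<close> tends to 1.\<close>

lemma visits_r:
  assumes r: "0 \<le> r" "r < 1" and z: "z \<noteq> 0"
  shows "hit r {0} x z + (if z = x then 1 else 0) =
    ((if x = 0 then 1 else 0) + pot_r r x) + pot_r r (- z) - pot_r r (x - z) -
      ((if x = 0 then 1 else 0) + pot_r r x) * pot_r r (- z) / green r 0"
proof -
  have g: "0 < green r 0" using green_0_ge[OF r] by simp
  have h0: "hit r {0} x 0 = (green r 0 - ((if x = 0 then 1 else 0) + pot_r r x)) / green r 0"
    using hit_0_eq[OF r, of x] g by (simp add: field_simps pot_r_def)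
  have "hit r {0} x z + (if z = x then 1 else 0) = green r (z - x) - hit r {0} x 0 * green r z"
    using hit_decomp[OF r, of "{0}" z x] z by simp
  also have "green r (z - x) = green r 0 - pot_r r (x - z)" by (simp add: pot_r_def)
  also have "green r z = green r 0 - pot_r r (- z)" by (simp add: pot_r_def)
  finally show ?thesis unfolding h0 using g by (simp add: field_simps)
qed

text \<open>Subadditivity is the nonnegativity of the killed Green function, read off from
  \<open>visits_r\<close> at \<open>z = - y\<close>.\<close>

lemma pot_r_subadd: assumes r: "0 \<le> r" "r < 1" shows "pot_r r (x + y) \<le> pot_r r x + pot_r r y"
proof (cases "x = 0 \<or> y = 0")
  case False
  have "0 \<le> hit r {0} x (- y) + (if - y = x then 1 else 0)" by simp
  moreover have "0 \<le> pot_r r x * pot_r r y / green r 0"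
    using pot_r_nonneg[OF r] green_nonneg[OF r] by simp
  moreover have "hit r {0} x (- y) + (if - y = x then 1 else 0) =
      pot_r r x + pot_r r y - pot_r r (x + y) - pot_r r x * pot_r r y / green r 0"
    using visits_r[OF r, of "- y" x] False by simp
  ultimately show ?thesis by linarith
qed auto

lemma pot_nonneg: "0 \<le> pot x"
proof (rule tendsto_lowerbound[OF pot_r_tendsto])
  show "eventually (\<lambda>r. 0 \<le> pot_r r x) (at_left 1)"
    using eventually_at_left_1 by eventually_elim (simp add: pot_r_nonneg)
qed simp

lemma pot_subadd: "pot (x + y) \<le> pot x + pot y"
proof (rule tendsto_le[OF _ tendsto_add[OF pot_r_tendsto pot_r_tendsto] pot_r_tendsto])
  show "eventually (\<lambda>r. pot_r r (x + y) \<le> pot_r r x + pot_r r y) (at_left 1)"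
    using eventually_at_left_1 by eventually_elim (simp add: pot_r_subadd)
qed simp

section \<open>Lower bound for the symmetrised potential\<close>

lemma green_rec:
  assumes r: "0 \<le> r" "r < 1"
  shows "green r y = (if y = 0 then 1 else 0) + r * E (\<lambda>k. green r (y - k))"
proof -
  have summ: "summable (\<lambda>n. r ^ n)" using r by (intro summable_geometric) simp
  have int: "integrable (measure_pmf P) (\<lambda>k. r ^ n * p n (y - k))" for n
    by (intro integrable_mult_right measure_pmf.integrable_const_bound[of _ 1]) (auto simp: pmf_le_1)
  have "E (\<lambda>k. green r (y - k)) = (\<Sum>n. E (\<lambda>k. r ^ n * p n (y - k)))"
    unfolding green_def
  proof (rule integral_suminf[OF int])
    show "AE k in measure_pmf P. summable (\<lambda>n. norm (r ^ n * p n (y - k)))"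
      using r summable_green[OF r] by (intro AE_I2) (simp add: abs_mult)
    show "summable (\<lambda>n. E (\<lambda>k. norm (r ^ n * p n (y - k))))"
    proof (rule summable_comparison_test'[OF summ, of 0])
      fix n
      have "E (\<lambda>k. norm (r ^ n * p n (y - k))) \<le> E (\<lambda>k. r ^ n)"
        using int[of n] r by (intro integral_mono integrable_norm) (auto simp: abs_mult mult_left_le pmf_le_1)
      then show "norm (E (\<lambda>k. norm (r ^ n * p n (y - k)))) \<le> r ^ n" by simp
    qed
  qed
  also have "\<dots> = (\<Sum>n. r ^ n * p (Suc n) y)"
    unfolding pmf_walk_Suc' by simp
  finally have "r * E (\<lambda>k. green r (y - k)) = r * (\<Sum>n. r ^ n * p (Suc n) y)" by simp
  moreover have "(\<Sum>n. r ^ Suc n * p (Suc n) y) = r * (\<Sum>n. r ^ n * p (Suc n) y)"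
  proof (cases "r = 0")
    case False
    have "summable (\<lambda>n. r ^ Suc n * p (Suc n) y)" using green_split[OF r, of y] by (simp add: sums_iff del: walk_pmf.simps)
    then have "summable (\<lambda>n. r * (r ^ n * p (Suc n) y))" by (simp add: mult.assoc del: walk_pmf.simps)
    then have "summable (\<lambda>n. r ^ n * p (Suc n) y)" using False by (simp only: summable_cmult_iff) simp
    then show ?thesis by (simp add: suminf_mult mult.assoc del: walk_pmf.simps)
  qed simp
  moreover have "(\<Sum>n. r ^ Suc n * p (Suc n) y) = green r y - (if y = 0 then 1 else 0)"
    using green_split[OF r, of y] by (simp only: sums_iff)
  ultimately show ?thesis by linarith
qed

text \<open>Summation by parts moves the generator of the walk from \<open>\<kappa>\<close> to the
  tent. The linear term has mean 0 and the remainder is bounded by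
  \<open>sum_abs_tent\<close>.\<close>

lemma tent_bound:
  assumes K: "\<And>z. \<bar>\<kappa> z\<bar> \<le> K"
  shows "\<bar>\<Sum>z\<in>{0..2 * int x}. tent x z * (\<kappa> z - E (\<lambda>k. \<kappa> (z - k)))\<bar> \<le> 8 * K * M x"
proof -
  let ?T = "{0..2 * int x}"
  define c0 where "c0 = (\<Sum>z\<in>?T. tent_slope x z * \<kappa> z)"
  \<comment> \<open>Adding \<open>k * c0\<close> leaves the expectation unchanged because the law is
    centred, and turns a first difference of the tent into its Taylor remainder.\<close>
  define W where "W k = (\<Sum>z\<in>?T. tent x z * \<kappa> z) - (\<Sum>z\<in>?T. tent x z * \<kappa> (z - k)) + real_of_int k * c0" for k
  have K0: "0 \<le> K" using K[of 0] by simp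
  have out: "tent x z = 0" "tent_slope x z = 0" if "z \<notin> ?T" for z
    using that by (auto simp: tent_def tent_slope_def)
  have W: "\<bar>W k\<bar> \<le> 8 * K * trunc x (nat \<bar>k\<bar>)" for k
  proof -
    define S where "S = ?T \<union> (\<lambda>z. z - k) ` ?T"
    have S: "finite S" by (simp add: S_def)
    have 1: "(\<Sum>z\<in>?T. tent x z * \<kappa> z) = (\<Sum>z\<in>S. tent x z * \<kappa> z)"
      by (rule sum.mono_neutral_left[OF S]) (use out in \<open>auto simp: S_def\<close>)
    have 2: "c0 = (\<Sum>z\<in>S. tent_slope x z * \<kappa> z)" unfolding c0_def
      by (rule sum.mono_neutral_left[OF S]) (use out in \<open>auto simp: S_def\<close>)
    have "(\<Sum>z\<in>?T. tent x z * \<kappa> (z - k)) = (\<Sum>z\<in>(\<lambda>z. z - k) ` ?T. tent x (z + k) * \<kappa> z)"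
      by (subst sum.reindex) (auto simp: inj_on_def)
    also have "\<dots> = (\<Sum>z\<in>S. tent x (z + k) * \<kappa> z)"
    proof (rule sum.mono_neutral_left[OF S])
      show "\<forall>z\<in>S - (\<lambda>z. z - k) ` ?T. tent x (z + k) * \<kappa> z = 0"
      proof
        fix z assume z: "z \<in> S - (\<lambda>z. z - k) ` ?T"
        have "z + k \<notin> ?T"
        proof
          assume "z + k \<in> ?T"
          then have "z \<in> (\<lambda>z. z - k) ` ?T" by (intro image_eqI[of _ _ "z + k"]) auto
          then show False using z by simp
        qed
        then show "tent x (z + k) * \<kappa> z = 0" using out by simp
      qed
    qed (auto simp: S_def)
    finally have "W k = - (\<Sum>z\<in>S. (tent x (z + k) - tent x z - real_of_int k * tent_slope x z) * \<kappa> z)"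
      unfolding W_def 1 2 by (simp add: sum_distrib_left sum_subtractf left_diff_distrib mult.assoc)
    then have "\<bar>W k\<bar> \<le> (\<Sum>z\<in>S. \<bar>tent x (z + k) - tent x z - real_of_int k * tent_slope x z\<bar> * \<bar>\<kappa> z\<bar>)"
      by (simp add: abs_mult[symmetric] sum_abs)
    also have "\<dots> \<le> (\<Sum>z\<in>S. \<bar>tent x (z + k) - tent x z - real_of_int k * tent_slope x z\<bar> * K)"
      using K by (intro sum_mono mult_left_mono) auto
    also have "\<dots> \<le> 8 * trunc x (nat \<bar>k\<bar>) * K"
      unfolding sum_distrib_right[symmetric] using K0 sum_abs_tent[OF S] by (intro mult_right_mono) auto
    finally show ?thesis by (simp add: mult_ac)
  qed
  have intk: "integrable (measure_pmf P) (\<lambda>k. \<kappa> (z - k))" for z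
    using K by (intro measure_pmf.integrable_const_bound[of _ K]) auto
  have "(\<Sum>z\<in>?T. tent x z * (\<kappa> z - E (\<lambda>k. \<kappa> (z - k)))) = E W"
    unfolding W_def using integrable_law
    by (simp add: intk mean_zero right_diff_distrib sum_subtractf)
  also have "\<bar>E W\<bar> \<le> E (\<lambda>k. \<bar>W k\<bar>)" by (rule integral_abs_bound)
  also have "\<dots> \<le> E (\<lambda>k. 8 * K * trunc x (nat \<bar>k\<bar>))"
  proof (intro integral_mono integrable_mult_right integrable_trunc W)
    show "integrable (measure_pmf P) (\<lambda>k. \<bar>W k\<bar>)"
      unfolding W_def using integrable_law intk
      by (intro integrable_abs Bochner_Integration.integrable_add Bochner_Integration.integrable_diff
        Bochner_Integration.integrable_sum integrable_mult_right integrable_mult_left) auto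
  qed
  also have "\<dots> = 8 * K * M x" by (simp add: dtail_eq)
  finally show ?thesis .
qed

text \<open>The difference \<open>\<kappa>\<close> of two Green functions has sources only at 0 and
  at \<open>x\<close>, and subadditivity bounds it by the symmetrised \<open>pot_r\<close>. Killing
  costs the term with \<open>1 - r\<close>, which disappears in the limit.\<close>

lemma pot_r_lower:
  assumes r: "0 < r" "r < 1"
  shows "real x \<le> (pot_r r (int x) + pot_r r (- int x)) * (8 * M x + (1 - r) * (\<Sum>z\<in>{0..2 * int x}. tent x z))"
proof -
  have r0: "0 \<le> r" using r by simp
  let ?T = "{0..2 * int x}"
  define K where "K = pot_r r (int x) + pot_r r (- int x)"
  define \<kappa> where "\<kappa> z = green r z - green r (z - int x)" for z
  have nn: "0 \<le> pot_r r y" for y by (rule pot_r_nonneg[OF r0 r(2)])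
  have K: "\<bar>\<kappa> z\<bar> \<le> K" for z
  proof -
    have eq: "\<kappa> z = pot_r r (int x - z) - pot_r r (- z)" by (simp add: \<kappa>_def pot_r_def)
    have "pot_r r (int x - z) \<le> pot_r r (int x) + pot_r r (- z)" using pot_r_subadd[OF r0 r(2), of "int x" "- z"] by simp
    moreover have "pot_r r (- z) \<le> pot_r r (int x - z) + pot_r r (- int x)" using pot_r_subadd[OF r0 r(2), of "int x - z" "- int x"] by simp
    ultimately show ?thesis using nn[of "int x"] nn[of "- int x"] unfolding eq K_def by linarith
  qed
  have intg: "integrable (measure_pmf P) (\<lambda>k. green r (z - k))" for z
    using green_le[OF r0 r(2)] green_nonneg[OF r0 r(2)]
    by (intro measure_pmf.integrable_const_bound[of _ "1 / (1 - r)"]) auto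
  have rec: "r * E (\<lambda>k. \<kappa> (z - k)) = \<kappa> z - (if z = 0 then 1 else 0) + (if z = int x then 1 else 0)" for z
  proof -
    have "(\<lambda>k. \<kappa> (z - k)) = (\<lambda>k. green r (z - k) - green r (z - int x - k))"
      by (simp add: \<kappa>_def algebra_simps)
    then have "E (\<lambda>k. \<kappa> (z - k)) = E (\<lambda>k. green r (z - k)) - E (\<lambda>k. green r (z - int x - k))"
      by (simp add: intg)
    then show ?thesis
      using green_rec[OF r0 r(2), of z] green_rec[OF r0 r(2), of "z - int x"]
      unfolding \<kappa>_def by (simp add: right_diff_distrib)
  qed
  have tsum: "(\<Sum>z\<in>?T. tent x z * ((if z = int x then 1 else 0) - (if z = 0 then 1 else 0))) = real x"
  proof -
    have "(\<Sum>z\<in>?T. tent x z * ((if z = int x then 1 else 0) - (if z = 0 then 1 else 0))) =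
      (\<Sum>z\<in>?T. if z = int x then tent x z else 0) - (\<Sum>z\<in>?T. if z = 0 then tent x z else 0)"
      unfolding sum_subtractf[symmetric] by (intro sum.cong) auto
    also have "\<dots> = tent x (int x) - tent x 0" by (simp add: sum.delta)
    also have "\<dots> = real x" by (simp add: tent_def)
    finally show ?thesis .
  qed
  have "real x = (\<Sum>z\<in>?T. tent x z * ((if z = int x then 1 else 0) - (if z = 0 then 1 else 0)))"
    by (rule tsum[symmetric])
  also have "\<dots> = (\<Sum>z\<in>?T. - r * (tent x z * (\<kappa> z - E (\<lambda>k. \<kappa> (z - k)))) - (1 - r) * (tent x z * \<kappa> z))"
  proof (rule sum.cong[OF refl])
    fix z
    have "- r * (tent x z * (\<kappa> z - E (\<lambda>k. \<kappa> (z - k)))) - (1 - r) * (tent x z * \<kappa> z)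
       = tent x z * (r * E (\<lambda>k. \<kappa> (z - k)) - \<kappa> z)" by (simp add: algebra_simps)
    also have "\<dots> = tent x z * ((if z = int x then 1 else 0) - (if z = 0 then 1 else 0))" unfolding rec by simp
    finally show "tent x z * ((if z = int x then 1 else 0) - (if z = 0 then 1 else 0)) =
      - r * (tent x z * (\<kappa> z - E (\<lambda>k. \<kappa> (z - k)))) - (1 - r) * (tent x z * \<kappa> z)" by simp
  qed
  also have "\<dots> = - (r * (\<Sum>z\<in>?T. tent x z * (\<kappa> z - E (\<lambda>k. \<kappa> (z - k))))) - (1 - r) * (\<Sum>z\<in>?T. tent x z * \<kappa> z)"
    by (simp add: sum_subtractf sum_distrib_left sum_negf)
  also have "\<dots> \<le> 8 * K * M x + (1 - r) * ((\<Sum>z\<in>?T. tent x z) * K)"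
  proof -
    have "\<bar>r * (\<Sum>z\<in>?T. tent x z * (\<kappa> z - E (\<lambda>k. \<kappa> (z - k))))\<bar> \<le> 1 * (8 * K * M x)"
      unfolding abs_mult using r tent_bound[OF K, of x] by (intro mult_mono) auto
    moreover have "\<bar>\<Sum>z\<in>?T. tent x z * \<kappa> z\<bar> \<le> (\<Sum>z\<in>?T. tent x z) * K"
      unfolding sum_distrib_right
      by (intro order_trans[OF sum_abs] sum_mono) (auto simp: abs_mult tent_def intro!: mult_mono K)
    then have "\<bar>(1 - r) * (\<Sum>z\<in>?T. tent x z * \<kappa> z)\<bar> \<le> (1 - r) * ((\<Sum>z\<in>?T. tent x z) * K)"
      unfolding abs_mult using r by (intro mult_mono) auto
    ultimately show ?thesis by linarith
  qed
  finally show ?thesis unfolding K_def[symmetric] by (simp add: algebra_simps)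
qed

lemma abar_lower: "f x \<le> 8 * abar (int x)"
proof (cases "x = 0")
  case False
  have "real x \<le> abar (int x) * (8 * M x + (1 - 1) * (\<Sum>z\<in>{0..2 * int x}. tent x z))"
  proof (rule tendsto_lowerbound)
    show "((\<lambda>r. (pot_r r (int x) + pot_r r (- int x)) * (8 * M x + (1 - r) * (\<Sum>z\<in>{0..2 * int x}. tent x z)))
      \<longlongrightarrow> abar (int x) * (8 * M x + (1 - 1) * (\<Sum>z\<in>{0..2 * int x}. tent x z))) (at_left 1)"
      by (intro tendsto_intros pot_r_tendsto)
    show "eventually (\<lambda>r. real x \<le> (pot_r r (int x) + pot_r r (- int x)) * (8 * M x + (1 - r) * (\<Sum>z\<in>{0..2 * int x}. tent x z))) (at_left 1)"
      using eventually_at_left_1 by eventually_elim (simp add: pot_r_lower)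
  qed simp
  then show ?thesis unfolding scale_def using M_pos[of x] False by (simp add: field_simps)
qed (simp add: pot_nonneg)

text \<open>Recurrence: \<open>pot_r r x + pot_r r (- x)\<close> is at most twice
  \<open>green r 0\<close>, and its limits \<open>abar x\<close> are unbounded because
  \<open>f\<close> is.\<close>

lemma green_at_top: "filterlim (\<lambda>r. green r 0) at_top (at_left 1)"
  unfolding filterlim_at_top
proof
  fix Z :: real
  have "eventually (\<lambda>x. 16 * Z + 1 \<le> f x) sequentially" using scale_at_top unfolding filterlim_at_top by blast
  then obtain x where "16 * Z + 1 \<le> f x" by (auto simp: eventually_sequentially)
  then have "2 * Z < abar (int x)" using abar_lower[of x] by (smt (verit))
  then have "eventually (\<lambda>r. 2 * Z < pot_r r (int x) + pot_r r (- int x)) (at_left 1)"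
    by (intro order_tendstoD(1)[OF tendsto_add[OF pot_r_tendsto pot_r_tendsto]])
  then show "eventually (\<lambda>r. Z \<le> green r 0) (at_left 1)"
    using eventually_at_left_1
  proof eventually_elim
    fix r assume "2 * Z < pot_r r (int x) + pot_r r (- int x)" "0 < r \<and> r < 1"
    then show "Z \<le> green r 0"
      using green_nonneg[of r "int x"] green_nonneg[of r "- int x"] by (simp add: pot_r_def)
  qed
qed

section \<open>Hitting identities in the limit of no killing\<close>

definition "potd x = (if x = 0 then 1 else 0) + pot x"

lemma taboo_series:
  assumes "b \<in> B"
  shows "summable (\<lambda>n. enn2real (taboo P B x n b))" "hit 1 B x b = (\<Sum>n. enn2real (taboo P B x n b))"
proof -
  have t: "taboo P B x n b = ennreal (enn2real (taboo P B x n b))" for n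
    using taboo_le_1[of P B x n b] by (metis ennreal_enn2real ennreal_one_less_top order_le_less_trans)
  have h: "hits P 1 B x b = (\<Sum>n. ennreal (enn2real (taboo P B x n b)))" unfolding hits_1 using t by simp
  have "hits P 1 B x b \<noteq> top" using hits_le_1[OF assms, of P x] by (auto simp: top_unique)
  then show s: "summable (\<lambda>n. enn2real (taboo P B x n b))"
    unfolding h by (intro summable_suminf_not_top) auto
  show "hit 1 B x b = (\<Sum>n. enn2real (taboo P B x n b))"
    unfolding h by (subst suminf_ennreal2[OF _ s], simp, subst enn2real_ennreal) (simp_all add: suminf_nonneg[OF s])
qed

lemma hit_tendsto:
  assumes "b \<in> B" shows "((\<lambda>r. hit r B x b) \<longlongrightarrow> hit 1 B x b) (at_left 1)"
proof -
  define u where "u n = enn2real (taboo P B x n b)" for n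
  have u: "taboo P B x n b = ennreal (u n)" "0 \<le> u n" for n
    using taboo_le_1[of P B x n b] unfolding u_def by (metis ennreal_enn2real ennreal_one_less_top order_le_less_trans, simp)
  have s: "summable u" "hit 1 B x b = suminf u" using taboo_series[OF assms, of x] by (simp_all add: u_def[abs_def])
  have "((\<lambda>r. r * (\<Sum>n. r ^ n * u n)) \<longlongrightarrow> 1 * hit 1 B x b) (at_left 1)"
    unfolding s(2) by (intro tendsto_intros abel_limit summable_sums s(1))
  moreover have "eventually (\<lambda>r. r * (\<Sum>n. r ^ n * u n) = hit r B x b) (at_left 1)"
    using eventually_at_left_1
  proof eventually_elim
    fix r :: real assume r: "0 < r \<and> r < 1"
    have sr: "summable (\<lambda>n. r ^ n * u n)"
    proof (rule summable_comparison_test'[OF s(1), of 0])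
      fix n
      have "r ^ n * u n \<le> 1 * u n" using r u(2) by (intro mult_right_mono power_le_one) auto
      then show "norm (r ^ n * u n) \<le> u n" using r u(2) by (simp add: abs_mult)
    qed
    have "hits P r B x b = (\<Sum>n. ennreal (r * (r ^ n * u n)))"
      unfolding hits_def u(1) using r u(2) by (intro suminf_cong) (simp add: ennreal_mult[symmetric] mult.assoc)
    also have "\<dots> = ennreal (\<Sum>n. r * (r ^ n * u n))"
      using r u(2) by (intro suminf_ennreal2 summable_mult sr) auto
    also have "(\<Sum>n. r * (r ^ n * u n)) = r * (\<Sum>n. r ^ n * u n)" by (rule suminf_mult[OF sr])
    finally show "r * (\<Sum>n. r ^ n * u n) = hit r B x b"
      using r u(2) by (simp add: suminf_nonneg sr)
  qed
  ultimately show ?thesis using Lim_transform_eventually by force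
qed

text \<open>By \<open>key\<close>, the missing mass times \<open>green r 0\<close> has a finite
  limit as \<open>r\<close> tends to 1. Since \<open>green r 0\<close> diverges, no mass is missing
  in the limit. The left side of \<open>key\<close> does not depend on \<open>y\<close>, so
  subtracting two instances removes the unknown limit.\<close>

lemma hit_identities:
  assumes B: "finite B" "B \<noteq> {}"
  shows "(\<Sum>b\<in>B. hit 1 B x b) = 1"
    and "y \<in> B \<Longrightarrow> y' \<in> B \<Longrightarrow>
      potd (x - y) - potd (x - y') = (\<Sum>b\<in>B. hit 1 B x b * (pot (b - y) - pot (b - y')))"
proof -
  define pr where "pr r u = (if u = 0 then 1 else 0) + pot_r r u" for r u
  have pr: "((\<lambda>r. pr r u) \<longlongrightarrow> potd u) (at_left 1)" for u
    unfolding pr_def potd_def by (intro tendsto_intros pot_r_tendsto)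
  have key: "green r 0 * (1 - (\<Sum>b\<in>B. hit r B x b)) = pr r (x - y) - (\<Sum>b\<in>B. hit r B x b * pot_r r (b - y))"
    if r: "0 < r \<and> r < 1" and y: "y \<in> B" for r y
  proof -
    have r': "0 \<le> r" "r < 1" using r by auto
    have e: "green r (y - b) = green r 0 - pot_r r (b - y)" for b by (simp add: pot_r_def)
    have "green r (y - x) - (if y = x then 1 else 0) = green r 0 - pr r (x - y)" by (simp add: pr_def pot_r_def)
    moreover have "(\<Sum>b\<in>B. hit r B x b * green r (y - b)) = green r 0 * (\<Sum>b\<in>B. hit r B x b) - (\<Sum>b\<in>B. hit r B x b * pot_r r (b - y))"
      unfolding e by (simp add: right_diff_distrib sum_subtractf sum_distrib_left mult.commute)
    ultimately show ?thesis using hit_green[OF r' B(1) y, of x] by (simp add: right_diff_distrib)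
  qed
  obtain y0 where y0: "y0 \<in> B" using B by auto
  have lim: "((\<lambda>r. pr r (x - y) - (\<Sum>b\<in>B. hit r B x b * pot_r r (b - y))) \<longlongrightarrow>
      potd (x - y) - (\<Sum>b\<in>B. hit 1 B x b * pot (b - y))) (at_left 1)" for y
    by (intro tendsto_intros pr hit_tendsto pot_r_tendsto)
  have "((\<lambda>r. 1 - (\<Sum>b\<in>B. hit r B x b)) \<longlongrightarrow> 0) (at_left 1)"
  proof (rule Lim_transform_eventually)
    show "((\<lambda>r. (pr r (x - y0) - (\<Sum>b\<in>B. hit r B x b * pot_r r (b - y0))) / green r 0) \<longlongrightarrow> 0) (at_left 1)"
      by (rule real_tendsto_divide_at_top[OF lim green_at_top])
    show "eventually (\<lambda>r. (pr r (x - y0) - (\<Sum>b\<in>B. hit r B x b * pot_r r (b - y0))) / green r 0 = 1 - (\<Sum>b\<in>B. hit r B x b)) (at_left 1)"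
      using eventually_at_left_1
    proof eventually_elim
      fix r :: real assume r: "0 < r \<and> r < 1"
      have "green r 0 \<noteq> 0" using green_0_ge[of r] r by auto
      then show "(pr r (x - y0) - (\<Sum>b\<in>B. hit r B x b * pot_r r (b - y0))) / green r 0 = 1 - (\<Sum>b\<in>B. hit r B x b)"
        using key[OF r y0] by (simp add: field_simps)
    qed
  qed
  moreover have "((\<lambda>r. 1 - (\<Sum>b\<in>B. hit r B x b)) \<longlongrightarrow> 1 - (\<Sum>b\<in>B. hit 1 B x b)) (at_left 1)"
    by (intro tendsto_intros hit_tendsto)
  ultimately have "1 - (\<Sum>b\<in>B. hit 1 B x b) = 0"
    by (intro tendsto_unique[of "at_left (1::real)"]) auto
  then show "(\<Sum>b\<in>B. hit 1 B x b) = 1" by simp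
  assume y: "y \<in> B" "y' \<in> B"
  have "potd (x - y) - (\<Sum>b\<in>B. hit 1 B x b * pot (b - y)) = potd (x - y') - (\<Sum>b\<in>B. hit 1 B x b * pot (b - y'))"
  proof (rule tendsto_unique[of "at_left (1::real)"])
    show "((\<lambda>r. pr r (x - y) - (\<Sum>b\<in>B. hit r B x b * pot_r r (b - y))) \<longlongrightarrow>
      potd (x - y) - (\<Sum>b\<in>B. hit 1 B x b * pot (b - y))) (at_left 1)" by (rule lim)
    show "((\<lambda>r. pr r (x - y) - (\<Sum>b\<in>B. hit r B x b * pot_r r (b - y))) \<longlongrightarrow>
      potd (x - y') - (\<Sum>b\<in>B. hit 1 B x b * pot (b - y'))) (at_left 1)"
    proof (rule Lim_transform_eventually[OF lim[of y']])
      show "eventually (\<lambda>r. pr r (x - y') - (\<Sum>b\<in>B. hit r B x b * pot_r r (b - y')) = 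
          pr r (x - y) - (\<Sum>b\<in>B. hit r B x b * pot_r r (b - y))) (at_left 1)"
        using eventually_at_left_1 by eventually_elim (simp only: key[symmetric] y)
    qed
  qed simp
  then show "potd (x - y) - potd (x - y') = (\<Sum>b\<in>B. hit 1 B x b * (pot (b - y) - pot (b - y')))"
    by (simp add: right_diff_distrib sum_subtractf)
qed

lemma hit_two_points:
  assumes "y \<noteq> 0"
  shows "hit 1 {0, y} x y * abar y = potd x + pot (- y) - potd (x - y)"
proof -
  have 1: "hit 1 {0, y} x 0 = 1 - hit 1 {0, y} x y"
    using hit_identities(1)[of "{0, y}" x] assms by simp
  have 2: "potd x - potd (x - y) = hit 1 {0, y} x 0 * (- pot (- y)) + hit 1 {0, y} x y * pot y"
    using hit_identities(2)[of "{0, y}" 0 y x] assms by simp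
  show ?thesis using 2 unfolding 1 by (simp add: algebra_simps)
qed

lemma abar_nonneg: "0 \<le> abar x" using pot_nonneg[of x] pot_nonneg[of "- x"] by simp

lemma abar_pos: assumes "x \<noteq> 0" shows "0 < abar x"
proof -
  have "0 < f (nat \<bar>x\<bar>)" using assms by (intro scale_pos) simp
  then have "0 < abar \<bar>x\<bar>" using abar_lower[of "nat \<bar>x\<bar>"] by (smt (verit) int_nat_eq)
  then show ?thesis by (cases "0 \<le> x") (simp_all add: add.commute)
qed

lemma hit_1_ennreal: "b \<in> B \<Longrightarrow> hits P 1 B x b = ennreal (hit 1 B x b)"
  using hits_le_1[of b B P x] by (metis ennreal_enn2real ennreal_one_less_top order_le_less_trans)

lemma hit_1_le: "b \<in> B \<Longrightarrow> hit 1 B x b \<le> 1"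
  using hits_le_1[of b B P x] by (simp add: enn2real_leI)

text \<open>For \<open>z\<close> outside the killing set, finiteness at \<open>r = 1\<close> is not
  known beforehand. The limit is therefore taken in finite partial sums, and the nonnegative last
  term of \<open>visits_r\<close> is dropped.\<close>

lemma visits_le:
  assumes z: "z \<noteq> 0"
  shows "hits P 1 {0} x z + (if z = x then 1 else 0) \<le> ennreal (potd x + pot (- z) - pot (x - z))"
proof -
  define \<delta> :: real where "\<delta> = (if z = x then 1 else 0)"
  define u where "u n = enn2real (taboo P {0} x n z)" for n
  have u: "taboo P {0} x n z = ennreal (u n)" "0 \<le> u n" for n
    using taboo_le_1[of P "{0}" x n z] unfolding u_def by (metis ennreal_enn2real ennreal_one_less_top order_le_less_trans, simp)
  define V where "V = potd x + pot (- z) - pot (x - z)"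
  have fin: "(\<Sum>n<N. u n) + \<delta> \<le> V" for N
  proof (rule tendsto_le[of "at_left (1::real)"])
    show "((\<lambda>r. ((if x = 0 then 1 else 0) + pot_r r x) + pot_r r (- z) - pot_r r (x - z)) \<longlongrightarrow> V) (at_left 1)"
      unfolding V_def potd_def by (intro tendsto_intros pot_r_tendsto)
    have "((\<lambda>r. (\<Sum>n<N. r ^ Suc n * u n) + \<delta>) \<longlongrightarrow> (\<Sum>n<N. 1 ^ Suc n * u n) + \<delta>) (at_left 1)"
      by (intro tendsto_intros)
    then show "((\<lambda>r. (\<Sum>n<N. r ^ Suc n * u n) + \<delta>) \<longlongrightarrow> (\<Sum>n<N. u n) + \<delta>) (at_left 1)" by simp
    show "eventually (\<lambda>r. (\<Sum>n<N. r ^ Suc n * u n) + \<delta> \<le> ((if x = 0 then 1 else 0) + pot_r r x) + pot_r r (- z) - pot_r r (x - z)) (at_left 1)"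
      using eventually_at_left_1
    proof eventually_elim
      fix r :: real assume "0 < r \<and> r < 1"
      then have r: "0 \<le> r" "r < 1" by auto
      have "ennreal (\<Sum>n<N. r ^ Suc n * u n) = (\<Sum>n<N. ennreal (r ^ Suc n) * taboo P {0} x n z)"
        using r u(2) by (subst sum_ennreal[symmetric]) (auto simp: u(1) ennreal_mult simp del: power_Suc)
      also have "\<dots> \<le> hits P r {0} x z" unfolding hits_def by (intro sum_le_suminf) auto
      also have "\<dots> = ennreal (hit r {0} x z)" by (rule ennreal_hit[OF r, symmetric])
      finally have "(\<Sum>n<N. r ^ Suc n * u n) \<le> hit r {0} x z" by (simp del: power_Suc)
      moreover have "0 \<le> ((if x = 0 then 1 else 0) + pot_r r x) * pot_r r (- z) / green r 0"
        using pot_r_nonneg[OF r] green_nonneg[OF r] by (intro divide_nonneg_nonneg mult_nonneg_nonneg add_nonneg_nonneg) auto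
      ultimately show "(\<Sum>n<N. r ^ Suc n * u n) + \<delta> \<le> ((if x = 0 then 1 else 0) + pot_r r x) + pot_r r (- z) - pot_r r (x - z)"
        using visits_r[OF r z, of x] unfolding \<delta>_def by linarith
    qed
  qed simp
  have \<delta>: "0 \<le> \<delta>" "\<delta> \<le> V" using fin[of 0] by (auto simp: \<delta>_def)
  have "hits P 1 {0} x z \<le> ennreal (V - \<delta>)"
    unfolding hits_1 u(1)
  proof (rule suminf_le_const)
    fix N
    have "(\<Sum>n<N. ennreal (u n)) = ennreal (\<Sum>n<N. u n)" using u(2) by simp
    also have "\<dots> \<le> ennreal (V - \<delta>)" using fin[of N] by (intro ennreal_leI) simp
    finally show "(\<Sum>n<N. ennreal (u n)) \<le> ennreal (V - \<delta>)" .
  qed simp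
  then have "hits P 1 {0} x z + ennreal \<delta> \<le> ennreal (V - \<delta>) + ennreal \<delta>" by (rule add_right_mono)
  also have "\<dots> = ennreal V" using \<delta> by (subst ennreal_plus[symmetric]) auto
  finally show ?thesis unfolding V_def \<delta>_def by (cases "z = x") simp_all
qed

text \<open>The increments of \<open>scale\<close> turn the crossing sum into a double sum against \<open>pos_tail_exp\<close>.\<close>

lemma convolution_count:
  "(\<Sum>j=1..<k. f (min j w) * f (min (k - j) R)) =
     (\<Sum>i<w. \<Sum>l<R. (f (Suc i) - f i) * (f (Suc l) - f l) * real (k - Suc (i + l)))"
proof -
  define d where "d i = f (Suc i) - f i" for i
  have tele: "f (min j w) = (\<Sum>i<w. if i < j then d i else 0)" for j w
  proof -
    have "(\<Sum>i<w. if i < j then d i else 0) = (\<Sum>i\<in>{i\<in>{..<w}. i < j}. d i)" by (rule sum.inter_filter[symmetric]) simp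
    also have "{i\<in>{..<w}. i < j} = {..<min j w}" by auto
    also have "(\<Sum>i<min j w. d i) = f (min j w)" unfolding d_def by (subst sum_lessThan_telescope) simp
    finally show ?thesis by simp
  qed
  \<comment> \<open>The indices with both increments present are \<open>i < j < k - l\<close>;
    truncated subtraction returns 0 when there are none.\<close>
  have count: "(\<Sum>j=1..<k. (if i < j then d i else 0) * (if l < k - j then d l else 0)) = d i * d l * real (k - Suc (i + l))" for i l
  proof -
    have "(\<Sum>j=1..<k. (if i < j then d i else 0) * (if l < k - j then d l else 0)) = (\<Sum>j\<in>{1..<k}. if i < j \<and> l < k - j then d i * d l else 0)"
      by (intro sum.cong) auto
    also have "\<dots> = (\<Sum>j\<in>{j\<in>{1..<k}. i < j \<and> l < k - j}. d i * d l)" by (rule sum.inter_filter[symmetric]) simp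
    also have "{j\<in>{1..<k}. i < j \<and> l < k - j} = {Suc i..<k - l}" by auto
    finally show ?thesis by (simp add: mult.commute add.commute)
  qed
  have "(\<Sum>j=1..<k. f (min j w) * f (min (k - j) R)) = (\<Sum>j=1..<k. \<Sum>i<w. \<Sum>l<R. (if i < j then d i else 0) * (if l < k - j then d l else 0))"
    unfolding tele sum_product ..
  also have "\<dots> = (\<Sum>i<w. \<Sum>l<R. \<Sum>j=1..<k. (if i < j then d i else 0) * (if l < k - j then d l else 0))"
    by (rule trans[OF sum.swap sum.cong[OF refl sum.swap]])
  finally show ?thesis unfolding count unfolding d_def .
qed

definition "conv w R = (\<Sum>i<w. \<Sum>l<R. (f (Suc i) - f i) * (f (Suc l) - f l) * pe (Suc (i + l)))"

lemma expectation_convolution: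
  "(\<integral>\<^sup>+k. ennreal (\<Sum>j=1..<nat k. f (min j w) * f (min (nat k - j) R)) \<partial>measure_pmf P) = ennreal (conv w R)"
proof -
  have nn: "0 \<le> f (Suc i) - f i" for i using scale_mono[of i "Suc i"] by simp
  have "(\<integral>\<^sup>+k. ennreal (\<Sum>j=1..<nat k. f (min j w) * f (min (nat k - j) R)) \<partial>measure_pmf P)
    = ennreal (E (\<lambda>k. \<Sum>i<w. \<Sum>l<R. (f (Suc i) - f i) * (f (Suc l) - f l) * real (nat k - Suc (i + l))))"
    unfolding convolution_count
    by (intro nn_integral_eq_integral AE_I2 sum_nonneg mult_nonneg_nonneg nn Bochner_Integration.integrable_sum
        integrable_mult_right integrable_pos_tail) auto
  also have "E (\<lambda>k. \<Sum>i<w. \<Sum>l<R. (f (Suc i) - f i) * (f (Suc l) - f l) * real (nat k - Suc (i + l))) = conv w R"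
    unfolding conv_def pos_tail_exp_def
    by (simp add: Bochner_Integration.integral_sum Bochner_Integration.integrable_sum integrable_pos_tail)
  finally show ?thesis .
qed

text \<open>As \<open>pe\<close> decreases, it is evaluated at the larger of the two indices; the
  sum of increments over the smaller one is a value of \<open>f\<close>, and
  \<open>scale_pos_tail_le\<close> converts it into \<open>Mp / M\<close>. For
  \<open>i \<ge> R\<close> that value is only \<open>f R\<close>; there the increments of
  \<open>f\<close> are at most \<open>1 / M R\<close>, and the tails add up to
  \<open>Mp\<close>.\<close>

lemma conv_le:
  "conv w R \<le> 2 * (\<Sum>l<R. (f (Suc l) - f l) * (Mp (Suc l) / M (Suc l))) + 2 * f R * (Mp (max w R) / M R)"
proof (cases "R = 0")
  case False
  define d where "d i = f (Suc i) - f i" for i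
  have d0: "0 \<le> d i" for i using scale_mono[of i "Suc i"] by (simp add: d_def)
  have sd: "(\<Sum>i<n. d i) = f n" for n unfolding d_def by (subst sum_lessThan_telescope) simp
  define \<rho> where "\<rho> k = Mp k / M k" for k
  have MR: "0 < M R" using False by (intro M_pos) auto
  have b: "d i * d l * pe (Suc (i + l)) \<le> (if i \<le> l then d i * d l * pe (Suc l) else 0) + (if l < i then d i * d l * pe (Suc i) else 0)" for i l
    using d0 by (auto intro!: mult_left_mono tail_antimono)
  have "conv w R \<le> (\<Sum>i<w. \<Sum>l<R. (if i \<le> l then d i * d l * pe (Suc l) else 0) + (if l < i then d i * d l * pe (Suc i) else 0))"
    unfolding conv_def d_def[symmetric] by (intro sum_mono b)
  also have "\<dots> = (\<Sum>l<R. \<Sum>i<w. if i \<le> l then d i * d l * pe (Suc l) else 0) + (\<Sum>i<w. \<Sum>l<R. if l < i then d i * d l * pe (Suc i) else 0)"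
    unfolding sum.distrib by (subst sum.swap) simp
  also have "(\<Sum>l<R. \<Sum>i<w. if i \<le> l then d i * d l * pe (Suc l) else 0) \<le> (\<Sum>l<R. d l * \<rho> (Suc l))"
  proof (rule sum_mono)
    fix l
    have "(\<Sum>i<w. if i \<le> l then d i * d l * pe (Suc l) else 0) = (\<Sum>i\<in>{i\<in>{..<w}. i \<le> l}. d i * d l * pe (Suc l))"
      by (rule sum.inter_filter[symmetric]) simp
    also have "\<dots> \<le> (\<Sum>i<Suc l. d i * d l * pe (Suc l))"
      using d0 tail_nonneg by (intro sum_mono2) auto
    also have "\<dots> = d l * (f (Suc l) * pe (Suc l))" by (simp only: sum_distrib_right[symmetric] sd) simp
    also have "\<dots> \<le> d l * \<rho> (Suc l)" unfolding \<rho>_def by (intro mult_left_mono scale_pos_tail_le d0)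
    finally show "(\<Sum>i<w. if i \<le> l then d i * d l * pe (Suc l) else 0) \<le> d l * \<rho> (Suc l)" .
  qed
  also have "(\<Sum>i<w. \<Sum>l<R. if l < i then d i * d l * pe (Suc i) else 0) \<le> (\<Sum>i<w. (if i < R then d i * \<rho> (Suc i) else 0) + (if i < R then 0 else f R * pe (Suc i) / M R))"
  proof (rule sum_mono)
    fix i
    have "(\<Sum>l<R. if l < i then d i * d l * pe (Suc i) else 0) = (\<Sum>l\<in>{l\<in>{..<R}. l < i}. d i * d l * pe (Suc i))"
      by (rule sum.inter_filter[symmetric]) simp
    also have "{l\<in>{..<R}. l < i} = {..<min i R}" by auto
    also have "(\<Sum>l<min i R. d i * d l * pe (Suc i)) = d i * pe (Suc i) * f (min i R)"
      unfolding sd[symmetric] by (simp add: sum_distrib_left mult_ac)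
    also have "\<dots> \<le> (if i < R then d i * \<rho> (Suc i) else 0) + (if i < R then 0 else f R * pe (Suc i) / M R)"
    proof (cases "i < R")
      case True
      have "d i * pe (Suc i) * f (min i R) \<le> d i * pe (Suc i) * f (Suc i)"
        using d0 tail_nonneg True by (intro mult_left_mono scale_mono) auto
      also have "\<dots> = d i * (f (Suc i) * pe (Suc i))" by simp
      also have "\<dots> \<le> d i * \<rho> (Suc i)" unfolding \<rho>_def by (intro mult_left_mono scale_pos_tail_le d0)
      finally show ?thesis using True by simp
    next
      case i: False
      have "d i \<le> 1 / M (Suc i)" unfolding d_def by (rule scale_diff_le)
      also have "\<dots> \<le> 1 / M R" using MR i M_mono(1)[of R "Suc i"] by (intro divide_left_mono) auto
      finally have "d i * (pe (Suc i) * f R) \<le> 1 / M R * (pe (Suc i) * f R)"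
        using tail_nonneg scale_nonneg by (intro mult_right_mono) auto
      moreover have "min i R = R" using i by simp
      ultimately show ?thesis using i by (simp add: mult_ac)
    qed
    finally show "(\<Sum>l<R. if l < i then d i * d l * pe (Suc i) else 0) \<le> (if i < R then d i * \<rho> (Suc i) else 0) + (if i < R then 0 else f R * pe (Suc i) / M R)" .
  qed
  also have "\<dots> = (\<Sum>i\<in>{i\<in>{..<w}. i < R}. d i * \<rho> (Suc i)) + (\<Sum>i\<in>{i\<in>{..<w}. \<not> i < R}. f R * pe (Suc i) / M R)"
    unfolding sum.distrib by (simp add: sum.inter_filter[symmetric] if_not_P cong: if_cong) (simp add: sum.If_cases Int_def)
  also have "(\<Sum>i\<in>{i\<in>{..<w}. i < R}. d i * \<rho> (Suc i)) \<le> (\<Sum>i<R. d i * \<rho> (Suc i))"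
    using d0 M_nonneg by (intro sum_mono2) (auto simp: \<rho>_def)
  also have "(\<Sum>i\<in>{i\<in>{..<w}. \<not> i < R}. f R * pe (Suc i) / M R) \<le> 2 * f R * (Mp (max w R) / M R)"
  proof -
    have "(\<Sum>i\<in>{i\<in>{..<w}. \<not> i < R}. pe (Suc i)) \<le> (\<Sum>i<max w R. pe (Suc i))"
      using tail_nonneg by (intro sum_mono2) auto
    also have "\<dots> \<le> Mp (Suc (max w R))"
      unfolding pos_dtail_def sum.lessThan_Suc_shift using tail_nonneg by simp
    also have "\<dots> \<le> 2 * Mp (max w R)" using False by (intro M_Suc_le) auto
    finally have "f R * (\<Sum>i\<in>{i\<in>{..<w}. \<not> i < R}. pe (Suc i)) / M R \<le> f R * (2 * Mp (max w R)) / M R"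
      using MR scale_nonneg by (intro divide_right_mono mult_left_mono) auto
    then show ?thesis by (simp add: sum_distrib_left sum_divide_distrib mult_ac)
  qed
  finally show ?thesis unfolding d_def \<rho>_def by simp
qed (simp add: conv_def)

end

section \<open>Upward crossings\<close>

lemma average_le:
  fixes a :: real
  assumes "0 < W" "(W * b - X) / a \<le> W * d" shows "b / a \<le> d + X / (W * a)"
proof -
  have "W * (b / a) \<le> W * (d + X / (W * a))"
    using assms by (simp add: distrib_left diff_divide_distrib)
  then show ?thesis using assms(1) by (rule mult_left_le_imp_le)
qed

lemma average_ge:
  fixes a :: real
  assumes "0 < W" "W * d \<le> (W * b + X) / a" shows "d \<le> b / a + X / (W * a)"
proof -
  have "W * d \<le> W * (b / a + X / (W * a))"
    using assms by (simp add: distrib_left add_divide_distrib)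
  then show ?thesis using assms(1) by (rule mult_left_le_imp_le)
qed

context centred_law begin

lemma hit_two_points_le:
  assumes "1 \<le> z" "1 \<le> R" "z \<noteq> int R"
  shows "hit 1 {0, int R} z (int R) * abar (int R) \<le> abar z"
proof -
  have "pot (- int R) \<le> pot (z - int R) + pot (- z)" using pot_subadd[of "z - int R" "- z"] by simp
  then show ?thesis using hit_two_points[of "int R" z] assms by (simp add: potd_def)
qed

text \<open>Two uses of subadditivity in \<open>visits_le\<close>. The bound in \<open>z\<close>
  makes visits near 0 rare, the bound in \<open>x\<close> caps the visits far below the
  start.\<close>

lemma visits_min:
  assumes x: "x < 0" and z: "z < 0"
  shows "(indicator {x} z + hits P 1 {0..} x z * indicator (- {0..}) z :: ennreal) \<le> ennreal (min (abar x) (abar z))"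
proof -
  have "(indicator {x} z + hits P 1 {0..} x z * indicator (- {0..}) z :: ennreal) = hits P 1 {0..} x z + (if z = x then 1 else 0)"
    using z by (auto simp: indicator_def add.commute)
  also have "\<dots> \<le> hits P 1 {0} x z + (if z = x then 1 else 0)"
    by (intro add_right_mono hits_antimono) auto
  also have "\<dots> \<le> ennreal (potd x + pot (- z) - pot (x - z))" using z by (intro visits_le) simp
  also have "\<dots> \<le> ennreal (min (abar x) (abar z))"
  proof (rule ennreal_leI)
    have "pot (- z) \<le> pot (x - z) + pot (- x)" using pot_subadd[of "x - z" "- x"] by simp
    moreover have "pot x \<le> pot (x - z) + pot z" using pot_subadd[of "x - z" z] by simp
    ultimately show "potd x + pot (- z) - pot (x - z) \<le> min (abar x) (abar z)"
      using x by (simp add: potd_def)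
  qed
  finally show ?thesis .
qed

text \<open>The path is cut at the jump of size \<open>k\<close> from \<open>- j\<close> into the
  nonnegative integers: visits to \<open>- j\<close> contribute at most
  \<open>C * f (min j w)\<close>, and from \<open>k - j\<close> the point \<open>R\<close> is
  reached before 0 with probability at most \<open>8 * C * f (min (k - j) R) / f R\<close>.\<close>

lemma crossing_bound:
  assumes C: "0 < C" "\<And>x. 1 \<le> x \<Longrightarrow> abar (int x) \<le> C * f x" and w: "1 \<le> w" and R: "1 \<le> R"
  shows "hit 1 {0, int R} (- int w) (int R) \<le> 8 * C\<^sup>2 / f R * conv w R"
proof -
  define x where "x = - int w"
  define K where "K = {0::int..}"
  define F where "F z = C * f (min (nat (- z)) w)" for z
  define G where "G y = 8 * C * f (min (nat y) R) / f R" for y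
  have fR: "0 < f R" using R by (intro scale_pos) simp
  then have c0: "0 \<le> 8 * C\<^sup>2 / f R" by simp
  have F0: "0 \<le> F z" for z using C scale_nonneg by (simp add: F_def)
  have G0: "0 \<le> G z" for z using C fR scale_nonneg by (simp add: G_def)
  have x: "x < 0" using w by (simp add: x_def)
  have aR: "0 < abar (int R)" using R by (intro abar_pos) simp
  \<comment> \<open>The upper and lower bounds for \<open>abar (int R)\<close> must be compatible.
    This makes \<open>G\<close> at least 1 from \<open>R\<close> on, where only the trivial bound
    for a probability is used.\<close>
  have C8: "1 \<le> 8 * C"
  proof -
    have "f R \<le> 8 * abar (int R)" by (rule abar_lower)
    also have "\<dots> \<le> 8 * (C * f R)" by (intro mult_left_mono C R) simp
    finally have "1 * f R \<le> (8 * C) * f R" by simp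
    then show ?thesis using fR by (rule mult_right_le_imp_le)
  qed
  have boundG: "hits P 1 {0, int R} z (int R) \<le> ennreal (G z)" if z: "1 \<le> z" "z \<noteq> int R" for z
  proof -
    have "hit 1 {0, int R} z (int R) \<le> G z"
    proof (cases "z \<le> int R")
      case True
      then have m: "min (nat z) R = nat z" by simp
      have "hit 1 {0, int R} z (int R) \<le> abar z / abar (int R)"
        using hit_two_points_le[OF z(1) R z(2)] aR by (simp add: field_simps)
      also have "\<dots> \<le> (C * f (nat z)) / (f R / 8)"
        using C(2)[of "nat z"] z abar_lower[of R] fR abar_nonneg C(1) scale_nonneg by (intro frac_le) auto
      finally show ?thesis by (simp add: G_def m mult_ac)
    next
      case False
      then have "G z = 8 * C" using fR by (simp add: G_def)
      then show ?thesis using hit_1_le[of "int R" "{0, int R}" z] C8 by simp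
    qed
    then show ?thesis by (subst hit_1_ennreal) (auto intro: ennreal_leI)
  qed
  have boundF: "(indicator {x} z + hits P 1 K x z * indicator (- K) z :: ennreal) \<le> ennreal (F z) * indicator {..-1} z" for z
  proof (cases "z < 0")
    case True
    have "abar x = abar (int w)" by (simp add: x_def add.commute)
    moreover have "abar (int (nat (- z))) \<le> C * f (nat (- z))" using True by (intro C) simp
    ultimately have "abar x \<le> C * f w" "abar z \<le> C * f (nat (- z))"
      using C(2)[OF w] True by (simp_all add: add.commute)
    then have "min (abar x) (abar z) \<le> F z" unfolding F_def by (auto simp: min_def)
    then show ?thesis using visits_min[OF x True] True unfolding K_def
      by (auto intro: order_trans ennreal_leI)
  next
    case False
    then show ?thesis using x by (simp add: K_def indicator_def)
  qed
  have "hits P 1 {0, int R} x (int R) = hits P 1 K x (int R) +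
     (\<integral>\<^sup>+z. hits P 1 K x z * indicator (K - {0, int R}) z * hits P 1 {0, int R} z (int R) \<partial>count_space UNIV)"
    by (rule hits_decomp) (auto simp: K_def)
  also have "hits P 1 K x (int R) = (\<integral>\<^sup>+z. hits P 1 K x (int R) * indicator {int R} z \<partial>count_space UNIV)"
    by (subst nn_integral_cmult_indicator) auto
  also have "\<dots> + (\<integral>\<^sup>+z. hits P 1 K x z * indicator (K - {0, int R}) z * hits P 1 {0, int R} z (int R) \<partial>count_space UNIV)
    = (\<integral>\<^sup>+z. hits P 1 K x (int R) * indicator {int R} z + hits P 1 K x z * indicator (K - {0, int R}) z * hits P 1 {0, int R} z (int R) \<partial>count_space UNIV)"
    by (rule nn_integral_add[symmetric]) auto
  also have "\<dots> \<le> (\<integral>\<^sup>+y. hits P 1 K x y * (indicator {1..} y * ennreal (G y)) \<partial>count_space UNIV)"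
  proof (rule nn_integral_mono)
    fix z
    consider "z = int R" | "1 \<le> z" "z \<noteq> int R" | "z \<le> 0" by linarith
    then show "hits P 1 K x (int R) * indicator {int R} z + hits P 1 K x z * indicator (K - {0, int R}) z * hits P 1 {0, int R} z (int R)
       \<le> hits P 1 K x z * (indicator {1..} z * ennreal (G z))"
    proof cases
      case 1
      have "G z = 8 * C" using 1 fR by (simp add: G_def)
      then have "1 \<le> ennreal (G z)" using C8 by simp
      then have "hits P 1 K x z * 1 \<le> hits P 1 K x z * ennreal (G z)" by (intro mult_left_mono) auto
      then show ?thesis using 1 R by simp
    next
      case 2
      then show ?thesis using boundG[OF 2] by (auto simp: indicator_def K_def intro!: mult_left_mono)
    next
      case 3
      then show ?thesis using R by (auto simp: indicator_def K_def)
    qed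
  qed
  also have "\<dots> \<le> (\<integral>\<^sup>+y. (\<integral>\<^sup>+z. ennreal (F z) * indicator {..-1} z * ennreal (pmf P (y - z)) \<partial>count_space UNIV) * (indicator {1..} y * ennreal (G y)) \<partial>count_space UNIV)"
  proof (intro nn_integral_mono mult_right_mono)
    fix y
    show "hits P 1 K x y \<le> (\<integral>\<^sup>+z. ennreal (F z) * indicator {..-1} z * ennreal (pmf P (y - z)) \<partial>count_space UNIV)"
      by (subst hits_Suc) (intro nn_integral_mono mult_right_mono boundF, simp)
  qed simp
  also have "\<dots> = (\<integral>\<^sup>+y. \<integral>\<^sup>+z. ennreal (F z) * indicator {..-1} z * ennreal (pmf P (y - z)) * (indicator {1..} y * ennreal (G y)) \<partial>count_space UNIV \<partial>count_space UNIV)"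
    by (intro nn_integral_cong nn_integral_multc[symmetric]) simp
  also have "\<dots> = (\<integral>\<^sup>+z. \<integral>\<^sup>+y. ennreal (F z) * indicator {..-1} z * ennreal (pmf P (y - z)) * (indicator {1..} y * ennreal (G y)) \<partial>count_space UNIV \<partial>count_space UNIV)"
    by (rule nn_integral_count_space_swap)
  \<comment> \<open>The substitution \<open>y = k + z\<close> makes the jump size a variable; after
    the next exchange of sums it is the outermost one and can be averaged under
    \<open>P\<close>.\<close>
  also have "\<dots> = (\<integral>\<^sup>+z. \<integral>\<^sup>+k. ennreal (F z) * indicator {..-1} z * ennreal (pmf P k) * (indicator {1..} (k + z) * ennreal (G (k + z))) \<partial>count_space UNIV \<partial>count_space UNIV)"
  proof (rule nn_integral_cong)
    fix z
    show "(\<integral>\<^sup>+y. ennreal (F z) * indicator {..-1} z * ennreal (pmf P (y - z)) * (indicator {1..} y * ennreal (G y)) \<partial>count_space UNIV)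
      = (\<integral>\<^sup>+k. ennreal (F z) * indicator {..-1} z * ennreal (pmf P k) * (indicator {1..} (k + z) * ennreal (G (k + z))) \<partial>count_space UNIV)"
      using nn_integral_count_space_shift[of "\<lambda>k. ennreal (F z) * indicator {..-1} z * ennreal (pmf P k) * (indicator {1..} (k + z) * ennreal (G (k + z)))" z]
      by simp
  qed
  also have "\<dots> = (\<integral>\<^sup>+k. \<integral>\<^sup>+z. ennreal (F z) * indicator {..-1} z * ennreal (pmf P k) * (indicator {1..} (k + z) * ennreal (G (k + z))) \<partial>count_space UNIV \<partial>count_space UNIV)"
    by (rule nn_integral_count_space_swap)
  also have "\<dots> = (\<integral>\<^sup>+k. ennreal (pmf P k) * ennreal (8 * C\<^sup>2 / f R * (\<Sum>j=1..<nat k. f (min j w) * f (min (nat k - j) R))) \<partial>count_space UNIV)"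
  proof (rule nn_integral_cong)
    fix k
    have "(\<integral>\<^sup>+z. ennreal (F z) * indicator {..-1} z * ennreal (pmf P k) * (indicator {1..} (k + z) * ennreal (G (k + z))) \<partial>count_space UNIV)
       = (\<Sum>z\<in>{1-k..-1}. ennreal (F z) * indicator {..-1} z * ennreal (pmf P k) * (indicator {1..} (k + z) * ennreal (G (k + z))))"
      by (rule nn_integral_count_space') (auto simp: indicator_def)
    also have "\<dots> = (\<Sum>z\<in>{1-k..-1}. ennreal (pmf P k) * ennreal (F z * G (k + z)))"
      by (intro sum.cong refl) (auto simp: indicator_def ennreal_mult F0 G0 mult_ac)
    also have "\<dots> = ennreal (pmf P k) * ennreal (\<Sum>z\<in>{1-k..-1}. F z * G (k + z))"
      unfolding sum_distrib_left[symmetric] using F0 G0 by (simp add: sum_ennreal)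
    also have "(\<Sum>z\<in>{1-k..-1}. F z * G (k + z)) = (\<Sum>j=1..<nat k. F (- int j) * G (k - int j))"
      by (rule sum.reindex_bij_witness[of _ "\<lambda>j. - int j" "\<lambda>z. nat (- z)"]) auto
    also have "\<dots> = (\<Sum>j=1..<nat k. 8 * C\<^sup>2 / f R * (f (min j w) * f (min (nat k - j) R)))"
    proof (intro sum.cong refl)
      fix j
      have "nat (k - int j) = nat k - j" by linarith
      then show "F (- int j) * G (k - int j) = 8 * C\<^sup>2 / f R * (f (min j w) * f (min (nat k - j) R))"
        by (simp add: F_def G_def power2_eq_square)
    qed
    finally show "(\<integral>\<^sup>+z. ennreal (F z) * indicator {..-1} z * ennreal (pmf P k) * (indicator {1..} (k + z) * ennreal (G (k + z))) \<partial>count_space UNIV)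
      = ennreal (pmf P k) * ennreal (8 * C\<^sup>2 / f R * (\<Sum>j=1..<nat k. f (min j w) * f (min (nat k - j) R)))"
      by (simp add: sum_distrib_left)
  qed
  also have "\<dots> = (\<integral>\<^sup>+k. ennreal (8 * C\<^sup>2 / f R) * ennreal (\<Sum>j=1..<nat k. f (min j w) * f (min (nat k - j) R)) \<partial>measure_pmf P)"
    unfolding nn_integral_measure_pmf by (simp only: ennreal_mult'[OF c0])
  also have "\<dots> = ennreal (8 * C\<^sup>2 / f R) * ennreal (conv w R)"
    unfolding expectation_convolution[symmetric] by (rule nn_integral_cmult) simp
  also have "\<dots> = ennreal (8 * C\<^sup>2 / f R * conv w R)" by (simp only: ennreal_mult'[OF c0])
  finally have "hits P 1 {0, int R} x (int R) \<le> ennreal (8 * C\<^sup>2 / f R * conv w R)" .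
  moreover have "0 \<le> conv w R"
    unfolding conv_def using scale_mono[of _ "Suc _"] tail_nonneg by (intro sum_nonneg mult_nonneg_nonneg) auto
  ultimately show ?thesis unfolding x_def using fR by (intro enn2real_leI) auto
qed

text \<open>The probability of reaching \<open>R\<close> from \<open>-w\<close> before \<open>0\<close>, see \<open>hit_two_points\<close>.\<close>

definition "up R w = (pot (- int w) + pot (- int R) - pot (- int w - int R)) / abar (int R)"

lemma up_eq_hit:
  assumes "1 \<le> R" "1 \<le> w" shows "up R w = hit 1 {0, int R} (- int w) (int R)"
  using hit_two_points[of "int R" "- int w"] abar_pos[of "int R"] assms
  by (simp add: up_def potd_def field_simps)

lemma up_0 [simp]: "up R 0 = 0" by (simp add: up_def)

lemma up_nonneg: "1 \<le> R \<Longrightarrow> 0 \<le> up R w"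
  by (cases "w = 0") (simp_all add: up_eq_hit)

lemma up_le_1: "1 \<le> R \<Longrightarrow> up R w \<le> 1"
  by (cases "w = 0") (simp_all add: up_eq_hit hit_1_le)

lemma hit_insert:
  assumes "B \<subseteq> B'" "B' - B = {z}" "y \<in> B"
  shows "hit 1 B x y = hit 1 B' x y + hit 1 B' x z * hit 1 B z y"
proof -
  have fin: "hits P 1 K u v < top" if "v \<in> K" for K u v
    using hits_le_1[OF that, of P u] by (rule order_le_less_trans) simp
  have "hits P 1 B x y = hits P 1 B' x y + hits P 1 B' x z * hits P 1 B z y"
    using hits_decomp[OF assms(1), of 1 P x y] assms(2) by (simp add: nn_integral_count_space_finite_indicator)
  moreover have "hits P 1 B' x y < top" "hits P 1 B' x z < top" "hits P 1 B z y < top"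
    using assms by (auto intro: fin)
  ultimately show ?thesis by (simp add: enn2real_plus enn2real_mult ennreal_mult_less_top)
qed

text \<open>After translation, \<open>1 - up w j\<close> is the probability of hitting
  \<open>- w\<close> before 0 from \<open>- (w + j)\<close>, and from \<open>- w\<close> the walk
  reaches \<open>R\<close> before 0 with probability \<open>up R w\<close>. Paths that meet
  \<open>R\<close> on the way to \<open>- w\<close> are counted in \<open>up R (w + j)\<close>
  already.\<close>

lemma up_chain:
  assumes R: "1 \<le> R" and w: "1 \<le> w"
  shows "(1 - up w j) * up R w \<le> up R (w + j)"
proof (cases "j = 0")
  case False
  define x where "x = - int (w + j)"
  have 1: "hit 1 {0, int R} x (int R) = hit 1 {0, int R, - int w} x (int R) +
      hit 1 {0, int R, - int w} x (- int w) * up R w"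
    unfolding up_eq_hit[OF R w] using R w by (intro hit_insert) auto
  have 2: "hit 1 {0, - int w} x (- int w) = hit 1 {0, int R, - int w} x (- int w) +
      hit 1 {0, int R, - int w} x (int R) * hit 1 {0, - int w} (int R) (- int w)"
    using R w by (intro hit_insert) auto
  have 3: "1 - up w j = hit 1 {0, - int w} x (- int w)"
  proof -
    have "hit 1 {0, - int w} x (- int w) * abar (int w) = pot x + pot (int w) - pot (- int j)"
      using hit_two_points[of "- int w" x] w False by (simp add: potd_def x_def add.commute)
    then show ?thesis using abar_pos[of "int w"] w
      by (simp add: up_def x_def field_simps)
  qed
  define \<alpha> \<beta> s where "\<alpha> = hit 1 {0, int R, - int w} x (int R)" and "\<beta> = hit 1 {0, int R, - int w} x (- int w)"
    and "s = hit 1 {0, - int w} (int R) (- int w)"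
  have nn: "0 \<le> \<alpha>" "0 \<le> \<beta>" "s \<le> 1" "0 \<le> up R w" "up R w \<le> 1"
    using up_nonneg[OF R, of w] up_le_1[OF R, of w] by (auto simp: \<alpha>_def \<beta>_def s_def hit_1_le)
  have "(1 - up w j) * up R w = (\<beta> + \<alpha> * s) * up R w" unfolding 3 2 \<alpha>_def \<beta>_def s_def ..
  also have "\<dots> = \<beta> * up R w + (\<alpha> * s) * up R w" by (simp add: algebra_simps)
  also have "(\<alpha> * s) * up R w \<le> (\<alpha> * 1) * 1" using nn by (intro mult_mono mult_left_mono mult_nonneg_nonneg) (auto simp: s_def)
  also have "\<beta> * up R w + (\<alpha> * 1) * 1 = up R (w + j)"
  proof -
    have "up R (w + j) = hit 1 {0, int R} x (int R)" using up_eq_hit[OF R, of "w + j"] w by (simp add: x_def)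
    then show ?thesis using 1 by (simp add: \<alpha>_def \<beta>_def)
  qed
  finally show ?thesis by simp
qed simp

text \<open>In \<open>conv_le\<close> the last term is \<open>(Mp v / M v) * (M v / M R)\<close>
  with \<open>v = max w R\<close>; the second quotient is the reason for the restriction to
  \<open>M w \<le> L * M R\<close>.\<close>

lemma up_small_near:
  assumes "1 \<le> L" "0 < \<delta>"
  obtains N where "1 \<le> N" "\<And>R w. N \<le> R \<Longrightarrow> M w \<le> L * M R \<Longrightarrow> up R w \<le> \<delta>"
proof -
  obtain C where C: "0 < C" "\<And>x. 1 \<le> x \<Longrightarrow> abar (int x) \<le> C * f x" by (rule abar_upper) blast
  \<comment> \<open>Solves \<open>16 * C^2 * (e * L + e * L) = \<delta>\<close>.\<close>
  define e where "e = \<delta> / (32 * C\<^sup>2 * L)"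
  have e: "0 < e" using assms C by (simp add: e_def)
  define E1 where "E1 R = (\<Sum>l<R. (f (Suc l) - f l) * (Mp (Suc l) / M (Suc l)))" for R
  have fs: "(\<Sum>l<R. f (Suc l) - f l) = f R" for R by (subst sum_lessThan_telescope) simp
  have "(\<lambda>R. E1 R / (\<Sum>l<R. f (Suc l) - f l)) \<longlonglongrightarrow> 0" unfolding E1_def
  proof (rule cesaro_tendsto_0)
    show "(\<lambda>n. Mp (Suc n) / M (Suc n)) \<longlonglongrightarrow> 0" using pos_dtail_ratio by (rule LIMSEQ_Suc)
    show "0 \<le> f (Suc n) - f n" for n using scale_mono[of n "Suc n"] by simp
    show "filterlim (\<lambda>n. \<Sum>k<n. f (Suc k) - f k) at_top sequentially" unfolding fs by (rule scale_at_top)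
  qed
  then have "eventually (\<lambda>R. E1 R / f R < e) sequentially" unfolding fs using e by (rule order_tendstoD)
  moreover have "eventually (\<lambda>R. Mp R / M R < e) sequentially" using pos_dtail_ratio e by (rule order_tendstoD)
  ultimately have "eventually (\<lambda>R. E1 R / f R < e \<and> Mp R / M R < e) sequentially" by (rule eventually_conj)
  then obtain N where N: "\<And>R. N \<le> R \<Longrightarrow> E1 R / f R < e \<and> Mp R / M R < e" by (auto simp: eventually_sequentially)
  show ?thesis
  proof (rule that[of "max 1 N"])
    fix R w assume R: "max 1 N \<le> R" and wR: "M w \<le> L * M R"
    then have R1: "1 \<le> R" and NR: "N \<le> R" by auto
    have fR: "0 < f R" and MR: "0 < M R" using R1 by (auto intro: scale_pos M_pos)
    show "up R w \<le> \<delta>"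
    proof (cases "w = 0")
      case False
      then have w: "1 \<le> w" by simp
      define v where "v = max w R"
      have v: "N \<le> v" "1 \<le> v" using NR R1 by (auto simp: v_def)
      have Mv: "M v \<le> L * M R"
      proof (cases "w \<le> R")
        case True
        then show ?thesis using assms(1) MR by (simp add: v_def max_def)
      qed (use wR in \<open>simp add: v_def max_def\<close>)
      have "Mp v / M R = (Mp v / M v) * (M v / M R)" using M_pos[of v] v by simp
      also have "\<dots> \<le> e * L"
        using N[OF v(1)] Mv M_nonneg e by (intro mult_mono less_imp_le[of _ e] pos_divide_le_eq[OF MR, THEN iffD2]) auto
      finally have b: "Mp v / M R \<le> e * L" .
      have a: "E1 R / f R \<le> e * L"
        using N[OF NR] assms(1) e by (smt (verit) mult_le_cancel_left1)
      have "up R w \<le> 8 * C\<^sup>2 / f R * conv w R"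
        unfolding up_eq_hit[OF R1 w] by (rule crossing_bound[OF C w R1])
      also have "\<dots> \<le> 8 * C\<^sup>2 / f R * (2 * E1 R + 2 * f R * (Mp v / M R))"
        using conv_le[of w R] fR unfolding E1_def v_def by (intro mult_left_mono) auto
      also have "\<dots> = 16 * C\<^sup>2 * (E1 R / f R + Mp v / M R)" using fR by (simp add: field_simps)
      also have "\<dots> \<le> 16 * C\<^sup>2 * (e * L + e * L)" using a b by (intro mult_left_mono add_mono) auto
      also have "\<dots> = \<delta>" using C(1) assms by (simp add: e_def field_simps)
      finally show ?thesis .
    qed (use assms in simp)
  qed simp
qed

text \<open>Step length and window length may be exchanged, since both sides are the same difference
  of boundary blocks. Only \<open>R\<close> terms remain, although the average runs over
  \<open>W\<close>.\<close>

lemma sum_shift_diff: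
  fixes g :: "nat \<Rightarrow> real"
  shows "(\<Sum>w<W. g w - g (w + R)) = (\<Sum>w<R. g w - g (w + W))"
proof -
  have split: "(\<Sum>w<a + b. g w) = (\<Sum>w<a. g w) + (\<Sum>w<b. g (w + a))" for a b
    by (induction b) (simp_all add: add.commute add.left_commute)
  show ?thesis using split[of W R] split[of R W] by (simp add: sum_subtractf add.commute)
qed

lemma sum_up:
  "(\<Sum>w<W. up R (v + w)) = (real W * pot (- int R) + (\<Sum>w<R. pot (- int (v + w)) - pot (- int (v + w + W)))) / abar (int R)"
proof -
  have "(\<Sum>w<W. up R (v + w)) = (\<Sum>w<W. pot (- int R) + (pot (- int (v + w)) - pot (- int (v + (w + R))))) / abar (int R)"
    unfolding sum_divide_distrib up_def by (intro sum.cong refl) (simp add: algebra_simps)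
  also have "(\<Sum>w<W. pot (- int R) + (pot (- int (v + w)) - pot (- int (v + (w + R))))) =
     real W * pot (- int R) + (\<Sum>w<R. pot (- int (v + w)) - pot (- int (v + (w + W))))"
    unfolding sum.distrib using sum_shift_diff[of "\<lambda>w. pot (- int (v + w))" R W] by simp
  finally show ?thesis by (simp add: add.assoc)
qed

text \<open>The window \<open>[0, W)\<close> is the longest on which \<open>up_small_near\<close> applies; averaging
  \<open>up R\<close> over a translate of it makes the increments of the potential telescope.\<close>

lemma up_small:
  assumes "0 < \<epsilon>"
  obtains N where "1 \<le> N" "\<And>R. N \<le> R \<Longrightarrow> pot (- int R) \<le> \<epsilon> * abar (int R)"
    "\<And>R w. N \<le> R \<Longrightarrow> up R w \<le> \<epsilon>"
proof -
  obtain C where C: "0 < C" "\<And>x. 1 \<le> x \<Longrightarrow> abar (int x) \<le> C * f x" by (rule abar_upper) blast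
  \<comment> \<open>The bound \<open>1 / 2\<close> allows division by \<open>1 - \<delta>\<close> at
    the end, and the size of \<open>L\<close> ensures
    \<open>C / L \<le> \<epsilon> / 128\<close>.\<close>
  define \<delta> where "\<delta> = min (\<epsilon> / 8) (1 / 2)"
  define L where "L = max 1 (128 * C / \<epsilon>)"
  have \<delta>: "0 < \<delta>" "\<delta> \<le> \<epsilon> / 8" "\<delta> \<le> 1 / 2" using assms by (auto simp: \<delta>_def)
  have L: "1 \<le> L" "128 * C / \<epsilon> \<le> L" by (auto simp: L_def)
  have CL: "C / L \<le> \<epsilon> / 128"
  proof -
    have "128 * C \<le> L * \<epsilon>" using L(2) assms by (simp add: divide_le_eq)
    then show ?thesis using L(1) by (simp add: field_simps)
  qed
  obtain N where N: "1 \<le> N" "\<And>R w. N \<le> R \<Longrightarrow> M w \<le> L * M R \<Longrightarrow> up R w \<le> \<delta>"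
    by (rule up_small_near[OF L(1) \<delta>(1)]) blast
  have key: "pot (- int R) \<le> \<epsilon> / 2 * abar (int R) \<and> (\<forall>w. up R w \<le> \<epsilon>)" if NR: "N \<le> R" for R
  proof -
    have R: "1 \<le> R" using NR N(1) by simp
    have MR: "0 < M R" and fR: "0 < f R" using R by (auto intro: M_pos scale_pos)
    have aR: "0 < abar (int R)" using R by (intro abar_pos) simp
    obtain Z where Z: "\<And>w. Z \<le> w \<Longrightarrow> L * M R + 1 \<le> M w"
      using dtail_at_top unfolding filterlim_at_top eventually_sequentially by blast
    define S where "S = {w. M w \<le> L * M R}"
    have "S \<subseteq> {..<Z}"
    proof
      fix w assume "w \<in> S"
      then have "\<not> Z \<le> w" using Z[of w] by (auto simp: S_def)
      then show "w \<in> {..<Z}" by simp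
    qed
    then have finS: "finite S" by (rule finite_subset) simp
    have RS: "R \<in> S" using L(1) MR by (simp add: S_def)
    define W where "W = Max S"
    have WS: "W \<in> S" unfolding W_def using finS RS by (intro Max_in) auto
    have Wmax: "w \<le> W" if "w \<in> S" for w unfolding W_def using finS that by (rule Max_ge)
    have RW: "R \<le> W" by (rule Wmax[OF RS])
    then have W1: "1 \<le> W" using R by simp
    \<comment> \<open>The window is maximal and \<open>M\<close> at most doubles in one step, so
      \<open>M W\<close> exceeds \<open>L * M R / 2\<close>.\<close>
    have "Suc W \<notin> S" using Wmax[of "Suc W"] by auto
    then have "L * M R < M (Suc W)" by (simp add: S_def)
    also have "\<dots> \<le> 2 * M W" using W1 by (intro M_Suc_le) simp
    finally have LM: "L * M R < 2 * M W" .
    have MW: "0 < M W" using W1 by (intro M_pos) simp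
    \<comment> \<open>Relative cost of \<open>R\<close> boundary terms of size
      \<open>C * f W\<close> against \<open>W\<close> averaged ones. The quotient collapses to
      \<open>M R / M W\<close>.\<close>
    have ratio: "real R / real W * (C * f W) / (f R / 8) \<le> 16 * (C / L)"
    proof -
      have "real R / real W * (C * f W) / (f R / 8) = 8 * C * (M R / M W)"
        using R W1 MR MW by (simp add: scale_def field_simps)
      also have "M R / M W \<le> 2 / L" using LM L(1) MW by (simp add: field_simps)
      then have "8 * C * (M R / M W) \<le> 8 * C * (2 / L)" using C(1) by (intro mult_left_mono) auto
      finally show ?thesis by simp
    qed
    have divbound: "real R * Y / (real W * abar (int R)) \<le> q * (16 * (C / L))"
      if Y: "Y \<le> q * (C * f W)" "0 \<le> q" for Y q
    proof -
      have "real R * Y / (real W * abar (int R)) \<le> real R * (q * (C * f W)) / (real W * abar (int R))"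
        using Y aR W1 by (intro divide_right_mono mult_left_mono) auto
      also have "\<dots> \<le> real R * (q * (C * f W)) / (real W * (f R / 8))"
        using Y C(1) scale_nonneg abar_lower[of R] fR W1 by (intro divide_left_mono mult_left_mono mult_pos_pos aR) auto
      also have "\<dots> = q * (real R / real W * (C * f W) / (f R / 8))" by simp
      also have "\<dots> \<le> q * (16 * (C / L))" using ratio Y(2) by (rule mult_left_mono)
      finally show ?thesis .
    qed
    \<comment> \<open>Average over \<open>[0, W)\<close>, where every \<open>up R w\<close> is at
      most \<open>\<delta>\<close>. The boundary terms reach up to \<open>2 * W\<close>, which
      accounts for the factor 2.\<close>
    have \<theta>: "pot (- int R) / abar (int R) \<le> 3 * \<epsilon> / 8"
    proof -
      have up: "(\<Sum>w<W. up R (0 + w)) \<le> real W * \<delta>"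
      proof -
        have "up R w \<le> \<delta>" if "w < W" for w
          using N(2)[OF NR, of w] M_mono(1)[of w W] WS that by (auto simp: S_def)
        then have "(\<Sum>w<W. up R (0 + w)) \<le> (\<Sum>w<W. \<delta>)" by (intro sum_mono) auto
        then show ?thesis by simp
      qed
      have b: "pot (- int (0 + w + W)) \<le> 2 * (C * f W)" if "w < R" for w
      proof -
        have "pot (- int (w + W)) \<le> abar (int (w + W))" using pot_nonneg[of "int (w + W)"] by simp
        also have "\<dots> \<le> C * f (w + W)" using W1 by (intro C) simp
        also have "\<dots> \<le> C * f (2 * W)" using C(1) that RW by (intro mult_left_mono scale_mono) auto
        also have "\<dots> \<le> C * (2 * f W)" using C(1) by (intro mult_left_mono scale_double) auto
        finally show ?thesis by simp
      qed
      have "(\<Sum>w<R. - (2 * (C * f W))) \<le> (\<Sum>w<R. pot (- int (0 + w)) - pot (- int (0 + w + W)))"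
      proof (rule sum_mono)
        fix w assume "w \<in> {..<R}"
        then show "- (2 * (C * f W)) \<le> pot (- int (0 + w)) - pot (- int (0 + w + W))"
          using b[of w] pot_nonneg[of "- int (0 + w)"] by simp
      qed
      then have "(real W * pot (- int R) - real R * (2 * (C * f W))) / abar (int R) \<le> real W * \<delta>"
        using up aR unfolding sum_up by (intro order_trans[OF _ up[unfolded sum_up]] divide_right_mono) auto
      then have "pot (- int R) / abar (int R) \<le> \<delta> + real R * (2 * (C * f W)) / (real W * abar (int R))"
        using W1 by (intro average_le) auto
      also have "real R * (2 * (C * f W)) / (real W * abar (int R)) \<le> 2 * (16 * (C / L))" by (rule divbound) auto
      finally have "pot (- int R) / abar (int R) \<le> \<delta> + 2 * (16 * (C / L))" by simp
      also have "\<dots> \<le> 3 * \<epsilon> / 8" using \<delta>(2) CL by simp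
      finally show ?thesis .
    qed
    have "up R w \<le> \<epsilon>" for w
    proof (cases "w \<in> S")
      case True
      then have "up R w \<le> \<delta>" using N(2)[OF NR] by (simp add: S_def)
      then show ?thesis using \<delta> assms by simp
    next
      case False
      then have Mw: "L * M R < M w" by (simp add: S_def)
      have "W < w"
      proof (rule ccontr)
        assume "\<not> W < w"
        then have "M w \<le> M W" by (intro M_mono) simp
        then show False using Mw WS by (simp add: S_def)
      qed
      then have w: "1 \<le> w" "N \<le> w" using NR RW by auto
      \<comment> \<open>The window is moved to \<open>[w, w + W)\<close>, where nothing is known
        about \<open>up R\<close>. Each term is bounded below through \<open>up_chain\<close>, as
        \<open>up w j \<le> \<delta>\<close> for \<open>j < W\<close>. From above, the average
        involves only \<open>\<theta>\<close> and increments over \<open>W\<close>, which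
        subadditivity bounds independently of \<open>w\<close>.\<close>
      have "(\<Sum>j<W. (1 - \<delta>) * up R w) \<le> (\<Sum>j<W. up R (w + j))"
      proof (rule sum_mono)
        fix j assume "j \<in> {..<W}"
        then have "M j \<le> M W" by (intro M_mono) simp
        also have "\<dots> \<le> L * M R" using WS by (simp add: S_def)
        also have "\<dots> \<le> M w" using Mw by simp
        also have "\<dots> \<le> L * M w" using L(1) M_nonneg(1)[of w] by (simp add: mult_le_cancel_right1)
        finally have "up w j \<le> \<delta>" by (rule N(2)[OF w(2)])
        then have "(1 - \<delta>) * up R w \<le> (1 - up w j) * up R w" using up_nonneg[OF R] by (intro mult_right_mono) auto
        also have "\<dots> \<le> up R (w + j)" by (rule up_chain[OF R w(1)])
        finally show "(1 - \<delta>) * up R w \<le> up R (w + j)" .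
      qed
      also have "\<dots> = (real W * pot (- int R) + (\<Sum>j<R. pot (- int (w + j)) - pot (- int (w + j + W)))) / abar (int R)"
        by (rule sum_up)
      also have "\<dots> \<le> (real W * pot (- int R) + real R * (1 * (C * f W))) / abar (int R)"
      proof -
        have "pot (- int (w + j)) - pot (- int (w + j + W)) \<le> C * f W" for j
        proof -
          have "pot (- int (w + j)) \<le> pot (- int (w + j + W)) + pot (int W)"
            using pot_subadd[of "- int (w + j + W)" "int W"] by simp
          moreover have "pot (int W) \<le> C * f W" using C(2)[OF W1] pot_nonneg[of "- int W"] by linarith
          ultimately show ?thesis by linarith
        qed
        then have "(\<Sum>j<R. pot (- int (w + j)) - pot (- int (w + j + W))) \<le> (\<Sum>j<R. C * f W)" by (intro sum_mono) auto
        then show ?thesis using aR by (intro divide_right_mono add_left_mono) auto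
      qed
      finally have "real W * ((1 - \<delta>) * up R w) \<le> (real W * pot (- int R) + real R * (1 * (C * f W))) / abar (int R)" by simp
      then have "(1 - \<delta>) * up R w \<le> pot (- int R) / abar (int R) + real R * (1 * (C * f W)) / (real W * abar (int R))"
        using W1 by (intro average_ge) auto
      also have "real R * (1 * (C * f W)) / (real W * abar (int R)) \<le> 1 * (16 * (C / L))" by (rule divbound) auto
      also have "pot (- int R) / abar (int R) + 1 * (16 * (C / L)) \<le> \<epsilon> / 2"
        using \<theta> CL by linarith
      finally have "(1 - \<delta>) * up R w \<le> \<epsilon> / 2" by simp
      moreover have "1 / 2 * up R w \<le> (1 - \<delta>) * up R w" using \<delta>(3) up_nonneg[OF R] by (intro mult_right_mono) auto
      ultimately show ?thesis by simp
    qed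
    moreover have "pot (- int R) / abar (int R) \<le> \<epsilon> / 2" using \<theta> assms by linarith
    ultimately show ?thesis using aR by (simp add: divide_le_eq)
  qed
  show ?thesis
  proof (rule that[OF N(1)])
    fix R assume R: "N \<le> R"
    then have "pot (- int R) \<le> \<epsilon> / 2 * abar (int R)" using key by blast
    also have "\<dots> \<le> \<epsilon> * abar (int R)" using assms abar_nonneg[of "int R"] by (intro mult_right_mono) auto
    finally show "pot (- int R) \<le> \<epsilon> * abar (int R)" .
    show "up R w \<le> \<epsilon>" for w using key[OF R] by blast
  qed
qed

end

section \<open>Exit from an interval\<close>

text \<open>Applied with \<open>e\<close> the exit probability, \<open>h = esc x\<close> and
  \<open>s = potd x * esc 0\<close>. The second error is relative to \<open>e\<close> itself, hence
  the division by \<open>1 - 2 * \<eta>\<close>.\<close>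

lemma two_sided_ratio:
  fixes e s :: real
  assumes s: "0 < s" and h: "\<bar>h - s\<bar> \<le> \<delta> * s" and e: "h \<le> e" "e - h \<le> 2 * \<eta> * e" "0 \<le> e"
    and \<epsilon>: "0 < \<epsilon>" and \<delta>: "0 < \<delta>" "\<delta> \<le> 1 / 4" "\<delta> \<le> \<epsilon> / 4"
    and \<eta>: "0 < \<eta>" "\<eta> \<le> 1 / 8" "\<eta> \<le> \<epsilon> / 16"
  shows "\<bar>e / s - 1\<bar> < \<epsilon>"
proof -
  have h': "(1 - \<delta>) * s \<le> h" "h \<le> (1 + \<delta>) * s" using h by (auto simp: abs_le_iff algebra_simps)
  have low: "1 - \<delta> \<le> e / s" using h'(1) e(1) s by (simp add: le_divide_eq)
  have "e * (1 - 2 * \<eta>) \<le> (1 + \<delta>) * s" using e h'(2) by (simp add: algebra_simps)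
  then have "e / s * (1 - 2 * \<eta>) \<le> 1 + \<delta>" using s by (simp add: field_simps)
  also have "\<dots> \<le> (1 + \<delta>) * (1 + 4 * \<eta>) * (1 - 2 * \<eta>)"
  proof -
    have "\<eta> * \<eta> * 8 \<le> \<eta> * 1" using mult_left_mono[of "8 * \<eta>" 1 \<eta>] \<eta> by simp
    then have "1 \<le> (1 + 4 * \<eta>) * (1 - 2 * \<eta>)" using \<eta>(1) by (simp add: algebra_simps)
    then have "(1 + \<delta>) * 1 \<le> (1 + \<delta>) * ((1 + 4 * \<eta>) * (1 - 2 * \<eta>))" using \<delta> by (intro mult_left_mono) auto
    then show ?thesis by (simp add: mult.assoc)
  qed
  finally have "e / s * (1 - 2 * \<eta>) \<le> (1 + \<delta>) * (1 + 4 * \<eta>) * (1 - 2 * \<eta>)" .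
  then have "e / s \<le> (1 + \<delta>) * (1 + 4 * \<eta>)" by (rule mult_right_le_imp_le) (use \<eta> in simp)
  also have "\<dots> \<le> 1 + \<delta> + 5 * \<eta>"
    using mult_mono[of \<delta> "1 / 4" "\<eta>" \<eta>] \<eta> \<delta> by (simp add: algebra_simps)
  also have "\<dots> < 1 + \<epsilon>" using \<eta> \<delta> \<epsilon> by linarith
  finally show ?thesis using low \<delta> \<epsilon> by (simp add: abs_less_iff)
qed

text \<open>Here \<open>a\<close>, \<open>a'\<close> are the potentials at \<open>Q\<close>,
  \<open>- Q\<close>, and \<open>b\<close>, \<open>b'\<close> those at \<open>R\<close>,
  \<open>- R\<close>; \<open>z\<close> is the potential at \<open>Q + R\<close>, \<open>q\<close> is
  \<open>qq\<close> and \<open>s\<close> is \<open>esc 0\<close>. Subadditivity supplies the two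
  bounds in terms of \<open>z\<close>, so that \<open>a'\<close> and \<open>b'\<close> are small
  against \<open>z\<close> as well.\<close>

lemma product_ratio:
  fixes a b c d q s z :: real
  assumes a: "0 < a" "0 \<le> a'" "a' \<le> \<eta> * (a + a')" and b: "0 < b" "0 \<le> b'" "b' \<le> \<eta> * (b + b')"
    and z: "a \<le> z + b'" "b \<le> z + a'" and q: "0 \<le> q" "q \<le> \<eta>"
    and s: "(1 - q) * ((z + a' + b') / ((a + a') * (b + b'))) \<le> s" "s * (1 - q) \<le> (z + a' + b') / ((a + a') * (b + b'))"
    and \<epsilon>: "0 < \<epsilon>" "\<eta> = min (1 / 8) (\<epsilon> / 32)"
  shows "0 < z" "\<bar>s / (z / (a * b)) - 1\<bar> < \<epsilon>"
proof -
  have \<eta>: "0 < \<eta>" "\<eta> \<le> 1 / 8" "\<eta> \<le> \<epsilon> / 32" using \<epsilon> by auto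
  have small: "a' \<le> 2 * \<eta> * a" if "0 < a" "0 \<le> a'" "a' \<le> \<eta> * (a + a')" for a a' :: real
  proof -
    have "\<eta> * a' \<le> 1 / 2 * a'" using \<eta> that by (intro mult_right_mono) auto
    then show ?thesis using that by (simp add: algebra_simps)
  qed
  have a2: "a' \<le> 2 * \<eta> * a" and b2: "b' \<le> 2 * \<eta> * b" using small a b by auto
  have "2 * \<eta> * a \<le> 1 / 4 * a" "2 * \<eta> * b \<le> 1 / 4 * b" using \<eta> a b by (auto intro!: mult_right_mono)
  then have "a' \<le> 1 / 4 * a" "b' \<le> 1 / 4 * b" using a2 b2 by (blast intro: order_trans)+
  then have az: "3 / 4 * a + 3 / 4 * b \<le> 2 * z" using z by linarith
  then show z0: "0 < z" using a b by linarith
  have ab: "a' + b' \<le> 6 * \<eta> * z"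
  proof -
    have "a' + b' \<le> 2 * \<eta> * (a + b)" using a2 b2 by (simp add: algebra_simps)
    also have "\<dots> \<le> 2 * \<eta> * (8 / 3 * z)" using az \<eta> by (intro mult_left_mono) auto
    also have "\<dots> \<le> 6 * \<eta> * z" using z0 \<eta> by simp
    finally show ?thesis .
  qed
  define A where "A = a / (a + a')"
  define B where "B = b / (b + b')"
  define Z where "Z = (z + a' + b') / z"
  have A: "1 - \<eta> \<le> A" "A \<le> 1" using a by (auto simp: A_def field_simps)
  have B: "1 - \<eta> \<le> B" "B \<le> 1" using b by (auto simp: B_def field_simps)
  have Z: "1 \<le> Z" "Z \<le> 1 + 6 * \<eta>" using a b ab z0 by (auto simp: Z_def field_simps)
  have T: "(z + a' + b') / ((a + a') * (b + b')) / (z / (a * b)) = A * B * Z"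
    using a b z0 by (simp add: A_def B_def Z_def field_simps)
  define y where "y = s / (z / (a * b))"
  have zab: "0 < z / (a * b)" using z0 a b by simp
  have low: "(1 - q) * (A * B * Z) \<le> y"
    using divide_right_mono[OF s(1), of "z / (a * b)"] zab unfolding y_def T[symmetric] by simp
  have upp: "y * (1 - q) \<le> A * B * Z"
    using divide_right_mono[OF s(2), of "z / (a * b)"] zab unfolding y_def T[symmetric] times_divide_eq_left[symmetric]
    by (simp add: mult_ac)
  have "(1 - \<eta>) * ((1 - \<eta>) * (1 - \<eta>) * 1) \<le> (1 - q) * (A * B * Z)"
    using A B Z q \<eta> by (intro mult_mono mult_nonneg_nonneg) auto
  moreover have "1 - 3 * \<eta> \<le> (1 - \<eta>) * ((1 - \<eta>) * (1 - \<eta>) * 1)"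
  proof -
    have "0 \<le> \<eta> * \<eta> * (3 - \<eta>)" using \<eta> by (intro mult_nonneg_nonneg) auto
    then show ?thesis by (simp add: algebra_simps)
  qed
  ultimately have ylow: "1 - 3 * \<eta> \<le> y" using low by linarith
  then have y0: "0 \<le> y" using \<eta> by linarith
  have "A * B * Z \<le> 1 * 1 * (1 + 6 * \<eta>)" using A B Z \<eta> by (intro mult_mono mult_nonneg_nonneg) auto
  then have "y * (1 - q) \<le> 1 + 6 * \<eta>" using order_trans[OF upp] by simp
  moreover have "y * (1 - \<eta>) \<le> y * (1 - q)" using y0 q by (intro mult_left_mono) auto
  ultimately have "y * (1 - \<eta>) \<le> 1 + 6 * \<eta>" by linarith
  also have "\<dots> \<le> (1 + 8 * \<eta>) * (1 - \<eta>)"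
    using mult_left_mono[of "8 * \<eta>" 1 \<eta>] \<eta> by (simp add: algebra_simps)
  finally have "y \<le> 1 + 8 * \<eta>" by (rule mult_right_le_imp_le) (use \<eta> in simp)
  then show "\<bar>s / (z / (a * b)) - 1\<bar> < \<epsilon>"
    using ylow \<eta> \<epsilon>(1) unfolding y_def[symmetric] by (simp add: abs_less_iff)
qed

context centred_law begin

text \<open>For \<open>r < 1\<close>, \<open>c y = 1 - hit r {0} y 0\<close> is the probability that
  the killed walk never reaches 0, and away from 0 it is \<open>pot_r r y / green r 0\<close>.
  Stopping at \<open>F\<close> and never reaching 0 afterwards is part of never reaching 0.
  Finiteness of \<open>F\<close> lets the limit pass through the sum.\<close>

lemma pot_superharmonic:
  assumes K: "0 \<in> K" and F: "finite F" "F \<subseteq> K - {0}"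
  shows "(\<Sum>y\<in>F. hit 1 K x y * pot y) \<le> potd x"
proof (rule tendsto_le[of "at_left (1::real)"])
  show "((\<lambda>r. (if x = 0 then 1 else 0) + pot_r r x) \<longlongrightarrow> potd x) (at_left 1)"
    unfolding potd_def by (intro tendsto_intros pot_r_tendsto)
  show "((\<lambda>r. \<Sum>y\<in>F. hit r K x y * pot_r r y) \<longlongrightarrow> (\<Sum>y\<in>F. hit 1 K x y * pot y)) (at_left 1)"
    using F by (intro tendsto_intros hit_tendsto pot_r_tendsto) auto
  show "eventually (\<lambda>r. (\<Sum>y\<in>F. hit r K x y * pot_r r y) \<le> (if x = 0 then 1 else 0) + pot_r r x) (at_left 1)"
    using eventually_at_left_1
  proof eventually_elim
    fix r :: real assume "0 < r \<and> r < 1"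
    then have r: "0 \<le> r" "r < 1" by auto
    have g: "0 < green r 0" using green_0_ge[OF r] by simp
    define c where "c y = 1 - hit r {0} y 0" for y
    have c: "0 \<le> c y" for y using hit_le_1[OF r, of 0 "{0}" y] by (simp add: c_def)
    have cg: "c y * green r 0 = (if y = 0 then 1 else 0) + pot_r r y" for y
      using hit_0_eq[OF r, of y] by (simp add: c_def left_diff_distrib pot_r_def)
    have "hits P r {0} x 0 + (\<Sum>y\<in>F. hits P r K x y * ennreal (c y)) =
       hits P r K x 0 + (\<integral>\<^sup>+z. hits P r K x z * indicator (K - {0}) z * hits P r {0} z 0 \<partial>count_space UNIV)
        + (\<integral>\<^sup>+z. hits P r K x z * indicator F z * ennreal (c z) \<partial>count_space UNIV)"
      using hits_decomp[of "{0}" K r P x 0] K r F by (simp add: nn_integral_count_space_finite_indicator)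
    also have "hits P r K x 0 = (\<integral>\<^sup>+z. hits P r K x z * indicator {0} z \<partial>count_space UNIV)" by simp
    also have "\<dots> + (\<integral>\<^sup>+z. hits P r K x z * indicator (K - {0}) z * hits P r {0} z 0 \<partial>count_space UNIV)
        + (\<integral>\<^sup>+z. hits P r K x z * indicator F z * ennreal (c z) \<partial>count_space UNIV) =
      (\<integral>\<^sup>+z. hits P r K x z * indicator {0} z + hits P r K x z * indicator (K - {0}) z * hits P r {0} z 0
         + hits P r K x z * indicator F z * ennreal (c z) \<partial>count_space UNIV)"
      by (simp add: nn_integral_add)
    also have "\<dots> \<le> (\<integral>\<^sup>+z. hits P 1 K x z * indicator K z \<partial>count_space UNIV)"
    proof (rule nn_integral_mono)
      fix z
      have one: "hits P r {0} z 0 + ennreal (c z) = 1"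
      proof -
        have "hits P r {0} z 0 + ennreal (c z) = ennreal (hit r {0} z 0) + ennreal (c z)" by (simp only: ennreal_hit[OF r])
        also have "\<dots> = ennreal (hit r {0} z 0 + c z)" using c by (intro ennreal_plus[symmetric]) auto
        finally show ?thesis by (simp add: c_def)
      qed
      have le: "hits P r {0} z 0 \<le> 1" unfolding one[symmetric] by simp
      have m: "hits P r K x z \<le> hits P 1 K x z" using r by (intro hits_mono_r) auto
      consider "z = 0" | "z \<in> F" "z \<noteq> 0" | "z \<in> K - {0}" "z \<notin> F" | "z \<notin> K" using F by auto
      then show "hits P r K x z * indicator {0} z + hits P r K x z * indicator (K - {0}) z * hits P r {0} z 0
         + hits P r K x z * indicator F z * ennreal (c z) \<le> hits P 1 K x z * indicator K z"
      proof cases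
        case 2
        then have "z \<in> K" using F by auto
        then have "hits P r K x z * indicator {0} z + hits P r K x z * indicator (K - {0}) z * hits P r {0} z 0
         + hits P r K x z * indicator F z * ennreal (c z) = hits P r K x z * (hits P r {0} z 0 + ennreal (c z))"
          using 2 by (simp add: distrib_left)
        then show ?thesis unfolding one using m \<open>z \<in> K\<close> by simp
      next
        case 3
        have "hits P r K x z * hits P r {0} z 0 \<le> hits P 1 K x z * 1" by (intro mult_mono m le) auto
        then show ?thesis using 3 by simp
      qed (use m F K in \<open>auto simp: indicator_def\<close>)
    qed
    also have "\<dots> \<le> 1" by (rule hits_mass_le)
    finally have "hits P r {0} x 0 + (\<Sum>y\<in>F. hits P r K x y * ennreal (c y)) \<le> 1" .
    moreover have "hits P r {0} x 0 + (\<Sum>y\<in>F. hits P r K x y * ennreal (c y)) = ennreal (hit r {0} x 0 + (\<Sum>y\<in>F. hit r K x y * c y))"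
    proof -
      have "(\<Sum>y\<in>F. hits P r K x y * ennreal (c y)) = (\<Sum>y\<in>F. ennreal (hit r K x y * c y))"
        by (intro sum.cong refl) (simp only: ennreal_mult'[OF enn2real_nonneg] ennreal_hit[OF r])
      also have "\<dots> = ennreal (\<Sum>y\<in>F. hit r K x y * c y)" using c by (intro sum_ennreal) auto
      finally show ?thesis using c
        by (simp only: ennreal_plus[OF enn2real_nonneg sum_nonneg] ennreal_hit[OF r] mult_nonneg_nonneg enn2real_nonneg)
    qed
    ultimately have "hit r {0} x 0 + (\<Sum>y\<in>F. hit r K x y * c y) \<le> 1" by simp
    then have "(\<Sum>y\<in>F. hit r K x y * c y) * green r 0 \<le> c x * green r 0"
      using g by (intro mult_right_mono) (auto simp: c_def)
    moreover have "(\<Sum>y\<in>F. hit r K x y * c y) * green r 0 = (\<Sum>y\<in>F. hit r K x y * pot_r r y)"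
      unfolding sum_distrib_right using F by (intro sum.cong refl) (auto simp: mult.assoc cg)
    ultimately show "(\<Sum>y\<in>F. hit r K x y * pot_r r y) \<le> (if x = 0 then 1 else 0) + pot_r r x"
      by (simp add: cg)
  qed
qed simp

text \<open>Writing \<open>R = y - n\<close>, subadditivity leaves the error
  \<open>pot (- n)\<close>. For large \<open>n\<close> it is negligible against
  \<open>pot n\<close>, hence against \<open>pot y\<close> up to \<open>pot (- R)\<close>; the
  finitely many small \<open>n\<close> are absorbed by \<open>abar R\<close>.\<close>

lemma pot_eventually_ge:
  assumes "0 < \<epsilon>"
  obtains N :: nat where "\<And>R y. int N \<le> R \<Longrightarrow> R \<le> y \<Longrightarrow> (1 - \<epsilon>) * abar R \<le> pot y"
proof -
  define \<eta> where "\<eta> = min (1 / 4) (\<epsilon> / 8)"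
  have \<eta>: "0 < \<eta>" "\<eta> \<le> 1 / 4" "8 * \<eta> \<le> \<epsilon>" using assms by (auto simp: \<eta>_def)
  obtain N where N: "1 \<le> N" "\<And>R. N \<le> R \<Longrightarrow> pot (- int R) \<le> \<eta> * abar (int R)"
    by (rule up_small[OF \<eta>(1)]) blast
  define C where "C = (\<Sum>n<N. pot (- int n))"
  have C: "pot (- int n) \<le> C" if "n < N" for n
    unfolding C_def using that by (intro member_le_sum) (auto simp: pot_nonneg)
  have "eventually (\<lambda>n. 8 * C / \<eta> \<le> f n) sequentially" using scale_at_top unfolding filterlim_at_top by blast
  then obtain N' where N': "\<And>n. N' \<le> n \<Longrightarrow> 8 * C / \<eta> \<le> f n" by (auto simp: eventually_sequentially)
  show ?thesis
  proof (rule that[of "N + N'"])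
    fix R y :: int assume R: "int (N + N') \<le> R" and y: "R \<le> y"
    have NR: "N \<le> nat R" "N' \<le> nat R" using R by linarith+
    have bR: "pot (- R) \<le> \<eta> * abar R" using N(2)[OF NR(1)] R by simp
    have "8 * C / \<eta> \<le> 8 * abar R" using N'[OF NR(2)] abar_lower[of "nat R"] R by simp
    then have CR: "C \<le> \<eta> * abar R" using \<eta>(1) by (simp add: field_simps)
    define n where "n = nat (y - R)"
    have n: "int n = y - R" using y by (simp add: n_def)
    have b: "pot (- int n) \<le> 2 * \<eta> * pot y + \<eta> * abar R"
    proof (cases "n < N")
      case True
      have "0 \<le> 2 * \<eta> * pot y" using \<eta> pot_nonneg by simp
      then show ?thesis using C[OF True] CR by linarith
    next
      case False
      then have "pot (- int n) \<le> \<eta> * abar (int n)" by (intro N) simp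
      moreover have "\<eta> * pot (- int n) \<le> 1 / 2 * pot (- int n)" using \<eta> pot_nonneg by (intro mult_right_mono) auto
      ultimately have "pot (- int n) \<le> 2 * \<eta> * pot (int n)" by (simp add: distrib_left)
      also have "\<dots> \<le> 2 * \<eta> * (pot y + pot (- R))"
        using pot_subadd[of y "- R"] \<eta> by (intro mult_left_mono) (auto simp: n)
      also have "\<dots> = 2 * \<eta> * pot y + 2 * \<eta> * pot (- R)" by (simp add: distrib_left)
      also have "2 * \<eta> * pot (- R) \<le> 1 * pot (- R)" using \<eta> pot_nonneg by (intro mult_right_mono) auto
      finally show ?thesis using bR by simp
    qed
    have "pot R \<le> pot y + pot (- int n)" using pot_subadd[of y "- int n"] by (simp add: n)
    then have 1: "pot R \<le> pot y + 2 * \<eta> * pot y + \<eta> * abar R" using b by linarith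
    have 2: "abar R - \<eta> * abar R \<le> pot R" using bR by simp
    have "(1 - 2 * \<eta>) * abar R \<le> (1 + 2 * \<eta>) * pot y" using 1 2 by (simp add: left_diff_distrib distrib_right)
    moreover have "(1 - 8 * \<eta>) * (1 + 2 * \<eta>) \<le> 1 - 2 * \<eta>"
    proof -
      have "0 \<le> 4 * \<eta> + 16 * (\<eta> * \<eta>)" using \<eta> by simp
      then show ?thesis by (simp add: algebra_simps)
    qed
    then have "(1 - 8 * \<eta>) * (1 + 2 * \<eta>) * abar R \<le> (1 - 2 * \<eta>) * abar R" using abar_nonneg by (rule mult_right_mono)
    ultimately have "(1 + 2 * \<eta>) * ((1 - 8 * \<eta>) * abar R) \<le> (1 + 2 * \<eta>) * pot y" by (simp add: mult_ac)
    then have "(1 - 8 * \<eta>) * abar R \<le> pot y" by (rule mult_left_le_imp_le) (use \<eta> in simp)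
    moreover have "(1 - \<epsilon>) * abar R \<le> (1 - 8 * \<eta>) * abar R" using \<eta> abar_nonneg by (intro mult_right_mono) auto
    ultimately show "(1 - \<epsilon>) * abar R \<le> pot y" by linarith
  qed
qed

section \<open>Escape from 0 through the points -Q and R\<close>

context
  fixes Q R :: int
begin

abbreviation "tri \<equiv> {- Q, 0, R}"

definition "esc x = 1 - hit 1 tri x 0"

text \<open>By \<open>hit_two_points\<close> these are \<open>P[\<sigma>\<^bsub>-Q\<^esub> < \<sigma>\<^sub>0]\<close> from \<open>R\<close> and \<open>P[\<sigma>\<^sub>R < \<sigma>\<^sub>0]\<close> from \<open>-Q\<close>.\<close>

definition "pp = (pot R + pot Q - pot (R + Q)) / abar Q"
definition "qq = (pot (- Q) + pot (- R) - pot (- Q - R)) / abar R"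

definition "exit_prob x =
  enn2real (\<integral>\<^sup>+y. hits P 1 (insert 0 (UNIV - {- Q<..<R})) x y * indicator (UNIV - {- Q<..<R}) y \<partial>count_space UNIV)"

context
  fixes \<eta> :: real
  assumes Q: "0 < Q" and R: "0 < R" and \<eta>: "0 < \<eta>" "\<eta> \<le> 1 / 8"
    and bQ: "pot (- Q) \<le> \<eta> * abar Q" and bR: "pot (- R) \<le> \<eta> * abar R"
    and upQ: "\<And>w. up (nat Q) w \<le> \<eta>" and upR: "\<And>w. up (nat R) w \<le> \<eta>"
    and low: "\<And>y. R \<le> y \<Longrightarrow> (1 - \<eta>) * abar R \<le> pot y"
begin

lemma aQ: "0 < abar Q" and aR: "0 < abar R" using Q R by (auto intro!: abar_pos)

lemma pp: "0 \<le> pp" "pp \<le> 1"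
proof -
  have "pot (R + Q) \<le> pot R + pot Q" by (rule pot_subadd)
  then show "0 \<le> pp" using aQ by (simp add: pp_def)
  have "pot R \<le> pot (R + Q) + pot (- Q)" using pot_subadd[of "R + Q" "- Q"] by simp
  then show "pp \<le> 1" using aQ by (simp add: pp_def)
qed

lemma qq: "0 \<le> qq" "qq \<le> \<eta>"
proof -
  have "pot (- Q - R) \<le> pot (- Q) + pot (- R)" using pot_subadd[of "- Q" "- R"] by simp
  then show "0 \<le> qq" using aR by (simp add: qq_def)
  show "qq \<le> \<eta>" using upR[of "nat Q"] Q R by (simp add: up_def qq_def)
qed

lemma pq: "1 - \<eta> \<le> 1 - pp * qq" "pp * qq \<le> qq"
proof -
  show "pp * qq \<le> qq" using mult_right_mono[OF pp(2) qq(1)] by simp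
  then show "1 - \<eta> \<le> 1 - pp * qq" using qq(2) by linarith
qed

text \<open>With \<open>u\<close>, \<open>v\<close> the masses at \<open>- Q\<close> and
  \<open>R\<close>, the identities become the linear system \<open>A = u + pp * v\<close>,
  \<open>B = v + qq * u\<close>. The combination \<open>(1 - qq) * A + (1 - pp) * B\<close> isolates
  \<open>u + v\<close>.\<close>

lemma esc_eq:
  assumes "x \<noteq> - Q" "x \<noteq> R"
  shows "(1 - pp * qq) * esc x = (potd x + pot Q - pot (x + Q)) / abar Q * (1 - qq) + (potd x + pot (- R) - pot (x - R)) / abar R * (1 - pp)"
proof -
  define u v where "u = hit 1 tri x (- Q)" and "v = hit 1 tri x R"
  have o: "hit 1 tri x 0 = 1 - u - v"
    using hit_identities(1)[of tri x] Q R by (simp add: u_def v_def)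
  have 1: "potd x - pot (x + Q) = u * pot (- Q) + (1 - u - v) * (- pot Q) + v * (pot R - pot (R + Q))"
    using hit_identities(2)[of tri 0 "- Q" x] Q R assms o by (simp add: u_def v_def potd_def)
  have 2: "potd x - pot (x - R) = u * (pot (- Q) - pot (- Q - R)) + (1 - u - v) * (- pot (- R)) + v * pot R"
    using hit_identities(2)[of tri 0 R x] Q R assms o by (simp add: u_def v_def potd_def)
  have A: "(potd x + pot Q - pot (x + Q)) / abar Q = u + pp * v"
  proof -
    have "potd x + pot Q - pot (x + Q) = u * abar Q + v * (pot R + pot Q - pot (R + Q))" using 1 by (simp add: algebra_simps)
    then show ?thesis unfolding pp_def using aQ by (simp add: add_divide_distrib mult.commute)
  qed
  have B: "(potd x + pot (- R) - pot (x - R)) / abar R = v + qq * u"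
  proof -
    have "potd x + pot (- R) - pot (x - R) = v * abar R + u * (pot (- Q) + pot (- R) - pot (- Q - R))" using 2 by (simp add: algebra_simps)
    then show ?thesis unfolding qq_def using aR by (simp add: add_divide_distrib mult.commute)
  qed
  show ?thesis unfolding A B esc_def o by (simp add: algebra_simps)
qed

lemma esc_0: "(1 - pp * qq) * esc 0 = 1 / abar Q * (1 - qq) + 1 / abar R * (1 - pp)"
  using esc_eq[of 0] Q R by (simp add: potd_def)

lemma esc_0_pos: "0 < esc 0"
proof -
  have "0 < (1 - pp * qq) * esc 0" unfolding esc_0
    using aQ aR pp qq \<eta> by (intro add_pos_nonneg mult_pos_pos mult_nonneg_nonneg) auto
  then show ?thesis using pq \<eta> by (simp add: zero_less_mult_iff)
qed

text \<open>The coefficients in \<open>esc_eq\<close> do not depend on \<open>x\<close>. Hence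
  \<open>esc x - potd x * esc 0\<close> contains just the two increments that the side condition
  bounds.\<close>

lemma esc_approx:
  assumes x: "- Q < x" "x < R"
    and cond: "\<bar>pot Q - pot (x + Q)\<bar> + \<bar>pot (- R) - pot (x - R)\<bar> \<le> \<delta> * potd x"
  shows "\<bar>esc x - potd x * esc 0\<bar> \<le> \<delta> * (potd x * esc 0)"
proof -
  define c where "c = 1 - pp * qq"
  have c: "0 < c" using pq \<eta> by (simp add: c_def)
  define g h where "g = 1 / abar Q * (1 - qq)" and "h = 1 / abar R * (1 - pp)"
  have gh: "0 \<le> g" "0 \<le> h" using aQ aR pp qq \<eta> by (auto simp: g_def h_def intro!: mult_nonneg_nonneg)
  have e0: "c * esc 0 = g + h" using esc_0 by (simp add: c_def g_def h_def)
  have ex: "c * esc x = (potd x + (pot Q - pot (x + Q))) * g + (potd x + (pot (- R) - pot (x - R))) * h"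
    using esc_eq[of x] x by (simp add: c_def g_def h_def add_diff_eq)
  have "c * (esc x - potd x * esc 0) = c * esc x - potd x * (c * esc 0)" by (simp add: algebra_simps)
  also have "\<dots> = (pot Q - pot (x + Q)) * g + (pot (- R) - pot (x - R)) * h" unfolding e0 ex by (simp add: algebra_simps)
  finally have eq: "c * (esc x - potd x * esc 0) = (pot Q - pot (x + Q)) * g + (pot (- R) - pot (x - R)) * h" .
  have "c * \<bar>esc x - potd x * esc 0\<bar> = \<bar>c * (esc x - potd x * esc 0)\<bar>" using c by (simp add: abs_mult)
  also have "\<dots> \<le> \<bar>pot Q - pot (x + Q)\<bar> * g + \<bar>pot (- R) - pot (x - R)\<bar> * h"
    unfolding eq using gh by (intro order_trans[OF abs_triangle_ineq]) (simp add: abs_mult)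
  also have "\<dots> \<le> (\<delta> * potd x) * g + (\<delta> * potd x) * h"
    using gh cond by (intro add_mono mult_right_mono) linarith+
  also have "\<dots> = c * (\<delta> * (potd x * esc 0))" unfolding distrib_left[symmetric] e0[symmetric] by (simp only: mult_ac)
  finally show ?thesis using c by simp
qed

text \<open>Translated by \<open>Q\<close>, hitting 0 before \<open>- Q\<close> from below
  \<open>- Q\<close> is hitting \<open>Q\<close> before 0 from a negative point, an upward
  crossing.\<close>

lemma hit_0_below:
  assumes z: "z < - Q" shows "hit 1 tri z 0 \<le> \<eta>"
proof -
  have "hits P 1 tri z 0 \<le> hits P 1 {0, - Q} z 0" by (intro hits_antimono) auto
  then have "hit 1 tri z 0 \<le> hit 1 {0, - Q} z 0"
    using hits_le_1[of 0 "{0, - Q}" P z] by (intro enn2real_mono) (auto intro: order_le_less_trans)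
  also have "\<dots> = 1 - hit 1 {0, - Q} z (- Q)" using hit_identities(1)[of "{0, - Q}" z] Q by simp
  also have "hit 1 {0, - Q} z (- Q) = 1 - up (nat Q) (nat (- Q - z))"
  proof -
    have "hit 1 {0, - Q} z (- Q) * abar Q = pot z + pot Q - pot (z + Q)"
      using hit_two_points[of "- Q" z] Q z by (simp add: potd_def add.commute)
    then have "hit 1 {0, - Q} z (- Q) = (pot z + pot Q - pot (z + Q)) / abar Q" using aQ by (simp add: field_simps)
    moreover have "up (nat Q) (nat (- Q - z)) = (pot (z + Q) + pot (- Q) - pot z) / abar Q"
      using Q z by (simp add: up_def add.commute)
    ultimately have "hit 1 {0, - Q} z (- Q) + up (nat Q) (nat (- Q - z)) =
        ((pot z + pot Q - pot (z + Q)) + (pot (z + Q) + pot (- Q) - pot z)) / abar Q"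
      by (simp only: add_divide_distrib)
    also have "\<dots> = 1" using aQ by simp
    finally show ?thesis by simp
  qed
  also have "1 - (1 - up (nat Q) (nat (- Q - z))) \<le> \<eta>" using upQ[of "nat (- Q - z)"] by simp
  finally show ?thesis .
qed

text \<open>A path that jumps over \<open>R\<close> and then reaches \<open>0\<close> before \<open>R\<close> is counted in
  \<open>P[\<sigma>\<^bsub>[R,\<infinity>)\<^esub> < \<sigma>\<^sub>0] - P[\<sigma>\<^sub>R < \<sigma>\<^sub>0]\<close>; superharmonicity of the potential bounds the
  first term, the explicit formula gives the second.\<close>

lemma overshoot_return:
  shows "(\<integral>\<^sup>+y. hits P 1 (insert 0 {R..}) x y * indicator {R<..} y * hits P 1 {0, R} y 0 \<partial>count_space UNIV)
     + hits P 1 {0, R} x R \<le> ennreal (potd x / ((1 - \<eta>) * abar R))"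
proof -
  define K where "K = insert 0 {R..}"
  have tot: "hits P 1 {0, R} y 0 + hits P 1 {0, R} y R = 1" for y
  proof -
    have "hits P 1 {0, R} y 0 + hits P 1 {0, R} y R = ennreal (hit 1 {0, R} y 0 + hit 1 {0, R} y R)"
      by (simp add: hit_1_ennreal[symmetric])
    also have "hit 1 {0, R} y 0 + hit 1 {0, R} y R = 1" using hit_identities(1)[of "{0, R}" y] R by simp
    finally show ?thesis by simp
  qed
  have "hits P 1 {0, R} x R = hits P 1 K x R +
      (\<integral>\<^sup>+y. hits P 1 K x y * indicator (K - {0, R}) y * hits P 1 {0, R} y R \<partial>count_space UNIV)"
    by (rule hits_decomp) (auto simp: K_def)
  also have "K - {0, R} = {R<..}" using R by (auto simp: K_def)
  finally have "(\<integral>\<^sup>+y. hits P 1 K x y * indicator {R<..} y * hits P 1 {0, R} y 0 \<partial>count_space UNIV) + hits P 1 {0, R} x R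
    = (\<integral>\<^sup>+y. hits P 1 K x y * indicator {R<..} y * hits P 1 {0, R} y 0 \<partial>count_space UNIV) +
       ((\<integral>\<^sup>+y. hits P 1 K x y * indicator {R} y \<partial>count_space UNIV) +
       (\<integral>\<^sup>+y. hits P 1 K x y * indicator {R<..} y * hits P 1 {0, R} y R \<partial>count_space UNIV))" by simp
  also have "\<dots> = (\<integral>\<^sup>+y. hits P 1 K x y * indicator {R<..} y * hits P 1 {0, R} y 0 +
       (hits P 1 K x y * indicator {R} y + hits P 1 K x y * indicator {R<..} y * hits P 1 {0, R} y R) \<partial>count_space UNIV)"
    by (simp add: nn_integral_add)
  also have "\<dots> = (\<integral>\<^sup>+y. hits P 1 K x y * indicator {R..} y \<partial>count_space UNIV)"
  proof (rule nn_integral_cong)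
    fix y
    consider "y < R" | "y = R" | "R < y" by linarith
    then show "hits P 1 K x y * indicator {R<..} y * hits P 1 {0, R} y 0 +
       (hits P 1 K x y * indicator {R} y + hits P 1 K x y * indicator {R<..} y * hits P 1 {0, R} y R)
       = hits P 1 K x y * indicator {R..} y"
    proof cases
      case 3
      have "hits P 1 K x y * hits P 1 {0, R} y 0 + hits P 1 K x y * hits P 1 {0, R} y R = hits P 1 K x y * 1"
        unfolding tot[of y, symmetric] by (rule distrib_left[symmetric])
      then show ?thesis using 3 by simp
    qed auto
  qed
  also have "\<dots> = (\<integral>\<^sup>+y. hits P 1 K x y \<partial>count_space {R..})" by (simp add: nn_integral_count_space_indicator)
  also have "\<dots> = (\<Sum>n. hits P 1 K x (R + int n))"
    unfolding nn_integral_count_space_nat[symmetric]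
    by (rule nn_integral_bij_count_space[symmetric])
       (auto simp: bij_betw_def inj_on_def image_iff intro!: bexI[of _ "nat (_ - R)"] exI[of _ "nat (_ - R)"])
  also have "\<dots> \<le> ennreal (potd x / ((1 - \<eta>) * abar R))"
  proof (rule suminf_le_const)
    fix n
    have c: "0 < (1 - \<eta>) * abar R" using \<eta> aR by simp
    have "(\<Sum>k<n. hits P 1 K x (R + int k)) = (\<Sum>k<n. ennreal (hit 1 K x (R + int k)))"
      by (intro sum.cong refl hit_1_ennreal) (simp add: K_def)
    also have "\<dots> = ennreal (\<Sum>k<n. hit 1 K x (R + int k))" by (rule sum_ennreal) simp
    also have "\<dots> \<le> ennreal (potd x / ((1 - \<eta>) * abar R))"
    proof (rule ennreal_leI)
      have "(\<Sum>k<n. hit 1 K x (R + int k)) * ((1 - \<eta>) * abar R) \<le> (\<Sum>k<n. hit 1 K x (R + int k) * pot (R + int k))"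
        unfolding sum_distrib_right using low by (intro sum_mono mult_left_mono) auto
      also have "\<dots> = (\<Sum>y\<in>(\<lambda>k. R + int k) ` {..<n}. hit 1 K x y * pot y)"
        by (subst sum.reindex) (auto simp: inj_on_def)
      also have "\<dots> \<le> potd x" using R by (intro pot_superharmonic) (auto simp: K_def)
      finally show "(\<Sum>k<n. hit 1 K x (R + int k)) \<le> potd x / ((1 - \<eta>) * abar R)"
        using c by (simp add: pos_le_divide_eq)
    qed
    finally show "(\<Sum>k<n. hits P 1 K x (R + int k)) \<le> ennreal (potd x / ((1 - \<eta>) * abar R))" .
  qed simp
  finally show ?thesis unfolding K_def .
qed

text \<open>The difference \<open>exit_prob x - esc x\<close> is the probability \<open>J 0\<close>
  of leaving the interval before 0 at a point other than \<open>- Q\<close> and \<open>R\<close> and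
  then hitting 0 before these two points. Exits below are covered by \<open>hit_0_below\<close>,
  exits above by \<open>overshoot_return\<close>.\<close>

lemma exit_prob:
  assumes x: "x < R" and \<delta>: "0 < \<delta>" "\<delta> \<le> 1 / 4"
    and cond: "\<bar>pot Q - pot (x + Q)\<bar> + \<bar>pot (- R) - pot (x - R)\<bar> \<le> \<delta> * potd x"
  shows "esc x \<le> exit_prob x" "exit_prob x - esc x \<le> (5 * \<eta> + 2 * \<delta>) * exit_prob x" "0 \<le> exit_prob x"
proof -
  define V where "V = UNIV - {- Q<..<R}"
  define K where "K = insert 0 V"
  define e where "e = (\<integral>\<^sup>+y. hits P 1 K x y * indicator V y \<partial>count_space UNIV)"
  define J where "J b = (\<integral>\<^sup>+z. hits P 1 K x z * indicator (K - tri) z * hits P 1 tri z b \<partial>count_space UNIV)" for b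
  have sub: "tri \<subseteq> K" using Q R by (auto simp: K_def V_def)
  have V0: "0 \<notin> V" using Q R by (simp add: V_def)
  have dec: "hits P 1 tri x b = hits P 1 K x b + J b" for b
    unfolding J_def by (rule hits_decomp[OF sub]) simp
  have tot: "(\<Sum>b\<in>tri. hits P 1 tri z b) = 1" for z
  proof -
    have "(\<Sum>b\<in>tri. hits P 1 tri z b) = (\<Sum>b\<in>tri. ennreal (hit 1 tri z b))"
      by (intro sum.cong refl hit_1_ennreal)
    also have "\<dots> = ennreal (\<Sum>b\<in>tri. hit 1 tri z b)" by (rule sum_ennreal) simp
    finally show ?thesis using hit_identities(1)[of tri z] by simp
  qed
  have "1 = (\<Sum>b\<in>tri. hits P 1 K x b) + (\<Sum>b\<in>tri. J b)"
    using tot[of x] by (simp only: dec sum.distrib)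
  also have "(\<Sum>b\<in>tri. J b) = (\<integral>\<^sup>+z. hits P 1 K x z * indicator (K - tri) z * (\<Sum>b\<in>tri. hits P 1 tri z b) \<partial>count_space UNIV)"
    unfolding J_def by (simp only: sum_distrib_left) (rule nn_integral_sum[symmetric], simp)
  also have "\<dots> = (\<integral>\<^sup>+z. hits P 1 K x z * indicator (K - tri) z \<partial>count_space UNIV)" by (simp only: tot mult_1_right)
  also have "(\<Sum>b\<in>tri. hits P 1 K x b) = (\<integral>\<^sup>+z. hits P 1 K x z * indicator tri z \<partial>count_space UNIV)"
    using nn_integral_count_space_finite_indicator[of tri "hits P 1 K x" "\<lambda>_. 1"] by simp
  also have "\<dots> + (\<integral>\<^sup>+z. hits P 1 K x z * indicator (K - tri) z \<partial>count_space UNIV) =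
     (\<integral>\<^sup>+z. hits P 1 K x z * indicator tri z + hits P 1 K x z * indicator (K - tri) z \<partial>count_space UNIV)"
    by (rule nn_integral_add[symmetric]) auto
  also have "\<dots> = (\<integral>\<^sup>+z. hits P 1 K x z * indicator {0} z + hits P 1 K x z * indicator V z \<partial>count_space UNIV)"
    using sub V0 by (intro nn_integral_cong) (auto simp: K_def indicator_def)
  also have "\<dots> = hits P 1 K x 0 + e"
    unfolding e_def by (subst nn_integral_add) auto
  finally have 1: "hits P 1 K x 0 + e = 1" by simp
  have fin: "hits P 1 K x 0 < top" "e < top" using 1 by (auto simp: less_top[symmetric])
  \<comment> \<open>Dropping the barrier at \<open>- Q\<close> only enlarges the contribution of the
    exits above \<open>R\<close>, and makes it the one-sided quantity of
    \<open>overshoot_return\<close>.\<close>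
  define J' where "J' = (\<integral>\<^sup>+y. hits P 1 (insert 0 {R..}) x y * indicator {R<..} y * hits P 1 {0, R} y 0 \<partial>count_space UNIV)"
  have J0: "J 0 \<le> ennreal \<eta> * e + J'"
  proof -
    have "J 0 \<le> (\<integral>\<^sup>+z. ennreal \<eta> * (hits P 1 K x z * indicator V z) +
        hits P 1 (insert 0 {R..}) x z * indicator {R<..} z * hits P 1 {0, R} z 0 \<partial>count_space UNIV)"
      unfolding J_def
    proof (rule nn_integral_mono)
      fix z
      consider "z \<notin> K - tri" | "z \<in> V" "z < - Q" | "z \<in> V" "R < z" using V0 by (force simp: K_def V_def)
      then show "hits P 1 K x z * indicator (K - tri) z * hits P 1 tri z 0 \<le> ennreal \<eta> * (hits P 1 K x z * indicator V z) +
        hits P 1 (insert 0 {R..}) x z * indicator {R<..} z * hits P 1 {0, R} z 0"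
      proof cases
        case 2
        have "hits P 1 tri z 0 = ennreal (hit 1 tri z 0)" by (rule hit_1_ennreal) simp
        also have "\<dots> \<le> ennreal \<eta>" by (intro ennreal_leI hit_0_below 2)
        finally have "hits P 1 K x z * indicator (K - tri) z * hits P 1 tri z 0 \<le> hits P 1 K x z * 1 * ennreal \<eta>"
          by (intro mult_mono) (auto simp: indicator_def)
        then show ?thesis using 2 Q R by (simp add: mult.commute)
      next
        case 3
        have "hits P 1 K x z * indicator (K - tri) z * hits P 1 tri z 0 \<le>
            hits P 1 (insert 0 {R..}) x z * indicator {R<..} z * hits P 1 {0, R} z 0"
          using 3 by (intro mult_mono hits_antimono) (auto simp: K_def V_def indicator_def)
        then show ?thesis by (rule order_trans) simp
      qed simp
    qed
    also have "\<dots> = ennreal \<eta> * e + J'" unfolding e_def J'_def by (simp add: nn_integral_add nn_integral_cmult)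
    finally show ?thesis .
  qed
  define \<beta> where "\<beta> = hit 1 {0, R} x R"
  have \<beta>: "hits P 1 {0, R} x R = ennreal \<beta>" "0 \<le> \<beta>" unfolding \<beta>_def by (auto intro: hit_1_ennreal)
  have J': "J' + ennreal \<beta> \<le> ennreal (potd x / ((1 - \<eta>) * abar R))"
    using overshoot_return[of x] unfolding J'_def \<beta>(1) .
  have finJ': "J' < top" using order_le_less_trans[OF J' ennreal_less_top] by simp
  define p where "p = potd x / abar R"
  have p: "0 \<le> p" using pot_nonneg[of x] abar_nonneg[of R] by (simp add: p_def potd_def)
  have "enn2real J' + \<beta> \<le> potd x / ((1 - \<eta>) * abar R)"
  proof -
    have "0 \<le> potd x / ((1 - \<eta>) * abar R)" using pot_nonneg[of x] aR \<eta> by (simp add: potd_def)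
    moreover have "ennreal (enn2real J' + \<beta>) \<le> ennreal (potd x / ((1 - \<eta>) * abar R))"
      using J' finJ' \<beta>(2) by simp
    ultimately show ?thesis by simp
  qed
  also have "\<dots> = p * (1 / (1 - \<eta>))" by (simp add: p_def mult.commute)
  also have "\<dots> \<le> p * (1 + 2 * \<eta>)"
  proof (intro mult_left_mono p)
    have "\<eta> * \<eta> * 2 \<le> \<eta> * 1" using mult_left_mono[of "2 * \<eta>" 1 \<eta>] \<eta> by simp
    then have "1 \<le> (1 + 2 * \<eta>) * (1 - \<eta>)" by (simp add: algebra_simps)
    then show "1 / (1 - \<eta>) \<le> 1 + 2 * \<eta>" using \<eta> by (simp add: pos_divide_le_eq)
  qed
  finally have J'\<beta>: "enn2real J' + \<beta> \<le> p + 2 * (\<eta> * p)" by (simp add: algebra_simps)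
  \<comment> \<open>The side condition enters here: it keeps \<open>\<beta>\<close>, the probability
    of hitting \<open>R\<close> before 0, close to \<open>p\<close>, so little is left for
    overshooting paths that return.\<close>
  have \<beta>_low: "p - \<delta> * p \<le> \<beta>"
  proof -
    have "\<beta> * abar R = potd x + pot (- R) - pot (x - R)"
      using hit_two_points[of R x] R x by (simp add: \<beta>_def potd_def)
    then have "potd x - \<delta> * potd x \<le> \<beta> * abar R" using cond by linarith
    then have "(potd x - \<delta> * potd x) / abar R \<le> \<beta>" using aR by (simp add: pos_divide_le_eq)
    then show ?thesis by (simp add: p_def diff_divide_distrib)
  qed
  have "\<delta> * p \<le> 1 / 2 * p" using \<delta> p by (intro mult_right_mono) auto
  then have "p \<le> 2 * \<beta>" using \<beta>_low by linarith
  then have "(2 * \<eta> + \<delta>) * p \<le> (2 * \<eta> + \<delta>) * (2 * \<beta>)" using \<eta> \<delta> by (intro mult_left_mono) auto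
  moreover have "enn2real J' \<le> (2 * \<eta> + \<delta>) * p" using J'\<beta> \<beta>_low by (simp add: algebra_simps)
  ultimately have J'_le: "enn2real J' \<le> (4 * \<eta> + 2 * \<delta>) * \<beta>" by (simp add: algebra_simps)
  have "ennreal \<beta> \<le> e"
  proof -
    have "ennreal \<beta> = hits P 1 K x R +
      (\<integral>\<^sup>+y. hits P 1 K x y * indicator (K - {0, R}) y * hits P 1 {0, R} y R \<partial>count_space UNIV)"
      unfolding \<beta>(1)[symmetric] by (rule hits_decomp) (use sub in auto)
    also have "\<dots> = (\<integral>\<^sup>+y. hits P 1 K x y * indicator {R} y + hits P 1 K x y * indicator (K - {0, R}) y * hits P 1 {0, R} y R \<partial>count_space UNIV)"
      by (simp add: nn_integral_add)
    also have "\<dots> \<le> e" unfolding e_def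
    proof (rule nn_integral_mono)
      fix y
      have "hits P 1 K x y * hits P 1 {0, R} y R \<le> hits P 1 K x y * 1" by (intro mult_left_mono hits_le_1) auto
      then show "hits P 1 K x y * indicator {R} y + hits P 1 K x y * indicator (K - {0, R}) y * hits P 1 {0, R} y R
          \<le> hits P 1 K x y * indicator V y"
        using R by (auto simp: K_def V_def indicator_def)
    qed
    finally show ?thesis .
  qed
  then have \<beta>e: "\<beta> \<le> enn2real e" using enn2real_mono[of "ennreal \<beta>" e] fin \<beta>(2) by simp
  have finJ: "J 0 < top" using J0 fin finJ' by (auto intro: order_le_less_trans simp: ennreal_mult_less_top)
  have ex: "exit_prob x = enn2real e" by (simp add: exit_prob_def e_def K_def V_def)
  have r1: "enn2real (hits P 1 K x 0) + enn2real e = 1" using arg_cong[OF 1, of enn2real] fin by (simp add: enn2real_plus)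
  have "hit 1 tri x 0 = enn2real (hits P 1 K x 0) + enn2real (J 0)"
    using dec[of 0] fin finJ by (simp add: enn2real_plus)
  then have es: "esc x = enn2real e - enn2real (J 0)" using r1 by (simp add: esc_def)
  have "enn2real (J 0) \<le> enn2real (ennreal \<eta> * e + J')"
    using J0 fin finJ' by (intro enn2real_mono) (auto simp: ennreal_mult_less_top)
  also have "\<dots> = \<eta> * enn2real e + enn2real J'"
    using \<eta> fin finJ' by (simp add: enn2real_plus enn2real_mult ennreal_mult_less_top)
  also have "(4 * \<eta> + 2 * \<delta>) * \<beta> \<le> (4 * \<eta> + 2 * \<delta>) * enn2real e" using \<beta>e \<eta> \<delta> by (intro mult_left_mono) auto
  then have "\<eta> * enn2real e + enn2real J' \<le> (5 * \<eta> + 2 * \<delta>) * enn2real e" using J'_le by (simp add: algebra_simps)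
  finally show "esc x \<le> exit_prob x" "exit_prob x - esc x \<le> (5 * \<eta> + 2 * \<delta>) * exit_prob x" "0 \<le> exit_prob x"
    unfolding ex es by auto
qed

text \<open>The expression \<open>T\<close> is what \<open>esc_0\<close> gives for
  \<open>qq = 0\<close>. Only \<open>qq\<close> is small; \<open>pp\<close> need not be, and it is
  kept exactly inside \<open>T\<close>.\<close>

lemma esc_0_bounds:
  defines "T \<equiv> (pot (Q + R) + pot (- Q) + pot (- R)) / ((pot Q + pot (- Q)) * (pot R + pot (- R)))"
  shows "(1 - qq) * T \<le> esc 0" "esc 0 * (1 - qq) \<le> T"
proof -
  define g h where "g = 1 / abar Q" and "h = 1 / abar R * (1 - pp)"
  have gh: "0 \<le> g" "0 \<le> h" using aQ aR pp by (auto simp: g_def h_def)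
  have T: "T = g + h"
  proof -
    have "1 - pp = (pot (- Q) - pot R + pot (Q + R)) / abar Q" using aQ by (simp add: pp_def field_simps add.commute)
    then show ?thesis unfolding T_def g_def h_def using aQ aR by (simp add: field_simps)
  qed
  have e: "(1 - pp * qq) * esc 0 = g * (1 - qq) + h" using esc_0 by (simp add: g_def h_def)
  have "(1 - qq) * T \<le> (1 - pp * qq) * esc 0"
    unfolding e T using mult_left_le[of "1 - qq" h] gh qq by (simp add: algebra_simps)
  also have "\<dots> \<le> 1 * esc 0" using esc_0_pos pp qq by (intro mult_right_mono) auto
  finally show "(1 - qq) * T \<le> esc 0" by simp
  have "esc 0 * (1 - qq) \<le> (1 - pp * qq) * esc 0"
    using mult_right_mono[of "1 - qq" "1 - pp * qq" "esc 0"] pq esc_0_pos by (simp add: mult.commute)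
  also have "\<dots> \<le> T" unfolding e T using gh qq mult_left_le[of "1 - qq" g] by simp
  finally show "esc 0 * (1 - qq) \<le> T" .
qed

end

end

lemma window:
  assumes "0 < \<eta>"
  obtains N where "\<And>R. N \<le> R \<Longrightarrow> 0 < R \<Longrightarrow>
    pot (- R) \<le> \<eta> * abar R \<and> (\<forall>w. up (nat R) w \<le> \<eta>) \<and> (\<forall>y\<ge>R. (1 - \<eta>) * abar R \<le> pot y)"
proof -
  obtain N where N: "1 \<le> N" "\<And>R. N \<le> R \<Longrightarrow> pot (- int R) \<le> \<eta> * abar (int R)"
    "\<And>R w. N \<le> R \<Longrightarrow> up R w \<le> \<eta>" by (rule up_small[OF assms]) blast
  obtain N' where N': "\<And>R y. int N' \<le> R \<Longrightarrow> R \<le> y \<Longrightarrow> (1 - \<eta>) * abar R \<le> pot y"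
    by (rule pot_eventually_ge[OF assms]) blast
  show ?thesis
  proof (rule that[of "int (N + N')"])
    fix R :: int assume R: "int (N + N') \<le> R" "0 < R"
    then have "N \<le> nat R" "int N' \<le> R" by linarith+
    then show "pot (- R) \<le> \<eta> * abar R \<and> (\<forall>w. up (nat R) w \<le> \<eta>) \<and> (\<forall>y\<ge>R. (1 - \<eta>) * abar R \<le> pot y)"
      using N(2)[of "nat R"] N(3)[of "nat R"] N'[of R] R(2) by simp
  qed
qed

lemma exit_asymp:
  assumes "0 < \<epsilon>"
  obtains \<delta> N where "0 < \<delta>" "\<And>Q R x. 0 < Q \<Longrightarrow> 0 < R \<Longrightarrow> N \<le> Q \<Longrightarrow> N \<le> R \<Longrightarrow> - Q < x \<Longrightarrow> x < R \<Longrightarrow>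
     potd x \<noteq> 0 \<Longrightarrow> \<bar>pot Q - pot (x + Q)\<bar> + \<bar>pot (- R) - pot (x - R)\<bar> \<le> \<delta> * potd x \<Longrightarrow>
     \<bar>exit_prob Q R x / (potd x * esc Q R 0) - 1\<bar> < \<epsilon>"
proof -
  \<comment> \<open>The three constants are tuned to
    \<open>5 * \<eta> + 2 * \<delta> = 2 * \<theta>\<close>, so that \<open>exit_prob\<close>
    delivers the form used in \<open>two_sided_ratio\<close>.\<close>
  define \<theta> where "\<theta> = min (1 / 8) (\<epsilon> / 16)"
  define \<delta> where "\<delta> = \<theta> / 2"
  define \<eta> where "\<eta> = \<theta> / 5"
  have \<theta>: "0 < \<theta>" "\<theta> \<le> 1 / 8" "\<theta> \<le> \<epsilon> / 16" using assms by (auto simp: \<theta>_def)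
  have \<eta>: "0 < \<eta>" "\<eta> \<le> 1 / 8" and \<delta>: "0 < \<delta>" "\<delta> \<le> 1 / 4" "\<delta> \<le> \<epsilon> / 4" using \<theta> by (simp_all add: \<eta>_def \<delta>_def)
  have sum: "5 * \<eta> + 2 * \<delta> = 2 * \<theta>" by (simp add: \<eta>_def \<delta>_def)
  obtain N where N: "\<And>R. N \<le> R \<Longrightarrow> 0 < R \<Longrightarrow>
      pot (- R) \<le> \<eta> * abar R \<and> (\<forall>w. up (nat R) w \<le> \<eta>) \<and> (\<forall>y\<ge>R. (1 - \<eta>) * abar R \<le> pot y)"
    by (rule window[OF \<eta>(1)]) blast
  show ?thesis
  proof (rule that[OF \<delta>(1), of N])
    fix Q R x :: int
    assume QR: "0 < Q" "0 < R" "N \<le> Q" "N \<le> R" and x: "- Q < x" "x < R" "potd x \<noteq> 0"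
      and cond: "\<bar>pot Q - pot (x + Q)\<bar> + \<bar>pot (- R) - pot (x - R)\<bar> \<le> \<delta> * potd x"
    have a: "pot (- Q) \<le> \<eta> * abar Q" "pot (- R) \<le> \<eta> * abar R" "up (nat Q) w \<le> \<eta>" "up (nat R) w \<le> \<eta>"
        "R \<le> y \<Longrightarrow> (1 - \<eta>) * abar R \<le> pot y" for w y
      using N[of Q] N[of R] QR by auto
    have px: "0 < potd x" using x(3) pot_nonneg[of x] by (auto simp: potd_def less_le)
    have s: "0 < potd x * esc Q R 0" using px esc_0_pos[OF QR(1,2) \<eta> a] by simp
    show "\<bar>exit_prob Q R x / (potd x * esc Q R 0) - 1\<bar> < \<epsilon>"
      by (rule two_sided_ratio[OF s esc_approx[OF QR(1,2) \<eta> a x(1,2) cond]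
        exit_prob[OF QR(1,2) \<eta> a x(2) \<delta>(1,2) cond, unfolded sum] assms \<delta> \<theta>])
  qed
qed

lemma esc_asymp:
  assumes "0 < \<epsilon>"
  obtains N where "\<And>Q R x. 0 < Q \<Longrightarrow> 0 < R \<Longrightarrow> N \<le> Q \<Longrightarrow> N \<le> R \<Longrightarrow> potd x \<noteq> 0 \<Longrightarrow>
     \<bar>potd x * esc Q R 0 / (potd x * (pot (Q + R) / (pot Q * pot R))) - 1\<bar> < \<epsilon>"
proof -
  define \<eta> where "\<eta> = min (1 / 8) (\<epsilon> / 32)"
  have \<eta>: "0 < \<eta>" "\<eta> \<le> 1 / 8" using assms by (auto simp: \<eta>_def)
  obtain N where N: "\<And>R. N \<le> R \<Longrightarrow> 0 < R \<Longrightarrow> pot (- R) \<le> \<eta> * abar R \<and> (\<forall>w. up (nat R) w \<le> \<eta>) \<and> (\<forall>y\<ge>R. (1 - \<eta>) * abar R \<le> pot y)"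
    by (rule window[OF \<eta>(1)]) blast
  show ?thesis
  proof (rule that[of N])
    fix Q R x :: int
    assume QR: "0 < Q" "0 < R" "N \<le> Q" "N \<le> R" and x: "potd x \<noteq> 0"
    have a: "pot (- Q) \<le> \<eta> * abar Q" "pot (- R) \<le> \<eta> * abar R" "up (nat Q) w \<le> \<eta>" "up (nat R) w \<le> \<eta>"
        "R \<le> y \<Longrightarrow> (1 - \<eta>) * abar R \<le> pot y" for w y
      using N[of Q] N[of R] QR by auto
    have pos: "0 < pot u" if "0 < u" "pot (- u) \<le> \<eta> * abar u" for u
    proof (rule ccontr)
      assume "\<not> 0 < pot u"
      then have "pot u = 0" using pot_nonneg[of u] by simp
      then have "abar u \<le> 1 / 8 * abar u"
        using that(2) \<eta> mult_right_mono[of \<eta> "1 / 8" "abar u"] abar_nonneg[of u] by simp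
      then show False using abar_pos[of u] that(1) by simp
    qed
    have z: "pot Q \<le> pot (Q + R) + pot (- R)" "pot R \<le> pot (Q + R) + pot (- Q)"
      using pot_subadd[of "Q + R" "- R"] pot_subadd[of "Q + R" "- Q"] by simp_all
    note b = esc_0_bounds[OF QR(1,2) \<eta> a] and q = qq[OF QR(1,2) \<eta> a]
    have "\<bar>esc Q R 0 / (pot (Q + R) / (pot Q * pot R)) - 1\<bar> < \<epsilon>"
      by (rule product_ratio(2)[OF pos[OF QR(1) a(1)] pot_nonneg a(1) pos[OF QR(2) a(2)] pot_nonneg a(2) z q b assms \<eta>_def])
    then show "\<bar>potd x * esc Q R 0 / (potd x * (pot (Q + R) / (pot Q * pot R))) - 1\<bar> < \<epsilon>"
      unfolding mult_divide_mult_cancel_left[OF x] .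
  qed
qed

end

section \<open>Transfer to the random walk\<close>

lemma pmf_of_law:
  assumes "prob_space M" "iid M X"
  obtains P where "measure_pmf P = distr M (count_space UNIV) (X 0)"
proof -
  interpret D: prob_space "distr M (count_space UNIV) (X 0)"
    using iid_measurable[OF assms] by (rule prob_space.prob_space_distr[OF assms(1)])
  have "AE k in distr M (count_space UNIV) (X 0). measure (distr M (count_space UNIV) (X 0)) {k} \<noteq> 0"
    by (subst D.AE_support_countable) (auto intro!: exI[of _ UNIV])
  then have "measure_pmf (Abs_pmf (distr M (count_space UNIV) (X 0))) = distr M (count_space UNIV) (X 0)"
    by (intro Abs_pmf_inverse) (auto intro: D.prob_space_axioms)
  then show ?thesis by (rule that)
qed

text \<open>Layer-cake formula by Fubini. At integers it identifies the integrated tail with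
  \<open>pos_tail_exp\<close>.\<close>

lemma integral_tail_prob:
  fixes P :: "int pmf"
  shows "(LINT y:{x..}|lborel. measure_pmf.prob P {k. y < real_of_int k}) =
    measure_pmf.expectation P (\<lambda>k. max 0 (real_of_int k - x))"
proof -
  interpret pair_sigma_finite "measure_pmf P" lborel
    by (simp add: pair_sigma_finite_def lborel.sigma_finite_measure_axioms measure_pmf.sigma_finite_measure_axioms)
  have "mono (\<lambda>y. - measure_pmf.prob P {k. y < real_of_int k})"
    by (intro monoI) (auto intro!: measure_pmf.finite_measure_mono)
  then have "(\<lambda>y. - measure_pmf.prob P {k. y < real_of_int k}) \<in> borel_measurable borel" by (rule borel_measurable_mono)
  then have [measurable]: "(\<lambda>y. measure_pmf.prob P {k. y < real_of_int k}) \<in> borel_measurable borel"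
    using borel_measurable_uminus_eq by blast
  have "(\<integral>\<^sup>+y. ennreal (indicator {x..} y *\<^sub>R measure_pmf.prob P {k. y < real_of_int k}) \<partial>lborel)
    = (\<integral>\<^sup>+y. \<integral>\<^sup>+k. indicator {(k, y). x \<le> y \<and> y < real_of_int k} (k, y) \<partial>measure_pmf P \<partial>lborel)"
  proof (rule nn_integral_cong)
    fix y :: real
    have "(\<integral>\<^sup>+k. indicator {(k, y). x \<le> y \<and> y < real_of_int k} (k, y) \<partial>measure_pmf P) =
       (\<integral>\<^sup>+k. indicator {x..} y * indicator {k. y < real_of_int k} k \<partial>measure_pmf P)"
      by (intro nn_integral_cong) (auto simp: indicator_def)
    also have "\<dots> = indicator {x..} y * emeasure (measure_pmf P) {k. y < real_of_int k}"
      by (simp add: nn_integral_cmult)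
    finally show "ennreal (indicator {x..} y *\<^sub>R measure_pmf.prob P {k. y < real_of_int k}) =
      (\<integral>\<^sup>+k. indicator {(k, y). x \<le> y \<and> y < real_of_int k} (k, y) \<partial>measure_pmf P)"
      by (auto simp: indicator_def measure_pmf.emeasure_eq_measure)
  qed
  also have "\<dots> = (\<integral>\<^sup>+k. \<integral>\<^sup>+y. indicator {(k, y). x \<le> y \<and> y < real_of_int k} (k, y) \<partial>lborel \<partial>measure_pmf P)"
    by (rule Fubini) measurable
  also have "\<dots> = (\<integral>\<^sup>+k. ennreal (max 0 (real_of_int k - x)) \<partial>measure_pmf P)"
  proof (rule nn_integral_cong)
    fix k :: int
    have "(\<integral>\<^sup>+y. indicator {(k, y). x \<le> y \<and> y < real_of_int k} (k, y) \<partial>lborel) =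
      (\<integral>\<^sup>+y. indicator {x..<real_of_int k} y \<partial>lborel)"
      by (intro nn_integral_cong) (auto simp: indicator_def)
    then show "(\<integral>\<^sup>+y. indicator {(k, y). x \<le> y \<and> y < real_of_int k} (k, y) \<partial>lborel) = ennreal (max 0 (real_of_int k - x))"
      by (cases "x \<le> real_of_int k") auto
  qed
  finally show ?thesis unfolding set_lebesgue_integral_def
    by (subst integral_eq_nn_integral, simp, simp, subst integral_eq_nn_integral) auto
qed

text \<open>This is the function \<open>m_+\<close> of a law; \<open>m_-\<close> is obtained from
  the reflected law.\<close>

definition integrated_tail :: "int pmf \<Rightarrow> real \<Rightarrow> real" where
  "integrated_tail P x = (LINT s:{0..x}|lborel. LINT y:{s..}|lborel. measure_pmf.prob P {k. y < real_of_int k})"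

text \<open>The inner integral decreases, so on each unit interval it lies between its values at the
  ends. The Lipschitz bound only serves to make it integrable.\<close>

lemma integrated_tail_bounds:
  assumes int: "integrable (measure_pmf P) real_of_int"
  shows "integrated_tail P (real n) \<le> (\<Sum>j<n. pos_tail_exp P j)" "(\<Sum>j<n. pos_tail_exp P (Suc j)) \<le> integrated_tail P (real n)"
proof -
  define h where "h s = measure_pmf.expectation P (\<lambda>k. max 0 (real_of_int k - s))" for s
  have i: "integrable (measure_pmf P) (\<lambda>k. max 0 (real_of_int k - s))" for s using int by simp
  have anti: "h t \<le> h s" if "s \<le> t" for s t unfolding h_def using that by (intro integral_mono i) auto
  have lip: "h s \<le> h t + (t - s)" if "s \<le> t" for s t
  proof -
    have "h s \<le> measure_pmf.expectation P (\<lambda>k. max 0 (real_of_int k - t) + (t - s))"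
      unfolding h_def using that i by (intro integral_mono) auto
    also have "\<dots> = h t + (t - s)" unfolding h_def using i by simp
    finally show ?thesis .
  qed
  have "1-lipschitz_on UNIV h"
  proof (rule lipschitz_onI)
    fix s t show "dist (h s) (h t) \<le> 1 * dist s t"
      using anti[of s t] anti[of t s] lip[of s t] lip[of t s] by (cases "s \<le> t") (auto simp: dist_real_def)
  qed simp
  then have cont: "continuous_on S h" for S using lipschitz_on_continuous_on continuous_on_subset by blast
  have ion: "h integrable_on {a..b}" for a b using cont by (intro integrable_continuous_interval)
  have eq: "integrated_tail P x = integral {0..x} h" for x
  proof -
    have "integrated_tail P x = (LINT s:{0..x}|lborel. h s)" unfolding integrated_tail_def integral_tail_prob h_def ..
    also have "\<dots> = integral {0..x} h" by (intro set_borel_integral_eq_integral(2) borel_integrable_atLeastAtMost' cont)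
    finally show ?thesis .
  qed
  have hp: "h (real j) = pos_tail_exp P j" for j
    unfolding h_def pos_tail_exp_def by (intro Bochner_Integration.integral_cong refl) (auto simp: max_def nat_diff_distrib)
  have step: "integrated_tail P (real (Suc n)) = integrated_tail P (real n) + integral {real n..real (Suc n)} h" for n
    unfolding eq by (rule Henstock_Kurzweil_Integration.integral_combine[symmetric]) (auto intro: ion)
  have le: "integral {real n..real (Suc n)} h \<le> h (real n)" for n
  proof -
    have "integral {real n..real (Suc n)} h \<le> integral {real n..real (Suc n)} (\<lambda>_. h (real n))"
      by (intro integral_le ion) (auto intro: anti)
    then show ?thesis by simp
  qed
  have ge: "h (real (Suc n)) \<le> integral {real n..real (Suc n)} h" for n
  proof -
    have "integral {real n..real (Suc n)} (\<lambda>_. h (real (Suc n))) \<le> integral {real n..real (Suc n)} h"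
      by (intro integral_le ion) (auto intro: anti)
    then show ?thesis by simp
  qed
  show "integrated_tail P (real n) \<le> (\<Sum>j<n. pos_tail_exp P j)"
  proof (induction n)
    case (Suc n)
    then show ?case unfolding step using le[of n] by (simp add: hp)
  qed (simp add: eq)
  show "(\<Sum>j<n. pos_tail_exp P (Suc j)) \<le> integrated_tail P (real n)"
  proof (induction n)
    case (Suc n)
    then show ?case unfolding step using ge[of n] unfolding hp by simp
  qed (simp add: eq)
qed

lemma tail_exp_split:
  assumes int: "integrable (measure_pmf P) real_of_int"
  shows "tail_exp P j = pos_tail_exp P j + pos_tail_exp (map_pmf uminus P) j"
proof -
  have i: "integrable (measure_pmf P) (\<lambda>k. real (nat k - j))" "integrable (measure_pmf P) (\<lambda>k. real (nat (- k) - j))"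
    by (rule Bochner_Integration.integrable_bound[OF int]; simp)+
  have "tail_exp P j = measure_pmf.expectation P (\<lambda>k. real (nat k - j) + real (nat (- k) - j))"
    unfolding tail_exp_def by (intro Bochner_Integration.integral_cong refl) auto
  also have "\<dots> = pos_tail_exp P j + pos_tail_exp (map_pmf uminus P) j"
    using i by (simp add: pos_tail_exp_def)
  finally show ?thesis .
qed

lemma filterlim_sum_at_top:
  fixes u :: "nat \<Rightarrow> real"
  assumes "\<And>j. 0 \<le> u j" "(\<Sum>j. ennreal (u j)) = \<infinity>"
  shows "filterlim (\<lambda>n. \<Sum>j<n. u j) at_top sequentially"
proof (rule ccontr)
  assume "\<not> ?thesis"
  then obtain Z where Z: "\<not> eventually (\<lambda>n. Z \<le> (\<Sum>j<n. u j)) sequentially"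
    unfolding filterlim_at_top by auto
  have "(\<Sum>j<n. u j) \<le> Z" for n
  proof (rule ccontr)
    assume "\<not> (\<Sum>j<n. u j) \<le> Z"
    then have "Z \<le> (\<Sum>j<m. u j)" if "n \<le> m" for m
      using sum_mono2[of "{..<m}" "{..<n}" u] assms(1) that by force
    then show False using Z by (auto simp: eventually_sequentially)
  qed
  then have "summable u" using assms(1) by (intro bounded_imp_summable[of u Z]) (simp_all only: lessThan_Suc_atMost[symmetric])
  then show False using suminf_ennreal2[OF assms(1)] assms(2) by simp
qed

text \<open>At \<open>n = k\<close>, \<open>trunc_ge\<close> reads
  \<open>k^2 \<le> 2 * trunc k k\<close>, so the series of the \<open>tail_exp\<close> inherits the
  divergence of the second moment.\<close>

lemma dtail_diverges:
  assumes int: "integrable (measure_pmf P) real_of_int"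
    and sq: "(\<integral>\<^sup>+k. ennreal ((real_of_int k)\<^sup>2) \<partial>measure_pmf P) = \<infinity>"
  shows "filterlim (dtail P) at_top sequentially"
proof -
  have "ennreal (tail_exp P j) = (\<integral>\<^sup>+k. ennreal (real (nat \<bar>k\<bar> - j)) \<partial>measure_pmf P)" for j
    unfolding tail_exp_def
    by (rule nn_integral_eq_integral[symmetric]) (auto intro: Bochner_Integration.integrable_bound[OF int])
  then have "(\<Sum>j. ennreal (tail_exp P j)) = (\<integral>\<^sup>+k. (\<Sum>j. ennreal (real (nat \<bar>k\<bar> - j))) \<partial>measure_pmf P)"
    by (simp add: nn_integral_suminf)
  moreover have "(\<integral>\<^sup>+k. ennreal ((real_of_int k)\<^sup>2) \<partial>measure_pmf P) \<le>
    (\<integral>\<^sup>+k. 2 * (\<Sum>j. ennreal (real (nat \<bar>k\<bar> - j))) \<partial>measure_pmf P)"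
  proof (rule nn_integral_mono)
    fix k :: int
    define m where "m = nat \<bar>k\<bar>"
    have "(real_of_int k)\<^sup>2 = real m * real (min m m)" by (simp add: m_def power2_eq_square flip: abs_mult)
    also have "\<dots> \<le> 2 * trunc m m" by (rule trunc_ge)
    finally have "ennreal ((real_of_int k)\<^sup>2) \<le> ennreal (2 * trunc m m)" by (rule ennreal_leI)
    also have "\<dots> = 2 * (\<Sum>j<m. ennreal (real (m - j)))" by (simp add: trunc_def ennreal_mult' sum_ennreal del: of_nat_diff)
    also have "\<dots> \<le> 2 * (\<Sum>j. ennreal (real (m - j)))" by (intro mult_left_mono sum_le_suminf) auto
    finally show "ennreal ((real_of_int k)\<^sup>2) \<le> 2 * (\<Sum>j. ennreal (real (nat \<bar>k\<bar> - j)))" by (simp add: m_def)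
  qed
  ultimately have "\<infinity> \<le> 2 * (\<Sum>j. ennreal (tail_exp P j))" using sq by (simp add: nn_integral_cmult)
  then have "(\<Sum>j. ennreal (tail_exp P j)) = \<infinity>" by (auto simp: top_unique ennreal_mult_eq_top_iff)
  then show ?thesis unfolding dtail_def[abs_def]
    by (intro filterlim_sum_at_top) (simp_all add: tail_exp_def)
qed

text \<open>Sums and integrals differ by at most the first summand, a constant, while the
  denominators diverge.\<close>

lemma pos_dtail_ratio_tendsto_0:
  assumes int: "integrable (measure_pmf P) real_of_int"
    and top: "filterlim (dtail P) at_top sequentially"
    and lim: "((\<lambda>x. integrated_tail P x / (integrated_tail P x + integrated_tail (map_pmf uminus P) x)) \<longlongrightarrow> 0) at_top"
  shows "(\<lambda>n. pos_dtail P n / dtail P n) \<longlonglongrightarrow> 0"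
proof -
  have int': "integrable (measure_pmf (map_pmf uminus P)) real_of_int" using int by simp
  define A T where "A n = integrated_tail P (real n)" 
    and "T n = integrated_tail P (real n) + integrated_tail (map_pmf uminus P) (real n)" for n
  have nn: "0 \<le> pos_tail_exp P j" "0 \<le> tail_exp P j" for j by (simp_all add: pos_tail_exp_def tail_exp_def)
  have shift: "(\<Sum>j<n. u j) \<le> u 0 + (\<Sum>j<n. u (Suc j))" if "\<And>j. 0 \<le> u j" for u :: "nat \<Rightarrow> real" and n
    using that[of n] sum.lessThan_Suc_shift[of u n] by simp
  have A: "pos_dtail P n \<le> pos_tail_exp P 0 + A n" for n
    unfolding pos_dtail_def A_def
    using shift[of "pos_tail_exp P" n] nn integrated_tail_bounds(2)[OF int, of n] by simp
  have T: "T n \<le> dtail P n" "dtail P n \<le> tail_exp P 0 + T n" for n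
  proof -
    show "T n \<le> dtail P n"
      using integrated_tail_bounds(1)[OF int, of n] integrated_tail_bounds(1)[OF int', of n]
      unfolding T_def dtail_def tail_exp_split[OF int] sum.distrib by linarith
    have "dtail P n \<le> tail_exp P 0 + (\<Sum>j<n. tail_exp P (Suc j))" unfolding dtail_def using nn by (intro shift)
    then show "dtail P n \<le> tail_exp P 0 + T n"
      using integrated_tail_bounds(2)[OF int, of n] integrated_tail_bounds(2)[OF int', of n]
      unfolding T_def tail_exp_split[OF int, of "Suc _"] sum.distrib by linarith
  qed
  have "filterlim (\<lambda>n. - tail_exp P 0 + dtail P n) at_top sequentially"
    by (rule filterlim_tendsto_add_at_top[OF tendsto_const top])
  then have Ttop: "filterlim T at_top sequentially"
    by (rule filterlim_at_top_mono) (use T(2) in \<open>auto simp: algebra_simps\<close>)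
  have "(\<lambda>n. A n / T n) \<longlonglongrightarrow> 0"
    using filterlim_compose[OF lim filterlim_real_sequentially] by (simp add: A_def T_def)
  moreover have "(\<lambda>n. pos_tail_exp P 0 / T n) \<longlonglongrightarrow> 0"
    by (intro tendsto_divide_0[OF tendsto_const] filterlim_at_top_imp_at_infinity Ttop)
  ultimately have "(\<lambda>n. A n / T n + pos_tail_exp P 0 / T n) \<longlonglongrightarrow> 0 + 0" by (rule tendsto_add)
  then have up: "(\<lambda>n. A n / T n + pos_tail_exp P 0 / T n) \<longlonglongrightarrow> 0" by simp
  have dn: "0 \<le> pos_dtail P n" for n unfolding pos_dtail_def using nn by (intro sum_nonneg) auto
  show ?thesis
  proof (rule tendsto_sandwich[OF _ _ tendsto_const up])
    show "eventually (\<lambda>n. 0 \<le> pos_dtail P n / dtail P n) sequentially"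
      using nn dn by (auto simp: dtail_def sum_nonneg)
    have "eventually (\<lambda>n. 1 \<le> T n) sequentially" using Ttop unfolding filterlim_at_top by blast
    then show "eventually (\<lambda>n. pos_dtail P n / dtail P n \<le> A n / T n + pos_tail_exp P 0 / T n) sequentially"
    proof eventually_elim
      case (elim n)
      have "pos_dtail P n / dtail P n \<le> pos_dtail P n / T n"
        using T(1)[of n] elim dn by (intro divide_left_mono) auto
      also have "\<dots> \<le> (pos_tail_exp P 0 + A n) / T n" using A elim by (intro divide_right_mono) auto
      finally show ?case by (simp add: add_divide_distrib)
    qed
  qed
qed

lemma measure_walk:
  assumes "prob_space M" "iid M X" "measure_pmf P = distr M (count_space UNIV) (X 0)"
  shows "measure M {\<omega> \<in> space M. walk X 0 n \<omega> = y} = pmf (walk_pmf P n) y"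
proof -
  interpret prob_space M by fact
  show ?thesis
  proof (cases n)
    case 0
    have "{\<omega> \<in> space M. walk X 0 n \<omega> = y} = (if y = 0 then space M else {})" by (auto simp: walk_def 0)
    then show ?thesis by (simp add: 0 prob_space)
  next
    case (Suc m)
    have "ennreal (measure M {\<omega> \<in> space M. walk X 0 n \<omega> = y}) = ennreal (pmf (walk_pmf P n) y)"
      using emeasure_taboo[OF assms, of m 0 "{}" y] taboo_empty[of P 0 m y] by (simp add: Suc emeasure_eq_measure)
    then show ?thesis by simp
  qed
qed

text \<open>If \<open>char_int P t = 1\<close>, the same holds for every step number, so all
  reachable points \<open>k\<close> satisfy \<open>cos (t * k) = 1\<close>. Irreducibility makes
  \<open>k = 1\<close> reachable.\<close>

lemma char_int_neq_1:
  assumes "prob_space M" "iid M X" "measure_pmf P = distr M (count_space UNIV) (X 0)" "irreducible_walk M X"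
    and t: "0 < t" "t \<le> pi"
  shows "char_int P t \<noteq> 1"
proof
  assume 1: "char_int P t = 1"
  obtain n where "0 < measure M {\<omega> \<in> space M. walk X 0 n \<omega> = 1}"
    using assms(4) unfolding irreducible_walk_def by blast
  then have supp: "1 \<in> set_pmf (walk_pmf P n)" unfolding measure_walk[OF assms(1-3)] by (simp add: pmf_positive_iff)
  have "char_int (walk_pmf P n) t = 1" by (simp add: char_walk_pmf 1)
  then have "measure_pmf.expectation (walk_pmf P n) (\<lambda>k. cos (t * real_of_int k)) = 1"
    by (simp flip: Re_char_int)
  then have "measure_pmf.expectation (walk_pmf P n) (\<lambda>k. 1 - cos (t * real_of_int k)) = 0"
    by (simp add: integrable_cos_sin)
  then have "AE k in measure_pmf (walk_pmf P n). 1 - cos (t * real_of_int k) = 0"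
    by (subst (asm) integral_nonneg_eq_0_iff_AE) (auto simp: integrable_cos_sin)
  then have "cos t = 1" using supp by (auto simp: AE_measure_pmf_iff)
  moreover have "cos t < cos 0" using t by (intro cos_monotone_0_pi) auto
  ultimately show False by simp
qed

theorem proposition58:
  fixes M :: "'a measure" and X :: "nat \<Rightarrow> 'a \<Rightarrow> int"
  assumes "prob_space M"
    and "iid M X"
    and "irreducible_walk M X"
    and "integrable M (\<lambda>\<omega>. real_of_int (X 0 \<omega>))"
    and "(LINT \<omega>|M. real_of_int (X 0 \<omega>)) = 0"
    and "(\<integral>\<^sup>+\<omega>. ennreal ((real_of_int (X 0 \<omega>))\<^sup>2) \<partial>M) = \<infinity>"
    and "measure M {\<omega> \<in> space M. X 0 \<omega> \<ge> 2} > 0"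
    and "((\<lambda>x. m_plus M X x / m_total M X x) \<longlongrightarrow> 0) at_top"
  shows "asymp_equiv_subject M X
           (\<lambda>Q R x. measure M {\<omega> \<in> space M.
              hitting_time X x (UNIV - {-Q<..<R}) \<omega> < hitting_time X x {0} \<omega>})
           (\<lambda>Q R x. potential_dagger M X x * (1 - hitting_distribution M X 0 {-Q, 0, R} 0)) \<and>
         asymp_equiv_subject M X
           (\<lambda>Q R x. potential_dagger M X x * (1 - hitting_distribution M X 0 {-Q, 0, R} 0))
           (\<lambda>Q R x. potential_dagger M X x *
              (potential M X (Q + R) / (potential M X Q * potential M X R)))"
proof -
  obtain P where P: "measure_pmf P = distr M (count_space UNIV) (X 0)" by (rule pmf_of_law[OF assms(1,2)])
  note law = assms(1,2) P
  note [measurable] = iid_measurable[OF assms(1,2)]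
  have int: "integrable (measure_pmf P) real_of_int" unfolding P using assms(4) by (simp add: integrable_distr_eq)
  have sq: "(\<integral>\<^sup>+k. ennreal ((real_of_int k)\<^sup>2) \<partial>measure_pmf P) = \<infinity>"
    unfolding P using assms(6) by (simp add: nn_integral_distr)
  have prob: "measure_pmf.prob P {k. Q k} = measure M {\<omega> \<in> space M. Q (X 0 \<omega>)}" for Q
    unfolding P by (subst measure_distr) (auto intro!: arg_cong[of _ _ "measure M"])
  have plus: "m_plus M X = integrated_tail P"
    by (simp add: fun_eq_iff m_plus_def eta_plus_def mu_plus_def integrated_tail_def prob)
  have "measure_pmf.prob (map_pmf uminus P) {k. y < real_of_int k} = mu_minus M X y" for y
  proof -
    have "measure_pmf.prob (map_pmf uminus P) {k. y < real_of_int k} = measure_pmf.prob P {k. real_of_int k < - y}"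
      by (auto simp: vimage_def intro!: arg_cong[of _ _ "measure_pmf.prob P"])
    then show ?thesis by (simp add: prob mu_minus_def)
  qed
  then have minus: "m_minus M X = integrated_tail (map_pmf uminus P)"
    by (simp add: fun_eq_iff m_minus_def eta_minus_def integrated_tail_def)
  interpret centred_law P
  proof
    show "integrable (measure_pmf P) real_of_int" by (rule int)
    show "measure_pmf.expectation P real_of_int = 0" unfolding P using assms(5) by (simp add: integral_distr)
    show top: "filterlim (dtail P) at_top sequentially" by (rule dtail_diverges[OF int sq])
    show "(\<lambda>n. pos_dtail P n / dtail P n) \<longlonglongrightarrow> 0"
      using assms(8) unfolding m_total_def plus minus by (rule pos_dtail_ratio_tendsto_0[OF int top])
    show "char_int P t \<noteq> 1" if "0 < t" "t \<le> pi" for t by (rule char_int_neq_1[OF law assms(3) that])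
  qed
  have pot: "potential M X x = pot x" for x unfolding potential_def pot_def measure_walk[OF law] ..
  have potd: "potential_dagger M X x = potd x" for x by (simp add: potential_dagger_def potd_def pot)
  have esc: "1 - hitting_distribution M X 0 {- Q, 0, R} 0 = esc Q R 0" for Q R
    using arg_cong[OF hitting_distribution_eq[OF law, of 0 "{- Q, 0, R}" 0], of enn2real]
    by (simp add: esc_def hitting_distribution_def)
  have exit: "measure M {\<omega> \<in> space M. hitting_time X x (UNIV - {- Q<..<R}) \<omega> < hitting_time X x {0} \<omega>} = exit_prob Q R x"
    if "0 < Q" "0 < R" for Q R x
    using arg_cong[OF measure_hitting_time_less[OF law, of "UNIV - {- Q<..<R}" x], of enn2real] that
    by (simp add: exit_prob_def)
  show ?thesis
  proof
    show "asymp_equiv_subject M X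
           (\<lambda>Q R x. measure M {\<omega> \<in> space M.
              hitting_time X x (UNIV - {-Q<..<R}) \<omega> < hitting_time X x {0} \<omega>})
           (\<lambda>Q R x. potential_dagger M X x * (1 - hitting_distribution M X 0 {-Q, 0, R} 0))"
      unfolding asymp_equiv_subject_def pot potd esc
    proof (intro allI impI)
      fix \<epsilon> :: real assume "0 < \<epsilon>"
      then obtain \<delta> N where "0 < \<delta>" and *: "\<And>Q R x. 0 < Q \<Longrightarrow> 0 < R \<Longrightarrow> N \<le> Q \<Longrightarrow> N \<le> R \<Longrightarrow> - Q < x \<Longrightarrow> x < R \<Longrightarrow>
         potd x \<noteq> 0 \<Longrightarrow> \<bar>pot Q - pot (x + Q)\<bar> + \<bar>pot (- R) - pot (x - R)\<bar> \<le> \<delta> * potd x \<Longrightarrow>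
         \<bar>exit_prob Q R x / (potd x * esc Q R 0) - 1\<bar> < \<epsilon>" by (rule exit_asymp) blast
      then show "\<exists>\<delta>>0. \<exists>N. \<forall>Q R x. 0 < Q \<longrightarrow> 0 < R \<longrightarrow> N \<le> min Q R \<longrightarrow> - Q < x \<longrightarrow> x < R \<longrightarrow> potd x \<noteq> 0 \<longrightarrow>
          \<bar>pot Q - pot (x + Q)\<bar> + \<bar>pot (- R) - pot (x - R)\<bar> \<le> \<delta> * potd x \<longrightarrow>
          \<bar>measure M {\<omega> \<in> space M. hitting_time X x (UNIV - {- Q<..<R}) \<omega> < hitting_time X x {0} \<omega>}
            / (potd x * esc Q R 0) - 1\<bar> < \<epsilon>"
        unfolding min.bounded_iff using exit by (intro exI[of _ \<delta>] conjI exI[of _ N] allI impI) simp_all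
    qed
    show "asymp_equiv_subject M X
           (\<lambda>Q R x. potential_dagger M X x * (1 - hitting_distribution M X 0 {-Q, 0, R} 0))
           (\<lambda>Q R x. potential_dagger M X x *
              (potential M X (Q + R) / (potential M X Q * potential M X R)))"
      unfolding asymp_equiv_subject_def pot potd esc
    proof (intro allI impI)
      fix \<epsilon> :: real assume "0 < \<epsilon>"
      then obtain N where "\<And>Q R x. 0 < Q \<Longrightarrow> 0 < R \<Longrightarrow> N \<le> Q \<Longrightarrow> N \<le> R \<Longrightarrow> potd x \<noteq> 0 \<Longrightarrow>
         \<bar>potd x * esc Q R 0 / (potd x * (pot (Q + R) / (pot Q * pot R))) - 1\<bar> < \<epsilon>" by (rule esc_asymp) blast
      then show "\<exists>\<delta>>0. \<exists>N. \<forall>Q R x. 0 < Q \<longrightarrow> 0 < R \<longrightarrow> N \<le> min Q R \<longrightarrow> - Q < x \<longrightarrow> x < R \<longrightarrow> potd x \<noteq> 0 \<longrightarrow>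
          \<bar>pot Q - pot (x + Q)\<bar> + \<bar>pot (- R) - pot (x - R)\<bar> \<le> \<delta> * potd x \<longrightarrow>
          \<bar>potd x * esc Q R 0 / (potd x * (pot (Q + R) / (pot Q * pot R))) - 1\<bar> < \<epsilon>"
        unfolding min.bounded_iff by (intro exI[of _ 1] conjI exI[of _ N] allI impI) simp_all
    qed
  qed
qed

end
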